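(* Let $G$ be a diffeological group. If a diffeological space $X$ has the property that there is a bijection $[B,X] \to \mathrm{Prin}_G^D(B)$, for all diffeological spaces $B$, which is natural in $B$, then $X$ is smoothly homotopy equivalent to $BG$.
   Context: A diffeological space is a set $X$ with a specified set of functions $U \to X$ (plots) for each open $U \subseteq \mathbb{R}^n$, $n \in \mathbb{N}$, such that constant functions are plots, precomposing a plot $U\to X$ with a smooth map $V \to U$ between open subsets of Euclidean spaces gives a plot, and a function $U\to X$ that is locally a plot is a plot. A map $f : X \to Y$ is smooth if $f\circ p$ is a plot of $Y$ for every plot $p$ of $X$; a diffeomorphism is an invertible smooth map with smooth inverse. $\mathbb{R}$ carries the standard diffeology (plots are the usual smooth maps). A function into a product is a plot iff its components are; subsets carry the sub-diffeology (plots of the ambient space landing in the subset); a quotient $X/{\sim}$ has the quotient diffeology (functions that locally lift to plots of $X$). A subset $A \subseteq X$ is $D$-open if $p^{-1}(A)$ is open for every plot $p$; these sets form the $D$-topology. The pullback of $\pi : E \to B$ along smooth $f : B' \to B$ is $f^*(E) = \{(b',x) \in B' \times E : f(b') = \pi(x)\} \to B'$ with the sub-diffeology of the product. A diffeological group is a diffeological space with a group structure whose operations are smooth. Let $G$ be a diffeological group, $\pi : E \to B$ a smooth map, and let $G$ act smoothly on $E$ from the right with $\pi(x\cdot g)=\pi(x)$. Then $\pi$ is a trivial principal $G$-bundle if there is a $G$-equivariant diffeomorphism $E \to B \times G$ over $B$ (with $(b,g)\cdot g' = (b,gg')$); locally trivial if $B$ has a $D$-open cover $\{B_i\}$ such that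 each $\pi^{-1}(B_i) \to B_i$ is trivial; and a principal $G$-bundle if its pullback along every plot of $B$ is a locally trivial principal $G$-bundle. Two principal $G$-bundles over $B$ are isomorphic if there is a $G$-equivariant diffeomorphism between their total spaces over $B$. A smooth partition of unity on $X$ is a family of smooth functions $\mu_i : X \to \mathbb{R}$, $i \in I$, with $\mu_i \geq 0$, with $\{\operatorname{supp}(\mu_i)\}$ locally finite (each point has a $D$-open neighbourhood meeting only finitely many of them) and $\sum_i \mu_i = 1$, where $\operatorname{supp}(\mu_i)$ is the closure of $\mu_i^{-1}((0,\infty))$ in the $D$-topology. It is subordinate to a collection $\{X_i\}_{i\in I}$ if $\operatorname{supp}(\mu_i) \subseteq X_i$ for each $i$. A principal $G$-bundle $\pi : E \to B$ is $D$-numerable if there is a smooth partition of unity subordinate to a $D$-open cover $\{B_i\}$ of $B$ such that each $\pi^{-1}(B_i) \to B_i$ is a trivial principal $G$-bundle. $\mathrm{Prin}_G^D(B)$ is the set of isomorphism classes of $D$-numerable principal $G$-bundles over $B$, contravariantly functorial in $B$ via pullback. Construction of $BG$: $\Delta^\omega = \{(t_0,t_1,\ldots) \in \oplus_\omega \mathbb{R} : \sum_i t_i = 1,\ t_i \geq 0 \text{ for all } i\}$, with the diffeology in which $t : U \to \Delta^\omega$ is a plot iff each component $t_i : U \to \mathbb{R}$ is smooth and each $u \in U$ has an open neighbourhood $V$ and an $n \in \mathbb{N}$ with $t_i|_V = 0$ for all $i > n$. $EG$ is the quotient diffeological space of $\Delta^\omega \times \prod_\omega G$ by the equivalence relation $(t_i,g_i)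 \sim (t_i',g_i')$ iff $t_i = t_i'$ for every $i$ and $g_i = g_i'$ whenever $t_i = t_i' \neq 0$. $G$ acts smoothly on $EG$ on the right by $[t_i,g_i]\cdot g = [t_i, g_i g]$, and $BG$ is the orbit space $EG/G$ with the quotient diffeology. Smooth maps $f,g: X \to Y$ are smoothly homotopic if there is a smooth $F : X \times \mathbb{R} \to Y$ with $F(x,0)=f(x)$, $F(x,1)=g(x)$ for all $x$; $[X,Y]$ is the set of smooth homotopy classes of smooth maps. $X$ and $Y$ are smoothly homotopy equivalent if there are smooth maps $X \to Y$ and $Y \to X$ whose two composites are smoothly homotopic to the identities. *)

theory Defs
  imports "HOL-Analysis.Analysis" "HOL-Algebra.Group"
begin

section \<open>Smooth maps between open subsets of Euclidean spaces\<close>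

text \<open>
  Plots have domains in Euclidean spaces of every dimension, so the dimension has to be a term
  and not a type.  We use the library's \<^const>\<open>Euclidean_space\<close>: its points are the functions
  \<^typ>\<open>nat \<Rightarrow> real\<close> that vanish from index \<open>n\<close> on, and its topology is the product topology.
  The i-th partial derivative at \<open>x\<close> is the derivative of \<open>h \<mapsto> f (x(i := h))\<close> at \<open>x i\<close>.
\<close>

fun Ck_on :: "nat \<Rightarrow> nat \<Rightarrow> (nat \<Rightarrow> real) set \<Rightarrow> ((nat \<Rightarrow> real) \<Rightarrow> real) \<Rightarrow> bool" where
  "Ck_on 0 n U f \<longleftrightarrow> continuous_map (subtopology (Euclidean_space n) U) euclideanreal f"
| "Ck_on (Suc k) n U f \<longleftrightarrow>
     continuous_map (subtopology (Euclidean_space n) U) euclideanreal f \<and>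
     (\<exists>f'. \<forall>i<n.
        (\<forall>x\<in>U. ((\<lambda>h. f (x(i := h))) has_real_derivative f' i x) (at (x i))) \<and>
        Ck_on k n U (f' i))"

definition smooth_fun_on :: "nat \<Rightarrow> (nat \<Rightarrow> real) set \<Rightarrow> ((nat \<Rightarrow> real) \<Rightarrow> real) \<Rightarrow> bool" where
  "smooth_fun_on n U f \<longleftrightarrow> (\<forall>k. Ck_on k n U f)"

definition euclid_smooth ::
  "nat \<Rightarrow> (nat \<Rightarrow> real) set \<Rightarrow> nat \<Rightarrow> (nat \<Rightarrow> real) set \<Rightarrow> ((nat \<Rightarrow> real) \<Rightarrow> (nat \<Rightarrow> real)) \<Rightarrow> bool" where
  "euclid_smooth m V n U f \<longleftrightarrow>
     openin (Euclidean_space m) V \<and> openin (Euclidean_space n) U \<and>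
     f \<in> V \<rightarrow> U \<and> (\<forall>j<n. smooth_fun_on m V (\<lambda>v. f v j))"


section \<open>Diffeological spaces\<close>

text \<open>
  \<open>plot X n U p\<close> says that \<open>p\<close> is a plot of \<open>X\<close> with domain the open set \<open>U\<close> of n-space.
  HOL functions are total; \<open>plot_cong\<close> says that the values of \<open>p\<close> outside \<open>U\<close> are irrelevant.
\<close>

record 'a dspace =
  pts :: "'a set"
  plot :: "nat \<Rightarrow> (nat \<Rightarrow> real) set \<Rightarrow> ((nat \<Rightarrow> real) \<Rightarrow> 'a) \<Rightarrow> bool"

locale diffeological_space =
  fixes X :: "'a dspace"
  assumes plot_domain: "plot X n U p \<Longrightarrow> openin (Euclidean_space n) U"
    and plot_range: "plot X n U p \<Longrightarrow> p \<in> U \<rightarrow> pts X"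
    and plot_cong: "plot X n U p \<Longrightarrow> (\<And>u. u \<in> U \<Longrightarrow> q u = p u) \<Longrightarrow> plot X n U q"
    and plot_const: "openin (Euclidean_space n) U \<Longrightarrow> x \<in> pts X \<Longrightarrow> plot X n U (\<lambda>u. x)"
    and plot_compose: "plot X n U p \<Longrightarrow> euclid_smooth m V n U f \<Longrightarrow> plot X m V (p \<circ> f)"
    and plot_local: "openin (Euclidean_space n) U \<Longrightarrow>
       (\<And>u. u \<in> U \<Longrightarrow> \<exists>V. openin (Euclidean_space n) V \<and> u \<in> V \<and> V \<subseteq> U \<and> plot X n V p) \<Longrightarrow>
       plot X n U p"

definition smooth :: "'a dspace \<Rightarrow> 'b dspace \<Rightarrow> ('a \<Rightarrow> 'b) \<Rightarrow> bool" where
  "smooth X Y f \<longleftrightarrow>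
     f \<in> pts X \<rightarrow> pts Y \<and> (\<forall>n U p. plot X n U p \<longrightarrow> plot Y n U (f \<circ> p))"

definition diffeomorphism :: "'a dspace \<Rightarrow> 'b dspace \<Rightarrow> ('a \<Rightarrow> 'b) \<Rightarrow> bool" where
  "diffeomorphism X Y f \<longleftrightarrow>
     smooth X Y f \<and>
     (\<exists>g. smooth Y X g \<and> (\<forall>x\<in>pts X. g (f x) = x) \<and> (\<forall>y\<in>pts Y. f (g y) = y))"

definition real_dspace :: "real dspace" where
  "real_dspace = \<lparr>pts = UNIV,
     plot = (\<lambda>n U p. openin (Euclidean_space n) U \<and> smooth_fun_on n U p)\<rparr>"

definition euclid_dspace :: "nat \<Rightarrow> (nat \<Rightarrow> real) set \<Rightarrow> (nat \<Rightarrow> real) dspace" where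
  "euclid_dspace n U = \<lparr>pts = U, plot = (\<lambda>m V p. euclid_smooth m V n U p)\<rparr>"

definition prod_dspace :: "'a dspace \<Rightarrow> 'b dspace \<Rightarrow> ('a \<times> 'b) dspace" where
  "prod_dspace X Y = \<lparr>pts = pts X \<times> pts Y,
     plot = (\<lambda>n U p. plot X n U (fst \<circ> p) \<and> plot Y n U (snd \<circ> p))\<rparr>"

definition seq_dspace :: "'a dspace \<Rightarrow> (nat \<Rightarrow> 'a) dspace" where
  "seq_dspace X = \<lparr>pts = {s. \<forall>i. s i \<in> pts X},
     plot = (\<lambda>n U p. \<forall>i. plot X n U (\<lambda>u. p u i))\<rparr>"

definition sub_dspace :: "'a dspace \<Rightarrow> 'a set \<Rightarrow> 'a dspace" where
  "sub_dspace X A = \<lparr>pts = pts X \<inter> A,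
     plot = (\<lambda>n U p. plot X n U p \<and> p \<in> U \<rightarrow> A)\<rparr>"

definition quot_dspace :: "'a dspace \<Rightarrow> ('a \<times> 'a) set \<Rightarrow> 'a set dspace" where
  "quot_dspace X r = \<lparr>pts = pts X // r,
     plot = (\<lambda>n U p. openin (Euclidean_space n) U \<and>
       (\<forall>u\<in>U. \<exists>V q. openin (Euclidean_space n) V \<and> u \<in> V \<and> V \<subseteq> U \<and>
          plot X n V q \<and> (\<forall>v\<in>V. p v = r `` {q v})))\<rparr>"

definition D_open :: "'a dspace \<Rightarrow> 'a set \<Rightarrow> bool" where
  "D_open X A \<longleftrightarrow>
     A \<subseteq> pts X \<and> (\<forall>n U p. plot X n U p \<longrightarrow> openin (Euclidean_space n) {u\<in>U. p u \<in> A})"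

definition D_topology :: "'a dspace \<Rightarrow> 'a topology" where
  "D_topology X = topology (D_open X)"

lemma openin_D_topology: "openin (D_topology X) = D_open X"
proof -
  have "D_open X (S \<inter> T)" if "D_open X S" "D_open X T" for S T
    unfolding D_open_def
  proof (intro conjI allI impI)
    show "S \<inter> T \<subseteq> pts X"
      using that by (auto simp: D_open_def)
    fix n U p
    assume "plot X n U p"
    then have "openin (Euclidean_space n) ({u\<in>U. p u \<in> S} \<inter> {u\<in>U. p u \<in> T})"
      using that unfolding D_open_def by (intro openin_Int) auto
    also have "{u\<in>U. p u \<in> S} \<inter> {u\<in>U. p u \<in> T} = {u\<in>U. p u \<in> S \<inter> T}"
      by auto
    finally show "openin (Euclidean_space n) {u\<in>U. p u \<in> S \<inter> T}" .
  qed
  moreover have "D_open X (\<Union>\<K>)" if "\<forall>K\<in>\<K>. D_open X K" for \<K>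
    unfolding D_open_def
  proof (intro conjI allI impI)
    show "\<Union>\<K> \<subseteq> pts X"
      using that by (auto simp: D_open_def)
    fix n U p
    assume "plot X n U p"
    then have "openin (Euclidean_space n) (\<Union>K\<in>\<K>. {u\<in>U. p u \<in> K})"
      using that unfolding D_open_def by (intro openin_Union) auto
    also have "(\<Union>K\<in>\<K>. {u\<in>U. p u \<in> K}) = {u\<in>U. p u \<in> \<Union>\<K>}"
      by auto
    finally show "openin (Euclidean_space n) {u\<in>U. p u \<in> \<Union>\<K>}" .
  qed
  ultimately show ?thesis
    unfolding D_topology_def by (intro topology_inverse') (auto simp: istopology_def)
qed


section \<open>Smooth homotopy\<close>

definition smoothly_homotopic :: "'a dspace \<Rightarrow> 'b dspace \<Rightarrow> ('a \<Rightarrow> 'b) \<Rightarrow> ('a \<Rightarrow> 'b) \<Rightarrow> bool" where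
  "smoothly_homotopic X Y f g \<longleftrightarrow>
     (\<exists>F. smooth (prod_dspace X real_dspace) Y F \<and>
        (\<forall>x\<in>pts X. F (x, 0) = f x \<and> F (x, 1) = g x))"

definition htpy_rel :: "'a dspace \<Rightarrow> 'b dspace \<Rightarrow> (('a \<Rightarrow> 'b) \<times> ('a \<Rightarrow> 'b)) set" where
  "htpy_rel X Y = {(f, g). smooth X Y f \<and> smooth X Y g \<and> smoothly_homotopic X Y f g}"

definition htpy_classes :: "'a dspace \<Rightarrow> 'b dspace \<Rightarrow> ('a \<Rightarrow> 'b) set set" where
  "htpy_classes X Y = {f. smooth X Y f} // htpy_rel X Y"

definition smoothly_homotopy_equivalent :: "'a dspace \<Rightarrow> 'b dspace \<Rightarrow> bool" where
  "smoothly_homotopy_equivalent X Y \<longleftrightarrow>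
     (\<exists>f g. smooth X Y f \<and> smooth Y X g \<and>
        smoothly_homotopic X X (g \<circ> f) (\<lambda>x. x) \<and>
        smoothly_homotopic Y Y (f \<circ> g) (\<lambda>y. y))"


section \<open>Diffeological groups and principal bundles\<close>

record 'g dgroup = "'g monoid" +
  gplot :: "nat \<Rightarrow> (nat \<Rightarrow> real) set \<Rightarrow> ((nat \<Rightarrow> real) \<Rightarrow> 'g) \<Rightarrow> bool"

definition space_of :: "'g dgroup \<Rightarrow> 'g dspace" where
  "space_of G = \<lparr>pts = carrier G, plot = gplot G\<rparr>"

definition diffeological_group :: "'g dgroup \<Rightarrow> bool" where
  "diffeological_group G \<longleftrightarrow>
     group G \<and> diffeological_space (space_of G) \<and>
     smooth (prod_dspace (space_of G) (space_of G)) (space_of G) (\<lambda>(x, y). x \<otimes>\<^bsub>G\<^esub> y) \<and>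
     smooth (space_of G) (space_of G) (\<lambda>x. inv\<^bsub>G\<^esub> x)"

definition smooth_right_action :: "'g dgroup \<Rightarrow> 'e dspace \<Rightarrow> ('e \<Rightarrow> 'g \<Rightarrow> 'e) \<Rightarrow> bool" where
  "smooth_right_action G E a \<longleftrightarrow>
     smooth (prod_dspace E (space_of G)) E (\<lambda>(x, g). a x g) \<and>
     (\<forall>x\<in>pts E. a x \<one>\<^bsub>G\<^esub> = x) \<and>
     (\<forall>x\<in>pts E. \<forall>g\<in>carrier G. \<forall>h\<in>carrier G. a (a x g) h = a x (g \<otimes>\<^bsub>G\<^esub> h))"

record ('e, 'b, 'g) gbundle =
  tot :: "'e dspace"
  prj :: "'e \<Rightarrow> 'b"
  act :: "'e \<Rightarrow> 'g \<Rightarrow> 'e"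

definition G_space_over :: "'g dgroup \<Rightarrow> 'b dspace \<Rightarrow> ('e, 'b, 'g) gbundle \<Rightarrow> bool" where
  "G_space_over G B P \<longleftrightarrow>
     diffeological_space (tot P) \<and> smooth (tot P) B (prj P) \<and>
     smooth_right_action G (tot P) (act P) \<and>
     (\<forall>x\<in>pts (tot P). \<forall>g\<in>carrier G. prj P (act P x g) = prj P x)"

definition bundle_isomorphic ::
  "'g dgroup \<Rightarrow> ('e, 'b, 'g) gbundle \<Rightarrow> ('f, 'b, 'g) gbundle \<Rightarrow> bool" where
  "bundle_isomorphic G P Q \<longleftrightarrow>
     (\<exists>\<phi>. diffeomorphism (tot P) (tot Q) \<phi> \<and>
        (\<forall>x\<in>pts (tot P). prj Q (\<phi> x) = prj P x) \<and>
        (\<forall>x\<in>pts (tot P). \<forall>g\<in>carrier G. \<phi> (act P x g) = act Q (\<phi> x) g))"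

definition product_bundle :: "'g dgroup \<Rightarrow> 'b dspace \<Rightarrow> ('b \<times> 'g, 'b, 'g) gbundle" where
  "product_bundle G B =
     \<lparr>tot = prod_dspace B (space_of G), prj = fst, act = (\<lambda>(b, g) g'. (b, g \<otimes>\<^bsub>G\<^esub> g'))\<rparr>"

definition trivial_bundle :: "'g dgroup \<Rightarrow> 'b dspace \<Rightarrow> ('e, 'b, 'g) gbundle \<Rightarrow> bool" where
  "trivial_bundle G B P \<longleftrightarrow>
     G_space_over G B P \<and> bundle_isomorphic G P (product_bundle G B)"

definition restrict_bundle :: "('e, 'b, 'g) gbundle \<Rightarrow> 'b set \<Rightarrow> ('e, 'b, 'g) gbundle" where
  "restrict_bundle P A =
     \<lparr>tot = sub_dspace (tot P) {x. prj P x \<in> A}, prj = prj P, act = act P\<rparr>"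

definition locally_trivial_bundle :: "'g dgroup \<Rightarrow> 'b dspace \<Rightarrow> ('e, 'b, 'g) gbundle \<Rightarrow> bool" where
  "locally_trivial_bundle G B P \<longleftrightarrow>
     G_space_over G B P \<and>
     (\<exists>\<A>. (\<forall>A\<in>\<A>. D_open B A \<and> trivial_bundle G (sub_dspace B A) (restrict_bundle P A)) \<and>
          \<Union>\<A> = pts B)"

definition pullback_bundle ::
  "('c \<Rightarrow> 'b) \<Rightarrow> 'c dspace \<Rightarrow> ('e, 'b, 'g) gbundle \<Rightarrow> ('c \<times> 'e, 'c, 'g) gbundle" where
  "pullback_bundle f B' P =
     \<lparr>tot = sub_dspace (prod_dspace B' (tot P)) {(b', x). f b' = prj P x},
      prj = fst, act = (\<lambda>(b', x) g. (b', act P x g))\<rparr>"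

definition principal_bundle :: "'g dgroup \<Rightarrow> 'b dspace \<Rightarrow> ('e, 'b, 'g) gbundle \<Rightarrow> bool" where
  "principal_bundle G B P \<longleftrightarrow>
     G_space_over G B P \<and>
     (\<forall>n U p. plot B n U p \<longrightarrow>
        locally_trivial_bundle G (euclid_dspace n U) (pullback_bundle p (euclid_dspace n U) P))"


section \<open>Smooth partitions of unity and D-numerable bundles\<close>

definition D_supp :: "'a dspace \<Rightarrow> ('a \<Rightarrow> real) \<Rightarrow> 'a set" where
  "D_supp X f = D_topology X closure_of {x\<in>pts X. f x > 0}"

definition smooth_partition_of_unity :: "'a dspace \<Rightarrow> 'i set \<Rightarrow> ('i \<Rightarrow> 'a \<Rightarrow> real) \<Rightarrow> bool" where
  "smooth_partition_of_unity X I \<mu> \<longleftrightarrow>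
     (\<forall>i\<in>I. smooth X real_dspace (\<mu> i) \<and> (\<forall>x\<in>pts X. \<mu> i x \<ge> 0)) \<and>
     (\<forall>x\<in>pts X. \<exists>N. D_open X N \<and> x \<in> N \<and> finite {i\<in>I. D_supp X (\<mu> i) \<inter> N \<noteq> {}}) \<and>
     (\<forall>x\<in>pts X. (\<Sum>i | i \<in> I \<and> \<mu> i x \<noteq> 0. \<mu> i x) = 1)"

text \<open>
  The index sets are subsets of \<^typ>\<open>'b \<times> nat\<close>, where \<^typ>\<open>'b\<close> carries the base.  This loses
  nothing: members with \<open>\<mu>\<^sub>i = 0\<close> can be dropped together with their \<open>B\<^sub>i\<close> (the supports of the
  others still cover \<open>B\<close>), and by local finiteness at most countably (in fact finitely) many of
  the remaining indices belong to each point of the base, so they inject into \<^typ>\<open>'b \<times> nat\<close>.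
\<close>

definition D_numerable :: "'g dgroup \<Rightarrow> 'b dspace \<Rightarrow> ('e, 'b, 'g) gbundle \<Rightarrow> bool" where
  "D_numerable G B P \<longleftrightarrow>
     principal_bundle G B P \<and>
     (\<exists>(I :: ('b \<times> nat) set) A \<mu>.
        (\<forall>i\<in>I. D_open B (A i) \<and> trivial_bundle G (sub_dspace B (A i)) (restrict_bundle P (A i))) \<and>
        (\<Union>i\<in>I. A i) = pts B \<and>
        smooth_partition_of_unity B I \<mu> \<and>
        (\<forall>i\<in>I. D_supp B (\<mu> i) \<subseteq> A i))"

text \<open>
  The isomorphism classes are formed among bundles whose total space has its points in a given
  type \<^typ>\<open>'e\<close>.  A pullback along \<open>f : B' \<rightarrow> B\<close> has total space in another type, so the induced map
  sends a class \<open>c\<close> to the class of all bundles over \<open>B'\<close> with total space in \<^typ>\<open>'e\<close> that are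
  isomorphic to the pullback of a member of \<open>c\<close>.  The fibres of a D-numerable bundle are
  in bijection with the group, so every D-numerable bundle has an isomorphic copy with total
  space in \<^typ>\<open>'e\<close> as soon as the product of base and group injects into \<^typ>\<open>'e\<close>.  If all
  spaces, including the group, have their points in one type \<^typ>\<open>'u\<close>, this holds whenever
  \<^typ>\<open>'u\<close> is infinite; if \<^typ>\<open>'u\<close> is at least as large as the reals, it also has room for
  copies of \<open>EG\<close> and \<open>BG\<close>.
\<close>

definition bundle_rel ::
  "'g dgroup \<Rightarrow> 'b dspace \<Rightarrow> (('e, 'b, 'g) gbundle \<times> ('e, 'b, 'g) gbundle) set" where
  "bundle_rel G B = {(P, Q). D_numerable G B P \<and> D_numerable G B Q \<and> bundle_isomorphic G P Q}"

definition Prin :: "'g dgroup \<Rightarrow> 'b dspace \<Rightarrow> ('e, 'b, 'g) gbundle set set" where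
  "Prin G B = {P. D_numerable G B P} // bundle_rel G B"

definition Prin_map :: "'g dgroup \<Rightarrow> 'c dspace \<Rightarrow> ('c \<Rightarrow> 'b) \<Rightarrow>
    ('e, 'b, 'g) gbundle set \<Rightarrow> ('e, 'c, 'g) gbundle set" where
  "Prin_map G B' f c =
     {Q. D_numerable G B' Q \<and> (\<exists>P\<in>c. bundle_isomorphic G Q (pullback_bundle f B' P))}"


section \<open>The spaces EG and BG\<close>

definition Delta_omega :: "(nat \<Rightarrow> real) dspace" where
  "Delta_omega = \<lparr>
     pts = {t. finite {i. t i \<noteq> 0} \<and> (\<Sum>i | t i \<noteq> 0. t i) = 1 \<and> (\<forall>i. t i \<ge> 0)},
     plot = (\<lambda>n U p. openin (Euclidean_space n) U \<and>
       p \<in> U \<rightarrow> {t. finite {i. t i \<noteq> 0} \<and> (\<Sum>i | t i \<noteq> 0. t i) = 1 \<and> (\<forall>i. t i \<ge> 0)} \<and>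
       (\<forall>i. smooth_fun_on n U (\<lambda>u. p u i)) \<and>
       (\<forall>u\<in>U. \<exists>V N. openin (Euclidean_space n) V \<and> u \<in> V \<and> V \<subseteq> U \<and>
          (\<forall>i>N. \<forall>v\<in>V. p v i = 0)))\<rparr>"

definition pre_EG :: "'g dgroup \<Rightarrow> ((nat \<Rightarrow> real) \<times> (nat \<Rightarrow> 'g)) dspace" where
  "pre_EG G = prod_dspace Delta_omega (seq_dspace (space_of G))"

definition EG_rel :: "'g dgroup \<Rightarrow>
    (((nat \<Rightarrow> real) \<times> (nat \<Rightarrow> 'g)) \<times> ((nat \<Rightarrow> real) \<times> (nat \<Rightarrow> 'g))) set" where
  "EG_rel G = {((t, g), (t', g')).
     (t, g) \<in> pts (pre_EG G) \<and> (t', g') \<in> pts (pre_EG G) \<and>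
     (\<forall>i. t i = t' i) \<and> (\<forall>i. t i = t' i \<and> t i \<noteq> 0 \<longrightarrow> g i = g' i)}"

definition EG :: "'g dgroup \<Rightarrow> ((nat \<Rightarrow> real) \<times> (nat \<Rightarrow> 'g)) set dspace" where
  "EG G = quot_dspace (pre_EG G) (EG_rel G)"

definition EG_act :: "'g dgroup \<Rightarrow>
    ((nat \<Rightarrow> real) \<times> (nat \<Rightarrow> 'g)) set \<Rightarrow> 'g \<Rightarrow> ((nat \<Rightarrow> real) \<times> (nat \<Rightarrow> 'g)) set" where
  "EG_act G c a = EG_rel G `` {(t, \<lambda>i. g i \<otimes>\<^bsub>G\<^esub> a) | t g. (t, g) \<in> c}"

definition orbit_rel :: "'g dgroup \<Rightarrow> 'e dspace \<Rightarrow> ('e \<Rightarrow> 'g \<Rightarrow> 'e) \<Rightarrow> ('e \<times> 'e) set" where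
  "orbit_rel G E a = {(x, y). x \<in> pts E \<and> y \<in> pts E \<and> (\<exists>g\<in>carrier G. y = a x g)}"

definition BG :: "'g dgroup \<Rightarrow> ((nat \<Rightarrow> real) \<times> (nat \<Rightarrow> 'g)) set set dspace" where
  "BG G = quot_dspace (EG G) (orbit_rel G (EG G) (EG_act G))"

end

theory Submission
  imports Defs
begin

text \<open>As in the Yoneda lemma, the class of \<open>id\<close> gives a bundle \<open>P\<close> over \<open>X\<close> through which all
  D-numerable bundles are pulled back, uniquely up to homotopy. Since \<open>X\<close> already has the homotopy
  invariance, of \<open>BG\<close> one only needs that \<open>EG \<rightarrow> BG\<close> is D-numerable, that every D-numerable bundle
  has an equivariant smooth map to \<open>EG\<close>, and that an equivariant smooth self-map of \<open>EG\<close> covers a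
  self-map of \<open>BG\<close> homotopic to the identity.

  A D-numerable bundle is the same as a bundle with countably many smooth functions
  \<open>f\<^sub>k \<ge> 0\<close> on the base, positive somewhere at each point, and equivariant smooth maps \<open>\<gamma>\<^sub>k\<close> to \<open>G\<close> over
  \<open>{f\<^sub>k > 0}\<close>. For \<open>EG\<close> these are the coordinates \<open>t\<^sub>k\<close> and \<open>g\<^sub>k\<close>; in general they assemble, after passing to a
  partition of unity, to a map to \<open>EG\<close>. For the third point, any two equivariant maps become
  homotopic by linear interpolation after their coordinates have been moved to disjoint sets of
  positions, and moving the coordinates is itself an equivariant homotopy.\<close>

section \<open>Functions of class Ck\<close>

text \<open>On \<open>X\<close> the composite of the two maps is compared with the identity by the
  injectivity of \<Phi>. On \<open>BG\<close> nothing comparable is given, since \<Phi> describes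
  maps into \<open>X\<close> only; there the homotopy is built by hand, equivariantly on
  \<open>EG\<close>, and pushed down along \<open>EG \<times> R \<rightarrow> BG \<times> R\<close>.

  A group coordinate of a point of \<open>EG\<close> is meaningless where its weight is 0, and it
  can jump only there. So a homotopy must empty a position before another coordinate enters it,
  which dictates disjoint time windows and targets on odd or even positions. Infinitely many windows
  accumulate at time 1; this is harmless because on a plot only finitely many weights are nonzero
  near a given point.

  Smoothness is defined by iterated partial derivatives, so even composing a plot with a smooth map
  rests on a chain rule for them.

  The hypothesis is available only for bases and total spaces on the type \<open>'u\<close>, while
  \<open>EG\<close> and \<open>BG\<close> live on types of sets. It is applied to copies along
  injections into \<open>'u\<close>; these exist because a point of \<open>EG\<close> amounts to a
  finite list of reals and group elements.\<close>

abbreviation eopen :: "nat \<Rightarrow> (nat \<Rightarrow> real) set \<Rightarrow> bool" where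
  "eopen n U \<equiv> openin (Euclidean_space n) U"

definition pd :: "nat \<Rightarrow> ((nat \<Rightarrow> real) \<Rightarrow> real) \<Rightarrow> (nat \<Rightarrow> real) \<Rightarrow> real" where
  "pd i f x = deriv (\<lambda>h. f (x(i := h))) (x i)"

lemma Euclidean_space_top_of_set: "Euclidean_space n = top_of_set {x. \<forall>i\<ge>n. x i = 0}"
  by (simp add: Euclidean_space_def euclidean_product_topology)

lemma eopen_iff: "eopen n U \<longleftrightarrow> (\<exists>T. open T \<and> U = {x. \<forall>i\<ge>n. x i = 0} \<inter> T)"
  by (simp add: Euclidean_space_top_of_set openin_open)

lemma eopen_zero: "eopen n U \<Longrightarrow> x \<in> U \<Longrightarrow> i \<ge> n \<Longrightarrow> x i = 0"
  by (auto simp: eopen_iff)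

lemma subtopology_eopen: "eopen n U \<Longrightarrow> subtopology (Euclidean_space n) U = top_of_set U"
  unfolding Euclidean_space_top_of_set subtopology_subtopology
  using openin_subset[of "top_of_set {x. \<forall>i\<ge>n. x i = 0}" U] by (simp add: Int_absorb1)

lemma continuous_map_eopen_iff:
  "eopen n U \<Longrightarrow> continuous_map (subtopology (Euclidean_space n) U) euclideanreal f \<longleftrightarrow> continuous_on U f"
  by (simp add: subtopology_eopen)

lemma eopen_preimage:
  fixes f :: "(nat \<Rightarrow> real) \<Rightarrow> 'a::topological_space"
  assumes "eopen n U" "continuous_on U f" "open S"
  shows "eopen n {x\<in>U. f x \<in> S}"
proof -
  have "openin (top_of_set U) (U \<inter> f -` S)"
    using assms by (meson continuous_openin_preimage_gen)
  then have "openin (subtopology (Euclidean_space n) U) (U \<inter> f -` S)"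
    using assms(1) by (simp add: subtopology_eopen)
  then have "eopen n (U \<inter> f -` S)"
    using assms(1) by (simp add: openin_open_subtopology)
  moreover have "U \<inter> f -` S = {x\<in>U. f x \<in> S}" by auto
  ultimately show ?thesis by simp
qed

lemma continuous_on_fun_upd: "continuous_on UNIV (\<lambda>h::real. (x::nat \<Rightarrow> real)(i := h))"
  proof (rule continuous_on_coordinatewise_then_product)
  fix j show "continuous_on UNIV (\<lambda>h. (x(i := h)) j)"
    by (cases "j = i") auto
qed

text \<open>The bound \<open>i < n\<close> keeps the updated point in the subspace of functions
  vanishing from \<open>n\<close> on. This is what makes the one-variable derivatives in
  \<open>Ck_on\<close> local in \<open>U\<close>.\<close>

lemma eopen_eventually_upd:
  assumes "eopen n U" "x \<in> U" "i < n"
  shows "\<forall>\<^sub>F h in nhds (x i). x(i := h) \<in> U"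
proof -
  obtain T where T: "open T" "U = {x. \<forall>i\<ge>n. x i = 0} \<inter> T"
    using assms by (auto simp: eopen_iff)
  have "open ((\<lambda>h. x(i := h)) -` T)"
    using continuous_on_fun_upd T(1) by (metis continuous_on_open_vimage open_UNIV inf_top_right)
  then have "\<forall>\<^sub>F h in nhds (x i). h \<in> (\<lambda>h. x(i := h)) -` T"
    using assms T by (intro eventually_nhds_in_open) auto
  then show ?thesis
    using assms T by (auto elim!: eventually_mono)
qed

text \<open>A basic open set of the product topology restricts only finitely many coordinates, so
  one radius serves all of them.\<close>

lemma eopen_box:
  assumes "eopen n U" "x \<in> U"
  shows "\<exists>\<delta>>0. \<forall>y. (\<forall>i\<ge>n. y i = 0) \<longrightarrow> (\<forall>i<n. \<bar>y i - x i\<bar> < \<delta>) \<longrightarrow> y \<in> U"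
proof -
  obtain T where T: "open T" "U = {x. \<forall>i\<ge>n. x i = 0} \<inter> T"
    using assms by (auto simp: eopen_iff)
  have "openin (powertop_real UNIV) T"
    using T by (simp add: euclidean_product_topology)
  then obtain X where X: "x \<in> PiE UNIV X" "\<And>i. openin euclideanreal (X i)" "PiE UNIV X \<subseteq> T"
      "finite {i. X i \<noteq> UNIV}"
    using product_topology_open_contains_basis[of "\<lambda>_. euclideanreal" UNIV T x] assms T by auto
  have "\<forall>i. \<exists>d>0. ball (x i) d \<subseteq> X i"
    using X by (metis PiE_UNIV_domain UNIV_I open_contains_ball open_openin Pi_iff)
  then obtain d where d: "\<And>i. d i > 0" "\<And>i. ball (x i) (d i) \<subseteq> X i"
    by metis
  let ?D = "{i. X i \<noteq> UNIV}"
  \<comment> \<open>The inserted 1 covers the case that no coordinate is restricted.\<close>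
  define \<delta> where "\<delta> = Min (insert 1 (d ` ?D))"
  have "\<delta> > 0" using X(4) d by (auto simp: \<delta>_def)
  moreover have "y \<in> U" if y: "\<forall>i\<ge>n. y i = 0" "\<forall>i<n. \<bar>y i - x i\<bar> < \<delta>" for y
  proof -
    have "y i \<in> X i" for i
    proof (cases "X i = UNIV")
      case False
      have "\<bar>y i - x i\<bar> < \<delta>"
        using y eopen_zero[OF assms, of i] \<open>\<delta> > 0\<close> by (cases "i < n") auto
      moreover have "\<delta> \<le> d i"
        unfolding \<delta>_def using False X(4) by (intro Min_le) auto
      ultimately have "y i \<in> ball (x i) (d i)"
        by (auto simp: dist_real_def abs_minus_commute)
      then show ?thesis using d by blast
    qed auto
    then show ?thesis using X(3) T y by auto
  qed
  ultimately show ?thesis by blast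
qed

lemma deriv_transfer_on:
  assumes "eopen n U" "\<And>x. x \<in> U \<Longrightarrow> f x = g x" "x \<in> U" "i < n"
  shows "((\<lambda>h. f (x(i := h))) has_real_derivative D) (at (x i)) \<longleftrightarrow>
         ((\<lambda>h. g (x(i := h))) has_real_derivative D) (at (x i))"
proof (rule DERIV_cong_ev)
  show "\<forall>\<^sub>F h in nhds (x i). f (x(i := h)) = g (x(i := h))"
    using eopen_eventually_upd[OF assms(1,3,4)] assms(2) by (auto elim: eventually_mono)
qed auto

text \<open>No induction: the two functions have the same derivatives on \<open>U\<close>, so the
  same witnesses \<open>f'\<close> serve both.\<close>

lemma Ck_on_cong:
  assumes "eopen n U" "\<And>x. x \<in> U \<Longrightarrow> f x = g x" "Ck_on k n U f"
  shows "Ck_on k n U g"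
proof -
  have c: "continuous_on U f \<longleftrightarrow> continuous_on U g"
    using assms(2) by (intro continuous_on_cong) auto
  show ?thesis
  proof (cases k)
    case 0
    then show ?thesis using assms(3) by (simp add: continuous_map_eopen_iff[OF assms(1)] c)
  next
    case (Suc l)
    have "(\<forall>x\<in>U. ((\<lambda>h. f (x(i := h))) has_real_derivative f' x) (at (x i))) =
      (\<forall>x\<in>U. ((\<lambda>h. g (x(i := h))) has_real_derivative f' x) (at (x i)))" if "i < n" for i f'
      using deriv_transfer_on[of n U f g, OF assms(1,2) _ that] by (intro ball_cong) auto
    then show ?thesis
      using assms(3) unfolding Suc by (simp add: continuous_map_eopen_iff[OF assms(1)] c)
  qed
qed

text \<open>A one-variable derivative is unique, so the existential witness in \<open>Ck_on\<close>
  agrees on \<open>U\<close> with \<open>pd\<close>, and \<open>Ck_on_cong\<close> exchanges them.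
  Later inductions work with these canonical derivatives instead of the defining equation.\<close>

lemma Ck_on_Suc_iff:
  assumes U: "eopen n U"
  shows "Ck_on (Suc k) n U f \<longleftrightarrow> continuous_on U f \<and>
    (\<forall>i<n. (\<forall>x\<in>U. ((\<lambda>h. f (x(i := h))) has_real_derivative pd i f x) (at (x i))) \<and> Ck_on k n U (pd i f))"
    (is "?L \<longleftrightarrow> ?R")
proof
  assume ?L
  then obtain f' where f': "\<And>i x. i < n \<Longrightarrow> x \<in> U \<Longrightarrow> ((\<lambda>h. f (x(i := h))) has_real_derivative f' i x) (at (x i))"
      "\<And>i. i < n \<Longrightarrow> Ck_on k n U (f' i)" and c: "continuous_on U f"
    by (auto simp: continuous_map_eopen_iff[OF U])
  have *: "f' i x = pd i f x" if "i < n" "x \<in> U" for i x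
    unfolding pd_def using f'(1)[OF that] by (metis DERIV_imp_deriv)
  show ?R
    using f' c * Ck_on_cong[OF U *] by auto
next
  assume ?R
  then show ?L
    by (simp add: continuous_map_eopen_iff[OF U]) (intro exI[of _ "\<lambda>i. pd i f"], simp)
qed

declare Ck_on.simps(2) [simp del]

lemma Ck_on_0_iff: "eopen n U \<Longrightarrow> Ck_on 0 n U f \<longleftrightarrow> continuous_on U f"
  by (simp add: continuous_map_eopen_iff)

lemma Ck_on_continuous: "eopen n U \<Longrightarrow> Ck_on k n U f \<Longrightarrow> continuous_on U f"
  by (cases k) (auto simp: Ck_on_Suc_iff continuous_map_eopen_iff)

lemma Ck_on_SucD: "eopen n U \<Longrightarrow> Ck_on (Suc k) n U f \<Longrightarrow> Ck_on k n U f"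
proof (induction k arbitrary: f)
  case 0
  then show ?case using Ck_on_continuous[of n U "Suc 0" f] by (simp add: continuous_map_eopen_iff)
next
  case (Suc k)
  show ?case
    using Suc.prems Suc.IH unfolding Ck_on_Suc_iff[OF Suc.prems(1), of "Suc k"] Ck_on_Suc_iff[OF Suc.prems(1), of k]
    by blast
qed

lemma Ck_onI:
  assumes "eopen n U" "continuous_on U f"
    and "\<And>i x. i < n \<Longrightarrow> x \<in> U \<Longrightarrow> ((\<lambda>h. f (x(i := h))) has_real_derivative f' i x) (at (x i))"
    and "\<And>i. i < n \<Longrightarrow> Ck_on k n U (f' i)"
  shows "Ck_on (Suc k) n U f"
  using assms by (auto simp: Ck_on.simps(2) continuous_map_eopen_iff)

lemma Ck_on_pd:
  assumes "eopen n U" "Ck_on (Suc k) n U f" "i < n"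
  shows "Ck_on k n U (pd i f)"
    and "x \<in> U \<Longrightarrow> ((\<lambda>h. f (x(i := h))) has_real_derivative pd i f x) (at (x i))"
  using assms by (auto simp: Ck_on_Suc_iff)

lemma Ck_on_const: "eopen n U \<Longrightarrow> Ck_on k n U (\<lambda>x. c)"
proof (induction k arbitrary: c)
  case 0
  then show ?case by simp
next
  case (Suc k)
  then show ?case by (intro Ck_onI[where f' = "\<lambda>i x. 0"]) auto
qed

lemma Ck_on_add: "eopen n U \<Longrightarrow> Ck_on k n U f \<Longrightarrow> Ck_on k n U g \<Longrightarrow> Ck_on k n U (\<lambda>x. f x + g x)"
proof (induction k arbitrary: f g)
  case 0
  then show ?case unfolding Ck_on_0_iff[OF 0(1)] by (intro continuous_intros)
next
  case (Suc k)
  show ?case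
  proof (rule Ck_onI[where f' = "\<lambda>i x. pd i f x + pd i g x"])
    show "continuous_on U (\<lambda>x. f x + g x)"
      using Suc.prems Ck_on_continuous continuous_on_add by metis
    fix i x assume "i < n" "x \<in> U"
    then show "((\<lambda>h. f (x(i := h)) + g (x(i := h))) has_real_derivative pd i f x + pd i g x) (at (x i))"
      using Suc.prems by (intro DERIV_add Ck_on_pd)
  qed (use Suc in \<open>simp_all add: Ck_on_pd(1)\<close>)
qed

lemma Ck_on_mult: "eopen n U \<Longrightarrow> Ck_on k n U f \<Longrightarrow> Ck_on k n U g \<Longrightarrow> Ck_on k n U (\<lambda>x. f x * g x)"
proof (induction k arbitrary: f g)
  case 0
  then show ?case unfolding Ck_on_0_iff[OF 0(1)] by (intro continuous_intros)
next
  case (Suc k)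
  note D = Ck_on_SucD[OF Suc.prems(1)]
  show ?case
  proof (rule Ck_onI[where f' = "\<lambda>i x. pd i f x * g x + pd i g x * f x"])
    show "continuous_on U (\<lambda>x. f x * g x)"
      using Suc.prems Ck_on_continuous by (blast intro: continuous_on_mult)
    fix i x assume i: "i < n" "x \<in> U"
    have "((\<lambda>h. f (x(i := h)) * g (x(i := h))) has_real_derivative
         pd i f x * g (x(i := x i)) + pd i g x * f (x(i := x i))) (at (x i))"
      using Suc.prems i by (intro DERIV_mult Ck_on_pd)
    then show "((\<lambda>h. f (x(i := h)) * g (x(i := h))) has_real_derivative
         pd i f x * g x + pd i g x * f x) (at (x i))" by simp
  next
    fix i assume "i < n"
    then show "Ck_on k n U (\<lambda>x. pd i f x * g x + pd i g x * f x)"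
      using Suc.prems D Suc.IH by (intro Ck_on_add) (simp_all add: Ck_on_pd(1))
  qed (use Suc in auto)
qed

lemma Ck_on_sum:
  assumes "eopen n U" "finite I" "\<And>i. i \<in> I \<Longrightarrow> Ck_on k n U (f i)"
  shows "Ck_on k n U (\<lambda>x. \<Sum>i\<in>I. f i x)"
  using assms(2,3)
proof (induction rule: finite_induct)
  case (insert i F)
  then show ?case using assms(1) by (simp add: Ck_on_add)
qed (use assms(1) in \<open>auto intro: Ck_on_const\<close>)

lemma Ck_on_subset:
  "eopen n U \<Longrightarrow> eopen n V \<Longrightarrow> V \<subseteq> U \<Longrightarrow> Ck_on k n U f \<Longrightarrow> Ck_on k n V f"
proof (induction k arbitrary: f)
  case 0
  then show ?case by (auto simp: continuous_map_eopen_iff intro: continuous_on_subset)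
next
  case (Suc k)
  show ?case
  proof (rule Ck_onI[where f' = "\<lambda>i. pd i f"])
    show "continuous_on V f"
      using Suc.prems Ck_on_continuous continuous_on_subset by metis
    fix i x assume "i < n" "x \<in> V"
    then show "((\<lambda>h. f (x(i := h))) has_real_derivative pd i f x) (at (x i))"
      using Suc.prems by (intro Ck_on_pd(2)[of n U k f i x]) auto
  qed (use Suc in \<open>simp_all add: Ck_on_pd(1)\<close>)
qed

text \<open>The partial derivatives are those of one global function \<open>pd i f\<close>, so local
  statements about them glue by induction; the topological argument is confined to
  continuity.\<close>

lemma Ck_on_local:
  assumes U: "eopen n U" and loc: "\<And>u. u \<in> U \<Longrightarrow> \<exists>V. eopen n V \<and> u \<in> V \<and> V \<subseteq> U \<and> Ck_on k n V f"
  shows "Ck_on k n U f"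
proof -
  have cont: "continuous_on U f"
    if *: "\<And>u. u \<in> U \<Longrightarrow> \<exists>V. eopen n V \<and> u \<in> V \<and> V \<subseteq> U \<and> continuous_on V f" for f
    unfolding continuous_on_eq_continuous_within
  proof
    fix u assume u: "u \<in> U"
    then obtain V where V: "eopen n V" "u \<in> V" "V \<subseteq> U" "continuous_on V f" using * by blast
    obtain T where T: "open T" "V = {x. \<forall>i\<ge>n. x i = 0} \<inter> T"
      using V(1) by (auto simp: eopen_iff)
    have "U \<subseteq> {x. \<forall>i\<ge>n. x i = 0}" using eopen_zero[OF U] by auto
    \<comment> \<open>\<open>U\<close> and \<open>V\<close> coincide inside the open set
      \<open>T\<close>, because both lie in the subspace of functions vanishing from
      \<open>n\<close> on.\<close>
    then have "at u within U = at u within V"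
      using V T by (intro at_within_nhd[of u T]) auto
    then show "continuous (at u within U) f"
      using V by (simp add: continuous_on_eq_continuous_within continuous_within)
  qed
  show ?thesis
    using loc
  proof (induction k arbitrary: f)
    case 0
    have "continuous_on U f"
    proof (rule cont)
      fix u assume "u \<in> U"
      then show "\<exists>V. eopen n V \<and> u \<in> V \<and> V \<subseteq> U \<and> continuous_on V f"
        using 0[of u] Ck_on_continuous by blast
    qed
    then show ?case using U by (simp add: continuous_map_eopen_iff)
  next
    case (Suc k)
    show ?case
    proof (rule Ck_onI[OF U])
      show "continuous_on U f"
      proof (rule cont)
        fix u assume "u \<in> U"
        then show "\<exists>V. eopen n V \<and> u \<in> V \<and> V \<subseteq> U \<and> continuous_on V f"
          using Suc.prems[of u] Ck_on_continuous by blast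
      qed
      fix i x assume "i < n" "x \<in> U"
      then show "((\<lambda>h. f (x(i := h))) has_real_derivative pd i f x) (at (x i))"
        using Suc.prems[of x] by (auto intro: Ck_on_pd(2)[of n _ k])
    next
      fix i assume i: "i < n"
      show "Ck_on k n U (pd i f)"
      proof (rule Suc.IH)
        fix u assume "u \<in> U"
        then show "\<exists>V. eopen n V \<and> u \<in> V \<and> V \<subseteq> U \<and> Ck_on k n V (pd i f)"
          using Suc.prems[of u] i Ck_on_pd(1)[of n _ k f i] by auto
      qed
    qed
  qed
qed

lemma Ck_on_proj: "eopen n U \<Longrightarrow> Ck_on k n U (\<lambda>x. x j)"
proof (cases k)
  case 0
  assume "eopen n U"
  then show ?thesis unfolding 0 by (subst Ck_on_0_iff) (auto intro: continuous_on_subset[OF continuous_on_product_coordinates])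
next
  case (Suc l)
  assume U: "eopen n U"
  show ?thesis
    unfolding Suc
  proof (rule Ck_onI[OF U, where f' = "\<lambda>i x. if i = j then 1 else 0"])
    show "continuous_on U (\<lambda>x. x j)"
      by (rule continuous_on_subset[OF continuous_on_product_coordinates]) auto
  next
    fix i x assume "i < n" "x \<in> U"
    show "((\<lambda>h. (x(i := h)) j) has_real_derivative (if i = j then 1 else 0)) (at (x i))"
      by (cases "i = j") auto
  qed (use Ck_on_const[OF U] in auto)
qed

text \<open>Differentiating \<open>\<phi> \<circ> u\<close> only produces further members of the family times derivatives of
  \<open>u\<close>, so no chain rule for higher derivatives is needed.\<close>

lemma Ck_on_compose_real:
  assumes "eopen n U" "open S"
    and fam: "\<And>\<phi>. \<phi> \<in> \<F> \<Longrightarrow> \<exists>\<phi>'\<in>\<F>. \<forall>x\<in>S. (\<phi> has_real_derivative \<phi>' x) (at x)"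
    and "\<phi> \<in> \<F>" "u \<in> U \<rightarrow> S" "Ck_on k n U u"
  shows "Ck_on k n U (\<lambda>x. \<phi> (u x))"
  using assms(4,6)
proof (induction k arbitrary: \<phi>)
  have cont: "continuous_on U (\<lambda>x. \<phi> (u x))" if "\<phi> \<in> \<F>" "continuous_on U u" for \<phi>
  proof -
    have "continuous_on S \<phi>"
      using fam[OF that(1)] by (meson DERIV_continuous_on has_field_derivative_at_within)
    then show ?thesis using that(2) assms(5) by (auto intro: continuous_on_compose2)
  qed
  {
    case 0
    then show ?case using cont assms(1) by (simp add: continuous_map_eopen_iff)
  next
    case (Suc k)
    obtain \<phi>' where \<phi>': "\<phi>' \<in> \<F>" "\<And>x. x \<in> S \<Longrightarrow> (\<phi> has_real_derivative \<phi>' x) (at x)"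
      using fam Suc.prems by blast
    note u = Suc.prems(2)
    show ?case
    proof (rule Ck_onI[OF assms(1), where f' = "\<lambda>i x. \<phi>' (u x) * pd i u x"])
      show "continuous_on U (\<lambda>x. \<phi> (u x))"
        using Suc.prems(1) u assms(1) cont by (blast intro: Ck_on_continuous)
      fix i x assume i: "i < n" "x \<in> U"
      have "((\<lambda>h. u (x(i := h))) has_real_derivative pd i u x) (at (x i))"
        using u i assms(1) by (auto intro: Ck_on_pd(2)[of n _ k])
      then show "((\<lambda>h. \<phi> (u (x(i := h)))) has_real_derivative \<phi>' (u x) * pd i u x) (at (x i))"
        using \<phi>'(2)[of "u x"] i assms(5) by (intro DERIV_chain2[where f = \<phi>]) auto
    next
      fix i assume "i < n"
      then show "Ck_on k n U (\<lambda>x. \<phi>' (u x) * pd i u x)"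
        using u assms(1) \<phi>'(1) Suc.IH by (intro Ck_on_mult) (auto intro: Ck_on_pd Ck_on_SucD)
    qed
  }
qed

lemma Ck_on_inverse:
  assumes "eopen n U" "Ck_on k n U u" "\<And>x. x \<in> U \<Longrightarrow> u x \<noteq> 0"
  shows "Ck_on k n U (\<lambda>x. inverse (u x))"
proof -
  \<comment> \<open>Closed under differentiation away from 0; for \<open>m = 0\<close> the
    derivative is the member with coefficient 0.\<close>
  let ?F = "range (\<lambda>(c, m) x::real. c * inverse x ^ m)"
  have "\<exists>\<phi>'\<in>?F. \<forall>x\<in>-{0}. (\<phi> has_real_derivative \<phi>' x) (at x)" if F: "\<phi> \<in> ?F" for \<phi>
  proof -
    obtain c m where \<phi>: "\<phi> = (\<lambda>x. c * inverse x ^ m)" using F by auto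
    have "(\<phi> has_real_derivative (- c * real m) * inverse x ^ (m + 1)) (at x)" if "x \<in> -{0}" for x
      unfolding \<phi> using that
      by (auto intro!: derivative_eq_intros simp: power_Suc[symmetric] simp del: power_Suc)
    moreover have "(\<lambda>x. (- c * real m) * inverse x ^ (m + 1)) \<in> ?F"
      by (rule image_eqI[of _ _ "(- c * real m, m + 1)"]) auto
    ultimately show ?thesis by (rule_tac bexI) auto
  qed
  moreover have "(\<lambda>x::real. 1 * inverse x ^ 1) \<in> ?F"
    by (rule image_eqI[of _ _ "(1, 1)"]) auto
  ultimately have "Ck_on k n U (\<lambda>x. 1 * inverse (u x) ^ 1)"
    using assms by (intro Ck_on_compose_real[of n U "-{0}" ?F "\<lambda>x. 1 * inverse x ^ 1" u k]) (simp_all add: Pi_iff open_Compl)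
  then show ?thesis by simp
qed

section \<open>The flat function exp(-1/x)\<close>

definition flat :: "real \<Rightarrow> real" where
  "flat x = (if x > 0 then exp (- inverse x) else 0)"

lemma flat_pos: "flat x > 0 \<longleftrightarrow> x > 0" and flat_nonneg: "flat x \<ge> 0"
  and flat_zero: "x \<le> 0 \<Longrightarrow> flat x = 0"
  by (auto simp: flat_def)

text \<open>Put y = 1/x, so dy/dx = -y^2: the derivative of p(y) exp(-y) is y^2 (p - p')(y) exp(-y),
  and \<open>[:0, 0, 1:]\<close> is y^2. At 0 the exponential beats every polynomial. The family is
  therefore closed under differentiation on the whole line.\<close>

lemma flat_family_deriv:
  fixes p :: "real poly"
  defines "\<phi> \<equiv> \<lambda>p x::real. if x > 0 then poly p (inverse x) * exp (- inverse x) else 0"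
  shows "(\<phi> p has_real_derivative \<phi> ([:0, 0, 1:] * (p - pderiv p)) x) (at x)"
proof -
  consider "x > 0" | "x < 0" | "x = 0" by linarith
  then show ?thesis
  proof cases
    case 1
    have "((\<lambda>x. poly p (inverse x) * exp (- inverse x)) has_real_derivative
       \<phi> ([:0, 0, 1:] * (p - pderiv p)) x) (at x)"
      using 1 unfolding \<phi>_def
      by (auto intro!: derivative_eq_intros simp: algebra_simps power2_eq_square)
    then show ?thesis
      using 1 by (rule_tac has_field_derivative_transform_within_open[where S = "{0<..}"]) (auto simp: \<phi>_def)
  next
    case 2
    have "((\<lambda>x. 0) has_real_derivative \<phi> ([:0, 0, 1:] * (p - pderiv p)) x) (at x)"
      using 2 by (auto simp: \<phi>_def)
    then show ?thesis
      using 2 by (rule_tac has_field_derivative_transform_within_open[where S = "{..<0}"]) (auto simp: \<phi>_def)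
  next
    case 3
    have lim: "((\<lambda>y. poly q y / exp y) \<longlongrightarrow> 0) at_top" for q :: "real poly"
    proof -
      have "((\<lambda>y. \<Sum>i\<le>degree q. coeff q i * (y ^ i / exp y)) \<longlongrightarrow> (\<Sum>i\<le>degree q. coeff q i * 0)) at_top"
        by (intro tendsto_sum tendsto_mult tendsto_const tendsto_power_div_exp_0)
      then show ?thesis
        by (simp add: poly_altdef sum_divide_distrib)
    qed
    \<comment> \<open>\<open>pCons 0 p\<close> is y p(y): the extra factor y is the division by
      \<open>h\<close> in the difference quotient.\<close>
    have "((\<lambda>x. poly (pCons 0 p) (inverse x) / exp (inverse x)) \<longlongrightarrow> 0) (at_right 0)"
      using lim[of "pCons 0 p"] filterlim_inverse_at_top_right by (rule filterlim_compose)
    then have r: "((\<lambda>h. (\<phi> p h - \<phi> p 0) / h) \<longlongrightarrow> 0) (at_right 0)"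
    proof (rule Lim_transform_eventually)
      show "\<forall>\<^sub>F h in at_right 0. poly (pCons 0 p) (inverse h) / exp (inverse h) = (\<phi> p h - \<phi> p 0) / h"
        by (auto simp: eventually_at_filter \<phi>_def exp_minus field_simps)
    qed
    have l: "((\<lambda>h. (\<phi> p h - \<phi> p 0) / h) \<longlongrightarrow> 0) (at_left 0)"
    proof (rule Lim_transform_eventually[of "\<lambda>_. 0"])
      show "\<forall>\<^sub>F h in at_left 0. 0 = (\<phi> p h - \<phi> p 0) / h"
        by (auto simp: eventually_at_filter \<phi>_def)
    qed auto
    have "((\<lambda>h. (\<phi> p h - \<phi> p 0) / h) \<longlongrightarrow> 0) (at 0)"
      using l r by (simp add: filterlim_split_at)
    moreover have "\<phi> ([:0, 0, 1:] * (p - pderiv p)) 0 = 0"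
      by (simp add: \<phi>_def)
    ultimately show ?thesis using 3 by (simp add: DERIV_def)
  qed
qed

lemma Ck_on_flat:
  assumes "eopen n U" "Ck_on k n U u"
  shows "Ck_on k n U (\<lambda>x. flat (u x))"
proof -
  let ?\<phi> = "\<lambda>(p::real poly) x. if x > 0 then poly p (inverse x) * exp (- inverse x) else (0::real)"
  have "Ck_on k n U (\<lambda>x. ?\<phi> 1 (u x))"
  proof (rule Ck_on_compose_real[of n U UNIV "range ?\<phi>" "?\<phi> 1" u k])
    fix \<phi> assume "\<phi> \<in> range ?\<phi>"
    then obtain p where "\<phi> = ?\<phi> p" by blast
    then show "\<exists>\<phi>'\<in>range ?\<phi>. \<forall>x\<in>UNIV. (\<phi> has_real_derivative \<phi>' x) (at x)"
      using flat_family_deriv[of p] by (intro bexI[of _ "?\<phi> ([:0, 0, 1:] * (p - pderiv p))"]) auto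
  qed (use assms in auto)
  then show ?thesis by (simp add: flat_def cong: if_cong)
qed

section \<open>The chain rule in several variables\<close>

lemma partial_mvt:
  fixes f :: "(nat \<Rightarrow> real) \<Rightarrow> real"
  assumes der: "\<And>y. y \<in> closed_segment a b \<Longrightarrow>
      ((\<lambda>h. f (z(j := h))) has_real_derivative pd j f (z(j := y))) (at y)"
  shows "\<exists>\<xi>\<in>closed_segment a b. f (z(j := b)) - f (z(j := a)) = (b - a) * pd j f (z(j := \<xi>))"
proof -
  let ?g = "\<lambda>h. f (z(j := h))" and ?g' = "\<lambda>y. pd j f (z(j := y))"
  consider "a < b" | "b < a" | "a = b" by linarith
  then show ?thesis
  proof cases
    case 1
    then have "\<exists>y>a. y < b \<and> ?g b - ?g a = (b - a) * ?g' y"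
      by (intro MVT2 der) (auto simp: closed_segment_eq_real_ivl)
    then show ?thesis using 1 by (auto simp: closed_segment_eq_real_ivl intro!: bexI)
  next
    case 2
    then have "\<exists>y>b. y < a \<and> ?g a - ?g b = (a - b) * ?g' y"
      by (intro MVT2 der) (auto simp: closed_segment_eq_real_ivl)
    then obtain y where y: "b < y" "y < a" "?g a - ?g b = (a - b) * ?g' y" by blast
    then have "?g b - ?g a = (b - a) * ?g' y" by (simp add: algebra_simps)
    with y show ?thesis by (intro bexI[of _ y]) (auto simp: closed_segment_eq_real_ivl)
  next
    case 3
    then show ?thesis by (intro bexI[of _ a]) auto
  qed
qed

text \<open>Existence and continuity of the partial derivatives give differentiability along curves: the
  increment of \<open>f\<close> is split into increments in single coordinates, to which the mean value theorem
  applies.\<close>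

lemma has_real_derivative_along_curve:
  fixes f :: "(nat \<Rightarrow> real) \<Rightarrow> real" and c :: "real \<Rightarrow> nat \<Rightarrow> real"
  assumes U: "eopen n U"
    and der: "\<And>i x. i < n \<Longrightarrow> x \<in> U \<Longrightarrow> ((\<lambda>h. f (x(i := h))) has_real_derivative pd i f x) (at (x i))"
    and cont: "\<And>i. i < n \<Longrightarrow> continuous_on U (pd i f)"
    and c0: "c h0 \<in> U" and cU: "\<forall>\<^sub>F h in nhds h0. c h \<in> U"
    and c: "\<And>j. j < n \<Longrightarrow> ((\<lambda>h. c h j) has_real_derivative c' j) (at h0)"
  shows "((\<lambda>h. f (c h)) has_real_derivative (\<Sum>j<n. pd j f (c h0) * c' j)) (at h0)"
proof -
  define x where "x = c h0"
  \<comment> \<open>The coordinates below \<open>j\<close> have already moved to the curve, the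
    others still sit at \<open>x\<close>; consecutive points differ in coordinate \<open>j\<close>
    only.\<close>
  define mix where "mix = (\<lambda>j h i. if i < j then c h i else x i)"
  have x: "x \<in> U" by (simp add: x_def c0)
  have x0: "x i = 0" if "i \<ge> n" for i using eopen_zero[OF U x that] .
  have clim: "((\<lambda>h. c h j) \<longlongrightarrow> x j) (at h0)" if "j < n" for j
    using DERIV_isCont[OF c[OF that]] by (simp add: isCont_def x_def)
  have near: "\<forall>\<^sub>F h in at h0. \<forall>i<n. \<bar>c h i - x i\<bar> < \<delta>" if "\<delta> > 0" for \<delta>
  proof -
    have "\<forall>i\<in>{..<n}. \<forall>\<^sub>F h in at h0. \<bar>c h i - x i\<bar> < \<delta>"
      using tendstoD[OF clim \<open>\<delta> > 0\<close>] by (auto simp: dist_real_def)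
    then show ?thesis
      by (subst (asm) eventually_ball_finite_distrib[symmetric]) (auto elim: eventually_mono)
  qed
  have seg: "\<bar>y - x j\<bar> \<le> \<bar>c h j - x j\<bar>" if "y \<in> closed_segment (x j) (c h j)" for y j h
    using that by (auto simp: closed_segment_eq_real_ivl split: if_splits)
  \<comment> \<open>All intermediate points lie in a coordinate box around \<open>x\<close>, hence
    in any prescribed neighbourhood \<open>W\<close>. It is used for \<open>U\<close> itself and for
    a set on which \<open>pd j f\<close> is nearly constant.\<close>
  have box: "\<exists>\<delta>>0. \<forall>h j y. (\<forall>i<n. \<bar>c h i - x i\<bar> < \<delta>) \<longrightarrow> j < n \<longrightarrow>
       y \<in> closed_segment (x j) (c h j) \<longrightarrow> (mix j h)(j := y) \<in> W" if W: "eopen n W" "x \<in> W" for W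
  proof -
    obtain \<delta> where \<delta>: "\<delta> > 0"
      "\<And>y. (\<And>i. i \<ge> n \<Longrightarrow> y i = 0) \<Longrightarrow> (\<And>i. i < n \<Longrightarrow> \<bar>y i - x i\<bar> < \<delta>) \<Longrightarrow> y \<in> W"
      using eopen_box[OF W] by blast
    have "(mix j h)(j := y) \<in> W"
      if "\<forall>i<n. \<bar>c h i - x i\<bar> < \<delta>" "j < n" "y \<in> closed_segment (x j) (c h j)" for h j y
    proof (rule \<delta>(2))
      fix i assume "i < n"
      then show "\<bar>((mix j h)(j := y)) i - x i\<bar> < \<delta>"
        using that seg[OF that(3)] \<delta>(1) by (auto simp: mix_def intro: le_less_trans)
    qed (use that x0 in \<open>auto simp: mix_def\<close>)
    then show ?thesis using \<delta>(1) by blast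
  qed
  obtain \<delta> where \<delta>: "\<delta> > 0" "\<And>h j y. (\<And>i. i < n \<Longrightarrow> \<bar>c h i - x i\<bar> < \<delta>) \<Longrightarrow> j < n \<Longrightarrow>
       y \<in> closed_segment (x j) (c h j) \<Longrightarrow> (mix j h)(j := y) \<in> U"
    using box[OF U x] by blast
  have mix_Suc: "mix (Suc j) h = (mix j h)(j := c h j)" "mix j h = (mix j h)(j := x j)" for j h
    by (auto simp: mix_def fun_eq_iff less_Suc_eq)
  have "\<exists>\<xi>. \<forall>j<n. \<forall>h. (\<forall>i<n. \<bar>c h i - x i\<bar> < \<delta>) \<longrightarrow> \<xi> j h \<in> closed_segment (x j) (c h j) \<and>
     f (mix (Suc j) h) - f (mix j h) = (c h j - x j) * pd j f ((mix j h)(j := \<xi> j h))"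
  proof -
    have "\<exists>\<xi>\<in>closed_segment (x j) (c h j).
        f (mix (Suc j) h) - f (mix j h) = (c h j - x j) * pd j f ((mix j h)(j := \<xi>))"
      if "j < n" "\<forall>i<n. \<bar>c h i - x i\<bar> < \<delta>" for j h
    proof -
      have "\<exists>\<xi>\<in>closed_segment (x j) (c h j).
        f ((mix j h)(j := c h j)) - f ((mix j h)(j := x j)) = (c h j - x j) * pd j f ((mix j h)(j := \<xi>))"
      proof (rule partial_mvt)
        fix y assume "y \<in> closed_segment (x j) (c h j)"
        then have "(mix j h)(j := y) \<in> U" using \<delta>(2) that by blast
        from der[OF that(1) this]
        show "((\<lambda>ha. f ((mix j h)(j := ha))) has_real_derivative pd j f ((mix j h)(j := y))) (at y)"
          by simp
      qed
      then show ?thesis using mix_Suc by metis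
    qed
    then show ?thesis by metis
  qed
  then obtain \<xi> where \<xi>: "\<And>j h. j < n \<Longrightarrow> (\<And>i. i < n \<Longrightarrow> \<bar>c h i - x i\<bar> < \<delta>) \<Longrightarrow>
       \<xi> j h \<in> closed_segment (x j) (c h j)"
     "\<And>j h. j < n \<Longrightarrow> (\<And>i. i < n \<Longrightarrow> \<bar>c h i - x i\<bar> < \<delta>) \<Longrightarrow>
       f (mix (Suc j) h) - f (mix j h) = (c h j - x j) * pd j f ((mix j h)(j := \<xi> j h))"
    by metis
  \<comment> \<open>The derivative at the point given by the mean value theorem; by continuity of
    \<open>pd j f\<close> it tends to the value at \<open>x\<close>.\<close>
  define q where "q = (\<lambda>j h. pd j f ((mix j h)(j := \<xi> j h)))"
  have q: "(q j \<longlongrightarrow> pd j f x) (at h0)" if j: "j < n" for j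
  proof (rule tendstoI)
    fix e :: real assume "e > 0"
    define W where "W = {y\<in>U. pd j f y \<in> ball (pd j f x) e}"
    have "eopen n W" "x \<in> W"
      using eopen_preimage[OF U cont[OF j] open_ball] x \<open>e > 0\<close> by (auto simp: W_def)
    then obtain \<delta>' where \<delta>': "\<delta>' > 0" "\<And>h j y. (\<And>i. i < n \<Longrightarrow> \<bar>c h i - x i\<bar> < \<delta>') \<Longrightarrow> j < n \<Longrightarrow>
       y \<in> closed_segment (x j) (c h j) \<Longrightarrow> (mix j h)(j := y) \<in> W"
      using box[of W] by blast
    show "\<forall>\<^sub>F h in at h0. dist (q j h) (pd j f x) < e"
      using near[OF \<delta>(1)] near[OF \<delta>'(1)]
    proof eventually_elim
      case (elim h)
      then have "(mix j h)(j := \<xi> j h) \<in> W"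
        using \<xi>(1) \<delta>'(2) j by blast
      then show ?case by (simp add: W_def q_def dist_commute)
    qed
  qed
  have "((\<lambda>h. \<Sum>j<n. ((c h j - c h0 j) / (h - h0)) * q j h) \<longlongrightarrow> (\<Sum>j<n. c' j * pd j f x)) (at h0)"
    using c q by (intro tendsto_sum tendsto_mult) (auto simp: has_field_derivative_iff)
  then have "((\<lambda>h. (f (c h) - f (c h0)) / (h - h0)) \<longlongrightarrow> (\<Sum>j<n. c' j * pd j f x)) (at h0)"
  proof (rule Lim_transform_eventually)
    have "\<forall>\<^sub>F h in at h0. c h \<in> U"
      using cU by (auto simp: eventually_at_filter elim: eventually_mono)
    then show "\<forall>\<^sub>F h in at h0. (\<Sum>j<n. ((c h j - c h0 j) / (h - h0)) * q j h) = (f (c h) - f (c h0)) / (h - h0)"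
      using near[OF \<delta>(1)]
    proof eventually_elim
      case (elim h)
      have "mix 0 h = x" by (simp add: mix_def)
      \<comment> \<open>From \<open>n\<close> on both sides are 0, as \<open>c h\<close> and
        \<open>x\<close> lie in \<open>U\<close>.\<close>
      moreover have "mix n h = c h"
        using eopen_zero[OF U elim(1)] x0 by (auto simp: mix_def fun_eq_iff not_less)
      ultimately have "f (c h) - f x = (\<Sum>j<n. f (mix (Suc j) h) - f (mix j h))"
        using sum_lessThan_telescope[of "\<lambda>j. f (mix j h)" n] by simp
      also have "\<dots> = (\<Sum>j<n. (c h j - x j) * q j h)"
        using \<xi>(2) elim(2) by (intro sum.cong) (auto simp: q_def)
      finally show ?case by (simp add: x_def sum_divide_distrib)
    qed
  qed
  then show ?thesis
    by (simp add: has_field_derivative_iff x_def mult.commute)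
qed

text \<open>Induction on \<open>k\<close> for all \<open>f\<close> at once: the first derivatives
  are sums of products of \<open>pd j f\<close> after \<phi> with derivatives of the coordinates of
  \<phi>, and the induction hypothesis applies to \<open>pd j f\<close>. Coordinates of \<phi> from
  \<open>n\<close> on are constantly 0.\<close>

lemma Ck_on_compose:
  assumes U: "eopen n U" and V: "eopen m V" and \<phi>: "\<phi> \<in> V \<rightarrow> U"
    and c\<phi>: "\<And>j. j < n \<Longrightarrow> Ck_on k m V (\<lambda>v. \<phi> v j)" and f: "Ck_on k n U f"
  shows "Ck_on k m V (\<lambda>v. f (\<phi> v))"
  using c\<phi> f
proof (induction k arbitrary: f)
  have cont: "continuous_on V (\<lambda>v. f (\<phi> v))"
    if "\<And>j. j < n \<Longrightarrow> continuous_on V (\<lambda>v. \<phi> v j)" "continuous_on U f" for f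
  proof -
    have "continuous_on V \<phi>"
    proof (rule continuous_on_coordinatewise_then_product)
      fix i
      show "continuous_on V (\<lambda>v. \<phi> v i)"
      proof (cases "i < n")
        case False
        then have "\<phi> v i = 0" if "v \<in> V" for v
          using eopen_zero[OF U] \<phi> that by (auto simp: Pi_iff)
        then show ?thesis by (simp cong: continuous_on_cong)
      qed (use that in auto)
    qed
    then show ?thesis using \<phi> by (auto intro: continuous_on_compose2[OF that(2)])
  qed
  {
    case 0
    then have "continuous_on V (\<lambda>v. f (\<phi> v))"
      by (rule_tac cont) (auto simp: continuous_map_eopen_iff[OF V] continuous_map_eopen_iff[OF U])
    then show ?case by (simp add: continuous_map_eopen_iff[OF V])
  next
    case (Suc k)
    note p = Suc.prems(1) and f = Suc.prems(2)
    show ?case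
    proof (rule Ck_onI[OF V, where f' = "\<lambda>i v. \<Sum>j<n. pd j f (\<phi> v) * pd i (\<lambda>v. \<phi> v j) v"])
      show "continuous_on V (\<lambda>v. f (\<phi> v))"
        using p f by (rule_tac cont) (auto intro: Ck_on_continuous[OF V] Ck_on_continuous[OF U])
      fix i v assume i: "i < m" "v \<in> V"
      have e: "\<phi> (v(i := v i)) = \<phi> v" by simp
      have "((\<lambda>h. f (\<phi> (v(i := h)))) has_real_derivative
        (\<Sum>j<n. pd j f (\<phi> (v(i := v i))) * pd i (\<lambda>v. \<phi> v j) v)) (at (v i))"
      proof (rule has_real_derivative_along_curve[OF U, of f "\<lambda>h. \<phi> (v(i := h))"])
        show "\<forall>\<^sub>F h in nhds (v i). \<phi> (v(i := h)) \<in> U"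
          using eopen_eventually_upd[OF V i(2,1)] \<phi> by (auto elim: eventually_mono)
        show "\<phi> (v(i := v i)) \<in> U" unfolding e using \<phi> i by auto
      next
        fix j x assume "j < n" "x \<in> U"
        then show "((\<lambda>h. f (x(j := h))) has_real_derivative pd j f x) (at (x j))"
          using f U by (intro Ck_on_pd(2))
      next
        fix j assume "j < n"
        then show "continuous_on U (pd j f)"
          using Ck_on_pd(1)[OF U f] Ck_on_continuous[OF U] by blast
      next
        fix j assume j: "j < n"
        show "((\<lambda>h. \<phi> (v(i := h)) j) has_real_derivative pd i (\<lambda>v. \<phi> v j) v) (at (v i))"
          by (rule Ck_on_pd(2)[OF V p[OF j] i])
      qed
      then show "((\<lambda>h. f (\<phi> (v(i := h)))) has_real_derivative
        (\<Sum>j<n. pd j f (\<phi> v) * pd i (\<lambda>v. \<phi> v j) v)) (at (v i))" by simp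
    next
      fix i assume i: "i < m"
      show "Ck_on k m V (\<lambda>v. \<Sum>j<n. pd j f (\<phi> v) * pd i (\<lambda>v. \<phi> v j) v)"
      proof (intro Ck_on_sum Ck_on_mult V)
        fix j assume "j \<in> {..<n}"
        then have j: "j < n" by simp
        show "Ck_on k m V (\<lambda>v. pd j f (\<phi> v))"
        proof (rule Suc.IH)
          show "Ck_on k m V (\<lambda>v. \<phi> v i)" if "i < n" for i using Ck_on_SucD[OF V p[OF that]] .
        qed (rule Ck_on_pd(1)[OF U f j])
        show "Ck_on k m V (pd i (\<lambda>v. \<phi> v j))"
          using Ck_on_pd(1)[OF V p[OF j] i] .
      qed auto
    qed
  }
qed

section \<open>Smooth functions and maps on open sets\<close>

lemma smooth_fun_on_const: "eopen n U \<Longrightarrow> smooth_fun_on n U (\<lambda>x. c)"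
  by (simp add: smooth_fun_on_def Ck_on_const)

lemma smooth_fun_on_add:
  "eopen n U \<Longrightarrow> smooth_fun_on n U f \<Longrightarrow> smooth_fun_on n U g \<Longrightarrow> smooth_fun_on n U (\<lambda>x. f x + g x)"
  by (simp add: smooth_fun_on_def Ck_on_add)

lemma smooth_fun_on_mult:
  "eopen n U \<Longrightarrow> smooth_fun_on n U f \<Longrightarrow> smooth_fun_on n U g \<Longrightarrow> smooth_fun_on n U (\<lambda>x. f x * g x)"
  by (simp add: smooth_fun_on_def Ck_on_mult)

lemma smooth_fun_on_inverse:
  "eopen n U \<Longrightarrow> smooth_fun_on n U f \<Longrightarrow> (\<And>x. x \<in> U \<Longrightarrow> f x \<noteq> 0) \<Longrightarrow> smooth_fun_on n U (\<lambda>x. inverse (f x))"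
  by (simp add: smooth_fun_on_def Ck_on_inverse)

lemma smooth_fun_on_flat:
  "eopen n U \<Longrightarrow> smooth_fun_on n U f \<Longrightarrow> smooth_fun_on n U (\<lambda>x. flat (f x))"
  by (simp add: smooth_fun_on_def Ck_on_flat)

lemma smooth_fun_on_proj: "eopen n U \<Longrightarrow> smooth_fun_on n U (\<lambda>x. x j)"
  by (simp add: smooth_fun_on_def Ck_on_proj)

lemma smooth_fun_on_cong:
  assumes "eopen n U" "\<And>x. x \<in> U \<Longrightarrow> f x = g x" "smooth_fun_on n U f"
  shows "smooth_fun_on n U g"
  using assms(3) Ck_on_cong[of n U f g, OF assms(1,2)] unfolding smooth_fun_on_def by blast

lemma smooth_fun_on_subset:
  assumes "eopen n U" "eopen n V" "V \<subseteq> U" "smooth_fun_on n U f"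
  shows "smooth_fun_on n V f"
  using assms(4) Ck_on_subset[OF assms(1-3)] unfolding smooth_fun_on_def by blast

lemma smooth_fun_on_local:
  assumes "eopen n U" "\<And>u. u \<in> U \<Longrightarrow> \<exists>V. eopen n V \<and> u \<in> V \<and> V \<subseteq> U \<and> smooth_fun_on n V f"
  shows "smooth_fun_on n U f"
  unfolding smooth_fun_on_def
proof
  fix k
  show "Ck_on k n U f"
  proof (rule Ck_on_local[OF assms(1)])
    fix u assume "u \<in> U"
    from assms(2)[OF this] show "\<exists>V. eopen n V \<and> u \<in> V \<and> V \<subseteq> U \<and> Ck_on k n V f"
      unfolding smooth_fun_on_def by blast
  qed
qed

lemma smooth_fun_on_compose:
  assumes "euclid_smooth m V n U \<phi>" "smooth_fun_on n U f"
  shows "smooth_fun_on m V (\<lambda>v. f (\<phi> v))"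
  unfolding smooth_fun_on_def
proof
  fix k
  show "Ck_on k m V (\<lambda>v. f (\<phi> v))"
    by (rule Ck_on_compose[of n U m V]) (use assms in \<open>simp_all add: smooth_fun_on_def euclid_smooth_def\<close>)
qed

lemma smooth_fun_on_continuous: "eopen n U \<Longrightarrow> smooth_fun_on n U f \<Longrightarrow> continuous_on U f"
  using Ck_on_continuous[of n U 0 f] by (auto simp: smooth_fun_on_def)

lemma euclid_smooth_inclusion: "eopen n U \<Longrightarrow> eopen n V \<Longrightarrow> V \<subseteq> U \<Longrightarrow> euclid_smooth n V n U (\<lambda>x. x)"
  by (auto simp: euclid_smooth_def smooth_fun_on_proj)

lemma euclid_smooth_continuous:
  assumes f: "euclid_smooth m V n U f"
  shows "continuous_on V f"
proof (rule continuous_on_coordinatewise_then_product)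
  fix i
  show "continuous_on V (\<lambda>v. f v i)"
  proof (cases "i < n")
    case True
    then show ?thesis
      using f smooth_fun_on_continuous[of m V "\<lambda>v. f v i"] by (simp add: euclid_smooth_def)
  next
    case False
    then have "f v i = 0" if "v \<in> V" for v
      using eopen_zero[of n U "f v" i] f that by (auto simp: Pi_iff euclid_smooth_def)
    then show ?thesis by (simp cong: continuous_on_cong)
  qed
qed

lemma euclid_smooth_preimage:
  assumes f: "euclid_smooth m V n U f" and W: "eopen n W"
  shows "eopen m {v\<in>V. f v \<in> W}"
proof -
  obtain T where T: "open T" "W = {x. \<forall>i\<ge>n. x i = 0} \<inter> T" using W by (auto simp: eopen_iff)
  have "f v \<in> {x. \<forall>i\<ge>n. x i = 0}" if "v \<in> V" for v
    using eopen_zero[of n U "f v"] f that by (auto simp: Pi_iff euclid_smooth_def)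
  then have "{v\<in>V. f v \<in> W} = {v\<in>V. f v \<in> T}" using T by auto
  moreover have "eopen m V" using f by (simp add: euclid_smooth_def)
  ultimately show ?thesis
    using eopen_preimage[OF _ euclid_smooth_continuous[OF f] T(1)] by simp
qed

section \<open>Diffeological spaces\<close>

context diffeological_space
begin

lemma plot_restrict: "plot X n U p \<Longrightarrow> eopen n V \<Longrightarrow> V \<subseteq> U \<Longrightarrow> plot X n V p"
  using plot_compose[OF _ euclid_smooth_inclusion, of n U p V] plot_domain[of n U p] by (simp add: comp_def)

lemma plot_pts: "plot X n U p \<Longrightarrow> u \<in> U \<Longrightarrow> p u \<in> pts X"
  using plot_range by blast

text \<open>The locality axiom in the form in which it is applied: near each point \<open>p\<close>
  may be replaced by another plot \<open>q\<close>, typically built from a local lift.\<close>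

lemma plot_locally_eq:
  assumes "eopen n U"
    "\<And>u. u \<in> U \<Longrightarrow> \<exists>V q. eopen n V \<and> u \<in> V \<and> plot X n V q \<and> (\<forall>v\<in>V \<inter> U. p v = q v)"
  shows "plot X n U p"
proof (rule plot_local[OF assms(1)])
  fix u assume u: "u \<in> U"
  then obtain V q where V: "eopen n V" "u \<in> V" "plot X n V q" "\<forall>v\<in>V \<inter> U. p v = q v"
    using assms(2)[OF u] by blast
  have W: "eopen n (V \<inter> U)" using V(1) assms(1) by (rule openin_Int)
  then have "plot X n (V \<inter> U) q" using plot_restrict[OF V(3)] by blast
  then have "plot X n (V \<inter> U) p" by (rule plot_cong) (use V(4) in auto)
  then show "\<exists>V. eopen n V \<and> u \<in> V \<and> V \<subseteq> U \<and> plot X n V p"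
    using W u V(2) by (intro exI[of _ "V \<inter> U"]) auto
qed

end

section \<open>Constructions of diffeological spaces\<close>

lemma diffeological_space_real: "diffeological_space real_dspace"
proof
  fix n U p m V f
  assume p: "plot real_dspace n U p" and f: "euclid_smooth m V n U f"
  have "smooth_fun_on m V (\<lambda>v. p (f v))"
    using p by (intro smooth_fun_on_compose[OF f]) (simp add: real_dspace_def)
  then show "plot real_dspace m V (p \<circ> f)"
    using f by (simp add: real_dspace_def euclid_smooth_def comp_def)
next
  fix n U and p q :: "(nat \<Rightarrow> real) \<Rightarrow> real"
  assume p: "plot real_dspace n U p" "\<And>u. u \<in> U \<Longrightarrow> q u = p u"
  have "smooth_fun_on n U q"
    by (rule smooth_fun_on_cong[of n U p]) (use p in \<open>simp_all add: real_dspace_def\<close>)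
  then show "plot real_dspace n U q" using p by (simp add: real_dspace_def)
next
  fix n U and p :: "(nat \<Rightarrow> real) \<Rightarrow> real"
  assume "eopen n U" "\<And>u. u \<in> U \<Longrightarrow> \<exists>V. eopen n V \<and> u \<in> V \<and> V \<subseteq> U \<and> plot real_dspace n V p"
  then show "plot real_dspace n U p"
    by (simp add: real_dspace_def) (meson smooth_fun_on_local)
qed (auto simp: real_dspace_def smooth_fun_on_const)

lemma diffeological_space_euclid:
  assumes W: "eopen k W"
  shows "diffeological_space (euclid_dspace k W)"
proof
  fix n U p m V f
  assume p: "plot (euclid_dspace k W) n U p" and f: "euclid_smooth m V n U f"
  have "smooth_fun_on m V (\<lambda>v. p (f v) j)" if "j < k" for j
    using p that by (intro smooth_fun_on_compose[OF f]) (simp add: euclid_dspace_def euclid_smooth_def)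
  then show "plot (euclid_dspace k W) m V (p \<circ> f)"
    using p f by (simp add: euclid_dspace_def euclid_smooth_def Pi_iff)
next
  fix n U and p q :: "(nat \<Rightarrow> real) \<Rightarrow> (nat \<Rightarrow> real)"
  assume p: "plot (euclid_dspace k W) n U p" "\<And>u. u \<in> U \<Longrightarrow> q u = p u"
  have "smooth_fun_on n U (\<lambda>u. q u j)" if "j < k" for j
    by (rule smooth_fun_on_cong[of n U "\<lambda>u. p u j"])
      (use p that in \<open>simp_all add: euclid_dspace_def euclid_smooth_def\<close>)
  then show "plot (euclid_dspace k W) n U q"
    using p by (simp add: euclid_dspace_def euclid_smooth_def Pi_iff)
next
  fix n U and p :: "(nat \<Rightarrow> real) \<Rightarrow> (nat \<Rightarrow> real)"
  assume U: "eopen n U" and *: "\<And>u. u \<in> U \<Longrightarrow> \<exists>V. eopen n V \<and> u \<in> V \<and> V \<subseteq> U \<and> plot (euclid_dspace k W) n V p"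
  have "smooth_fun_on n U (\<lambda>u. p u j)" if "j < k" for j
    using * that by (intro smooth_fun_on_local[OF U]) (fastforce simp: euclid_dspace_def euclid_smooth_def)
  moreover have "p \<in> U \<rightarrow> W" using * by (fastforce simp: euclid_dspace_def euclid_smooth_def)
  ultimately show "plot (euclid_dspace k W) n U p"
    using U W by (auto simp: euclid_dspace_def euclid_smooth_def)
qed (use W in \<open>auto simp: euclid_dspace_def euclid_smooth_def smooth_fun_on_const\<close>)

lemma diffeological_space_prod:
  assumes "diffeological_space X" "diffeological_space Y"
  shows "diffeological_space (prod_dspace X Y)"
proof -
  interpret X: diffeological_space X by fact
  interpret Y: diffeological_space Y by fact
  show ?thesis
  proof
    fix n U p assume p: "plot (prod_dspace X Y) n U p"
    then show "eopen n U" using X.plot_domain by (auto simp: prod_dspace_def)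
    have "fst (p u) \<in> pts X" "snd (p u) \<in> pts Y" if "u \<in> U" for u
      using p X.plot_pts[of n U "fst \<circ> p" u] Y.plot_pts[of n U "snd \<circ> p" u] that by (simp_all add: prod_dspace_def)
    then show "p \<in> U \<rightarrow> pts (prod_dspace X Y)"
      by (simp add: prod_dspace_def mem_Times_iff Pi_iff)
  next
    fix n U p q assume "plot (prod_dspace X Y) n U p" "\<And>u. u \<in> U \<Longrightarrow> q u = p u"
    then show "plot (prod_dspace X Y) n U q"
      using X.plot_cong[of n U "fst \<circ> p" "fst \<circ> q"] Y.plot_cong[of n U "snd \<circ> p" "snd \<circ> q"]
      by (auto simp: prod_dspace_def)
  next
    fix n U p m V f assume "plot (prod_dspace X Y) n U p" "euclid_smooth m V n U f"
    then show "plot (prod_dspace X Y) m V (p \<circ> f)"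
      using X.plot_compose[of n U "fst \<circ> p" m V f] Y.plot_compose[of n U "snd \<circ> p" m V f]
      by (auto simp: prod_dspace_def comp_assoc)
  next
    fix n U p assume "eopen n U"
      "\<And>u. u \<in> U \<Longrightarrow> \<exists>V. eopen n V \<and> u \<in> V \<and> V \<subseteq> U \<and> plot (prod_dspace X Y) n V p"
    then show "plot (prod_dspace X Y) n U p"
      by (simp add: prod_dspace_def) (meson X.plot_local Y.plot_local)
  qed (auto simp: prod_dspace_def comp_def X.plot_const Y.plot_const)
qed

lemma diffeological_space_seq:
  assumes "diffeological_space X"
  shows "diffeological_space (seq_dspace X)"
proof -
  interpret X: diffeological_space X by fact
  show ?thesis
  proof
    fix n U p assume p: "plot (seq_dspace X) n U p"
    then show "eopen n U" using X.plot_domain[of n U "\<lambda>u. p u 0"] by (simp add: seq_dspace_def)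
    show "p \<in> U \<rightarrow> pts (seq_dspace X)"
    proof
      fix u assume "u \<in> U"
      then have "p u i \<in> pts X" for i using p X.plot_pts[of n U "\<lambda>u. p u i" u] by (simp add: seq_dspace_def)
      then show "p u \<in> pts (seq_dspace X)" by (simp add: seq_dspace_def)
    qed
  next
    fix n U p q assume "plot (seq_dspace X) n U p" "\<And>u. u \<in> U \<Longrightarrow> q u = p u"
    then show "plot (seq_dspace X) n U q"
      by (auto simp: seq_dspace_def intro: X.plot_cong)
  next
    fix n U p m V f assume "plot (seq_dspace X) n U p" "euclid_smooth m V n U f"
    then show "plot (seq_dspace X) m V (p \<circ> f)"
      using X.plot_compose[of n U _ m V f] by (auto simp add: seq_dspace_def comp_def)
  next
    fix n U p assume "eopen n U"
      "\<And>u. u \<in> U \<Longrightarrow> \<exists>V. eopen n V \<and> u \<in> V \<and> V \<subseteq> U \<and> plot (seq_dspace X) n V p"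
    then show "plot (seq_dspace X) n U p"
      by (simp add: seq_dspace_def) (meson X.plot_local)
  qed (auto simp: seq_dspace_def X.plot_const)
qed

lemma diffeological_space_sub:
  assumes "diffeological_space X"
  shows "diffeological_space (sub_dspace X A)"
proof -
  interpret X: diffeological_space X by fact
  show ?thesis
  proof
    fix n U p q assume "plot (sub_dspace X A) n U p" "\<And>u. u \<in> U \<Longrightarrow> q u = p u"
    then show "plot (sub_dspace X A) n U q"
      using X.plot_cong[of n U p q] by (auto simp: sub_dspace_def Pi_iff)
  next
    fix n U p m V f assume "plot (sub_dspace X A) n U p" "euclid_smooth m V n U f"
    then show "plot (sub_dspace X A) m V (p \<circ> f)"
      using X.plot_compose[of n U p m V f] by (auto simp: sub_dspace_def euclid_smooth_def)
  next
    fix n U p assume *: "eopen n U"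
      "\<And>u. u \<in> U \<Longrightarrow> \<exists>V. eopen n V \<and> u \<in> V \<and> V \<subseteq> U \<and> plot (sub_dspace X A) n V p"
    have "plot X n U p" by (rule X.plot_local[OF *(1)]) (use *(2) in \<open>fastforce simp: sub_dspace_def\<close>)
    moreover have "p \<in> U \<rightarrow> A" using *(2) by (fastforce simp: sub_dspace_def)
    ultimately show "plot (sub_dspace X A) n U p" by (simp add: sub_dspace_def)
  next
    fix n U p assume p: "plot (sub_dspace X A) n U p"
    then show "eopen n U" using X.plot_domain by (auto simp: sub_dspace_def)
    show "p \<in> U \<rightarrow> pts (sub_dspace X A)" using p X.plot_range by (fastforce simp: sub_dspace_def)
  qed (auto simp: sub_dspace_def X.plot_const)
qed

lemma diffeological_space_quot:
  assumes "diffeological_space X"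
  shows "diffeological_space (quot_dspace X r)"
proof -
  interpret X: diffeological_space X by fact
  show ?thesis
  proof
    fix n U p assume p: "plot (quot_dspace X r) n U p"
    then show "eopen n U" by (auto simp: quot_dspace_def)
    show "p \<in> U \<rightarrow> pts (quot_dspace X r)"
    proof
      fix u assume "u \<in> U"
      then obtain V q where "u \<in> V" "plot X n V q" "\<forall>v\<in>V. p v = r `` {q v}"
        using p by (auto simp: quot_dspace_def)
      then show "p u \<in> pts (quot_dspace X r)"
        using X.plot_pts[of n V q u] by (auto simp: quot_dspace_def intro: quotientI)
    qed
  next
    fix n U p q assume "plot (quot_dspace X r) n U p" "\<And>u. u \<in> U \<Longrightarrow> q u = p u"
    then show "plot (quot_dspace X r) n U q"
      by (simp add: quot_dspace_def) (metis subsetD)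
  next
    fix n U x assume U: "eopen n U" "x \<in> pts (quot_dspace X r)"
    then obtain a where "a \<in> pts X" "x = r `` {a}" by (auto simp: quot_dspace_def elim: quotientE)
    then show "plot (quot_dspace X r) n U (\<lambda>u. x)"
      using U(1) X.plot_const[OF U(1)] by (auto simp: quot_dspace_def intro!: exI[of _ U] exI[of _ "\<lambda>_. a"])
  next
    fix n U p m V f assume p: "plot (quot_dspace X r) n U p" and f: "euclid_smooth m V n U f"
    have V: "eopen m V" and fU: "f \<in> V \<rightarrow> U" using f by (auto simp: euclid_smooth_def)
    show "plot (quot_dspace X r) m V (p \<circ> f)"
      unfolding quot_dspace_def
    proof (simp, intro conjI ballI V)
      fix v assume v: "v \<in> V"
      then obtain W q where W: "eopen n W" "f v \<in> W" "W \<subseteq> U" "plot X n W q" "\<forall>w\<in>W. p w = r `` {q w}"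
        using p fU by (simp add: quot_dspace_def Pi_iff) blast
      \<comment> \<open>The local lift over \<open>W\<close> is pulled back to the preimage of
        \<open>W\<close>, which is open because smooth maps are continuous.\<close>
      let ?V = "{v\<in>V. f v \<in> W}"
      have V': "eopen m ?V" using euclid_smooth_preimage[OF f W(1)] .
      then have "euclid_smooth m ?V n W f"
        using f W(1) smooth_fun_on_subset[OF V V'] by (auto simp: euclid_smooth_def)
      then have "plot X m ?V (q \<circ> f)" using X.plot_compose W(4) by blast
      then show "\<exists>V'. eopen m V' \<and> v \<in> V' \<and> V' \<subseteq> V \<and>
          (\<exists>q. plot X m V' q \<and> (\<forall>v\<in>V'. p (f v) = r `` {q v}))"
        using V' W(2,5) v by (intro exI[of _ ?V] conjI exI[of _ "q \<circ> f"]) auto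
    qed
  next
    fix n U p assume U: "eopen n U" and
      *: "\<And>u. u \<in> U \<Longrightarrow> \<exists>V. eopen n V \<and> u \<in> V \<and> V \<subseteq> U \<and> plot (quot_dspace X r) n V p"
    show "plot (quot_dspace X r) n U p"
      unfolding quot_dspace_def
    proof (simp, intro conjI ballI U)
      fix u assume "u \<in> U"
      then obtain V where "V \<subseteq> U" "u \<in> V" "plot (quot_dspace X r) n V p" using * by blast
      then show "\<exists>V. eopen n V \<and> u \<in> V \<and> V \<subseteq> U \<and>
          (\<exists>q. plot X n V q \<and> (\<forall>v\<in>V. p v = r `` {q v}))"
        by (simp add: quot_dspace_def) (meson subset_trans)
    qed
  qed
qed

lemmas plot_domain = diffeological_space.plot_domain
  and plot_const = diffeological_space.plot_const
  and plot_cong = diffeological_space.plot_cong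
  and plot_compose = diffeological_space.plot_compose
  and plot_pts = diffeological_space.plot_pts
  and plot_restrict = diffeological_space.plot_restrict
  and plot_locally_eq = diffeological_space.plot_locally_eq

section \<open>Smooth maps, the D-topology and subductions\<close>

lemma smoothD: "smooth X Y f \<Longrightarrow> plot X n U p \<Longrightarrow> plot Y n U (\<lambda>u. f (p u))"
  by (simp add: smooth_def comp_def)

lemma smooth_pts: "smooth X Y f \<Longrightarrow> x \<in> pts X \<Longrightarrow> f x \<in> pts Y"
  by (auto simp: smooth_def)

lemma smoothI:
  "(\<And>x. x \<in> pts X \<Longrightarrow> f x \<in> pts Y) \<Longrightarrow> (\<And>n U p. plot X n U p \<Longrightarrow> plot Y n U (\<lambda>u. f (p u))) \<Longrightarrow> smooth X Y f"
  by (auto simp: smooth_def comp_def)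

lemma smooth_compose: "smooth X Y f \<Longrightarrow> smooth Y Z g \<Longrightarrow> smooth X Z (\<lambda>x. g (f x))"
  by (auto intro!: smoothI dest: smoothD smooth_pts)

lemma smooth_id: "smooth X X (\<lambda>x. x)"
  by (auto intro!: smoothI)

lemma smooth_const:
  assumes "diffeological_space X" "diffeological_space Y" "c \<in> pts Y"
  shows "smooth X Y (\<lambda>x. c)"
  using assms by (auto intro!: smoothI plot_const dest: plot_domain)

lemma smooth_cong:
  assumes "diffeological_space X" "diffeological_space Y" "smooth X Y f" "\<And>x. x \<in> pts X \<Longrightarrow> g x = f x"
  shows "smooth X Y g"
proof (rule smoothI)
  fix n U p assume p: "plot X n U p"
  show "plot Y n U (\<lambda>u. g (p u))"
    by (rule plot_cong[OF assms(2) smoothD[OF assms(3) p]])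
      (use assms(4) plot_pts[OF assms(1) p] in auto)
qed (use assms(3,4) smooth_pts in fastforce)

lemma pts_prod [simp]: "pts (prod_dspace X Y) = pts X \<times> pts Y"
  by (simp add: prod_dspace_def)

lemma pts_sub [simp]: "pts (sub_dspace X A) = pts X \<inter> A"
  by (simp add: sub_dspace_def)

lemma pts_real [simp]: "pts real_dspace = UNIV"
  by (simp add: real_dspace_def)

lemma pts_space_of [simp]: "pts (space_of G) = carrier G"
  by (simp add: space_of_def)

lemma smooth_fst: "smooth (prod_dspace X Y) X fst"
  and smooth_snd: "smooth (prod_dspace X Y) Y snd"
  by (auto intro!: smoothI simp: prod_dspace_def comp_def)

lemma smooth_Pair: "smooth X Y f \<Longrightarrow> smooth X Z g \<Longrightarrow> smooth X (prod_dspace Y Z) (\<lambda>x. (f x, g x))"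
  by (intro smoothI) (auto simp: prod_dspace_def comp_def dest: smooth_pts smoothD)

lemma smooth_from_sub: "smooth X Y f \<Longrightarrow> smooth (sub_dspace X A) Y f"
  by (intro smoothI) (auto simp: sub_dspace_def dest: smooth_pts smoothD)

lemma smooth_into_sub:
  assumes "diffeological_space X" "smooth X Y f" "\<And>x. x \<in> pts X \<Longrightarrow> f x \<in> A"
  shows "smooth X (sub_dspace Y A) f"
proof (rule smoothI)
  fix n U p assume "plot X n U p"
  then show "plot (sub_dspace Y A) n U (\<lambda>u. f (p u))"
    using assms plot_pts[OF assms(1), of n U p] by (auto simp: sub_dspace_def dest: smoothD)
qed (use assms smooth_pts in fastforce)

lemma smooth_from_sub_mono:
  assumes X: "diffeological_space X" and f: "smooth (sub_dspace X A) Y f"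
    and BA: "\<And>x. x \<in> pts X \<Longrightarrow> x \<in> B \<Longrightarrow> x \<in> A"
  shows "smooth (sub_dspace X B) Y f"
proof (rule smoothI)
  fix n U p assume p: "plot (sub_dspace X B) n U p"
  then have "plot (sub_dspace X A) n U p"
    using plot_pts[OF X, of n U p] BA by (auto simp: sub_dspace_def Pi_iff)
  then show "plot Y n U (\<lambda>u. f (p u))" using smoothD[OF f] by blast
qed (use smooth_pts[OF f] BA in auto)

lemma D_open_plot: "D_open X A \<Longrightarrow> plot X n U p \<Longrightarrow> eopen n {u\<in>U. p u \<in> A}"
  by (simp add: D_open_def)

lemma D_open_subset: "D_open X A \<Longrightarrow> A \<subseteq> pts X"
  by (simp add: D_open_def)

lemma D_open_preimage: "smooth X Y f \<Longrightarrow> D_open Y A \<Longrightarrow> D_open X {x\<in>pts X. f x \<in> A}"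
  if "diffeological_space X" for X
proof -
  interpret diffeological_space X by fact
  assume f: "smooth X Y f" and A: "D_open Y A"
  show ?thesis
    unfolding D_open_def
  proof (intro conjI allI impI)
    fix n U p assume p: "plot X n U p"
    have "{u\<in>U. p u \<in> {x\<in>pts X. f x \<in> A}} = {u\<in>U. f (p u) \<in> A}"
      using plot_pts[OF p] by auto
    then show "eopen n {u\<in>U. p u \<in> {x\<in>pts X. f x \<in> A}}"
      using D_open_plot[OF A smoothD[OF f p]] by simp
  qed auto
qed

lemma D_open_pts: "diffeological_space X \<Longrightarrow> D_open X (pts X)"
proof -
  assume "diffeological_space X"
  then interpret diffeological_space X .
  have "{u\<in>U. p u \<in> pts X} = U" if "plot X n U p" for n U p using plot_pts[OF that] by auto
  then show ?thesis using plot_domain by (auto simp: D_open_def)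
qed

lemma D_open_Int: "D_open X A \<Longrightarrow> D_open X B \<Longrightarrow> D_open X (A \<inter> B)"
  using openin_Int[of "D_topology X" A B] by (simp add: openin_D_topology)

lemma D_open_finite_INT:
  assumes "finite F" "diffeological_space X" "\<And>i. i \<in> F \<Longrightarrow> D_open X (A i)"
  shows "D_open X {x\<in>pts X. \<forall>i\<in>F. x \<in> A i}"
  using assms(1,3)
proof (induction rule: finite_induct)
  case (insert i F)
  have "{x\<in>pts X. \<forall>j\<in>insert i F. x \<in> A j} = A i \<inter> {x\<in>pts X. \<forall>i\<in>F. x \<in> A i}"
    using D_open_subset[of X "A i"] insert.prems by auto
  then show ?case using insert by (auto intro: D_open_Int)
qed (use D_open_pts[OF assms(2)] in simp)

lemma D_open_real: "open S \<Longrightarrow> D_open real_dspace S"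
  by (auto simp: D_open_def real_dspace_def intro: eopen_preimage dest: smooth_fun_on_continuous)

lemma D_open_preimage_real:
  "diffeological_space X \<Longrightarrow> smooth X real_dspace f \<Longrightarrow> open S \<Longrightarrow> D_open X {x\<in>pts X. f x \<in> S}"
  by (rule D_open_preimage[OF _ _ D_open_real])

lemma D_open_less:
  assumes "diffeological_space X" "smooth X real_dspace f"
  shows "D_open X {x\<in>pts X. f x > c}" "D_open X {x\<in>pts X. f x < c}"
  using D_open_preimage_real[OF assms, of "{c<..}"] D_open_preimage_real[OF assms, of "{..<c}"] by auto

text \<open>D-open sets have open preimages under plots, so the locality axiom of \<open>Y\<close>
  applies along each plot.\<close>

lemma smooth_locally:
  assumes "diffeological_space X" "diffeological_space Y" 
    and loc: "\<And>x. x \<in> pts X \<Longrightarrow> \<exists>N g. D_open X N \<and> x \<in> N \<and> smooth (sub_dspace X N) Y g \<and> (\<forall>y\<in>N. f y = g y)"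
  shows "smooth X Y f"
proof (rule smoothI)
  interpret X: diffeological_space X by fact
  interpret Y: diffeological_space Y by fact
  show "f x \<in> pts Y" if x: "x \<in> pts X" for x
    using loc[OF x] smooth_pts[of "sub_dspace X _" Y _ x] x by auto
  fix n U p assume p: "plot X n U p"
  show "plot Y n U (\<lambda>u. f (p u))"
  proof (rule Y.plot_locally_eq)
    show "eopen n U" using X.plot_domain[OF p] .
    fix u assume u: "u \<in> U"
    obtain N g where N: "D_open X N" "p u \<in> N" "smooth (sub_dspace X N) Y g" "\<forall>y\<in>N. f y = g y"
      using loc[OF X.plot_pts[OF p u]] by blast
    let ?V = "{u\<in>U. p u \<in> N}"
    have V: "eopen n ?V" using D_open_plot[OF N(1) p] .
    then have "plot (sub_dspace X N) n ?V p"
      using X.plot_restrict[OF p V] by (auto simp: sub_dspace_def)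
    then have "plot Y n ?V (\<lambda>u. g (p u))" using smoothD[OF N(3)] by blast
    then show "\<exists>V q. eopen n V \<and> u \<in> V \<and> plot Y n V q \<and> (\<forall>v\<in>V \<inter> U. f (p v) = q v)"
      using V u N(2,4) by (intro exI[of _ ?V] exI[of _ "\<lambda>u. g (p u)"]) auto
  qed
qed

lemma smooth_locally_eq:
  assumes "diffeological_space X" "diffeological_space Y" 
    and loc: "\<And>x. x \<in> pts X \<Longrightarrow> \<exists>N g. D_open X N \<and> x \<in> N \<and> smooth X Y g \<and> (\<forall>y\<in>N. f y = g y)"
  shows "smooth X Y f"
proof (rule smooth_locally[OF assms(1,2)])
  fix x assume "x \<in> pts X"
  then obtain N g where "D_open X N" "x \<in> N" "smooth X Y g" "\<forall>y\<in>N. f y = g y"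
    using loc by blast
  then show "\<exists>N g. D_open X N \<and> x \<in> N \<and> smooth (sub_dspace X N) Y g \<and> (\<forall>y\<in>N. f y = g y)"
    using smooth_from_sub by blast
qed

section \<open>Smooth real functions on diffeological spaces\<close>

lemma smooth_real_iff:
  "diffeological_space X \<Longrightarrow>
    smooth X real_dspace f \<longleftrightarrow> (\<forall>n U p. plot X n U p \<longrightarrow> smooth_fun_on n U (\<lambda>u. f (p u)))"
  by (auto simp: smooth_def real_dspace_def comp_def dest: plot_domain)

lemma smooth_real_const: "diffeological_space X \<Longrightarrow> smooth X real_dspace (\<lambda>x. c)"
  by (auto intro: smooth_const diffeological_space_real)

lemma smooth_real_add:
  "diffeological_space X \<Longrightarrow> smooth X real_dspace f \<Longrightarrow> smooth X real_dspace g \<Longrightarrow> smooth X real_dspace (\<lambda>x. f x + g x)"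
  by (auto simp: smooth_real_iff intro: smooth_fun_on_add dest: plot_domain)

lemma smooth_real_mult:
  "diffeological_space X \<Longrightarrow> smooth X real_dspace f \<Longrightarrow> smooth X real_dspace g \<Longrightarrow> smooth X real_dspace (\<lambda>x. f x * g x)"
  by (auto simp: smooth_real_iff intro: smooth_fun_on_mult dest: plot_domain)

lemma smooth_real_diff:
  assumes "diffeological_space X" "smooth X real_dspace f" "smooth X real_dspace g"
  shows "smooth X real_dspace (\<lambda>x. f x - g x)"
proof -
  have "smooth X real_dspace (\<lambda>x. f x + (-1) * g x)"
    using assms by (intro smooth_real_add smooth_real_mult smooth_real_const)
  then show ?thesis by simp
qed

lemma smooth_real_flat:
  "diffeological_space X \<Longrightarrow> smooth X real_dspace f \<Longrightarrow> smooth X real_dspace (\<lambda>x. flat (f x))"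
  by (auto simp: smooth_real_iff intro: smooth_fun_on_flat dest: plot_domain)

lemma smooth_real_divide:
  assumes X: "diffeological_space X" and "smooth X real_dspace f" "smooth X real_dspace g"
    and "\<And>x. x \<in> pts X \<Longrightarrow> g x \<noteq> 0"
  shows "smooth X real_dspace (\<lambda>x. f x / g x)"
proof -
  have "smooth X real_dspace (\<lambda>x. inverse (g x))"
    using assms plot_domain[OF X] plot_pts[OF X]
    by (auto simp: smooth_real_iff intro!: smooth_fun_on_inverse)
  then show ?thesis
    using smooth_real_mult[OF X assms(2)] by (simp add: divide_inverse)
qed

lemma smooth_real_sum:
  assumes "diffeological_space X" "\<And>i. i \<in> I \<Longrightarrow> smooth X real_dspace (f i)"
  shows "smooth X real_dspace (\<lambda>x. \<Sum>i\<in>I. f i x)"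
  using assms(2)
  by (induction I rule: infinite_finite_induct) (auto intro: assms(1) smooth_real_const smooth_real_add)

lemma smooth_real_prod:
  assumes "diffeological_space X" "\<And>i. i \<in> I \<Longrightarrow> smooth X real_dspace (f i)"
  shows "smooth X real_dspace (\<lambda>x. \<Prod>i\<in>I. f i x)"
  using assms(2)
  by (induction I rule: infinite_finite_induct) (auto intro: assms(1) smooth_real_const smooth_real_mult)

lemmas smooth_real_intros = smooth_real_const smooth_real_add smooth_real_mult smooth_real_diff
  smooth_real_flat smooth_real_divide smooth_real_sum smooth_real_prod

text \<open>Local lifting of plots characterises quotient maps among smooth maps. Bundle projections
  and the class maps onto \<open>EG\<close> and \<open>BG\<close> are all handled through this
  property.\<close>

definition subduction :: "'a dspace \<Rightarrow> 'b dspace \<Rightarrow> ('a \<Rightarrow> 'b) \<Rightarrow> bool" where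
  "subduction E B \<pi> \<longleftrightarrow> smooth E B \<pi> \<and> (\<forall>n U p. plot B n U p \<longrightarrow> (\<forall>u\<in>U. \<exists>V q.
     eopen n V \<and> u \<in> V \<and> V \<subseteq> U \<and> plot E n V q \<and> (\<forall>v\<in>V. \<pi> (q v) = p v)))"

lemma subduction_smooth: "subduction E B \<pi> \<Longrightarrow> smooth E B \<pi>"
  by (simp add: subduction_def)

lemma subductionE:
  assumes "subduction E B \<pi>" "plot B n U p" "u \<in> U"
  obtains V q where "eopen n V" "u \<in> V" "V \<subseteq> U" "plot E n V q" "\<And>v. v \<in> V \<Longrightarrow> \<pi> (q v) = p v"
  using assms unfolding subduction_def by meson

text \<open>Surjectivity is the lifting of constant plots on the space of dimension 0, whose only
  point is the zero function.\<close>

lemma subduction_surj: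
  assumes "diffeological_space B" "diffeological_space E" "subduction E B \<pi>" "b \<in> pts B"
  obtains x where "x \<in> pts E" "\<pi> x = b"
proof -
  let ?U = "topspace (Euclidean_space 0)"
  have p: "plot B 0 ?U (\<lambda>u. b)"
    using assms by (intro plot_const) auto
  have "(\<lambda>_. 0) \<in> ?U" by (simp add: topspace_Euclidean_space)
  then obtain V q where "(\<lambda>_. 0) \<in> V" "plot E 0 V q" "\<And>v. v \<in> V \<Longrightarrow> \<pi> (q v) = b"
    using subductionE[OF assms(3) p] by metis
  then show ?thesis
    using that plot_pts[OF assms(2)] by blast
qed

lemma smooth_via_subduction:
  assumes B: "diffeological_space B" and E: "diffeological_space E" and Z: "diffeological_space Z"
    and \<pi>: "subduction E B \<pi>" and g: "smooth E Z (\<lambda>x. g (\<pi> x))"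
  shows "smooth B Z g"
proof (rule smoothI)
  show "g b \<in> pts Z" if "b \<in> pts B" for b
    using subduction_surj[OF B E \<pi> that] smooth_pts[OF g] by metis
  fix n U p assume p: "plot B n U p"
  show "plot Z n U (\<lambda>u. g (p u))"
  proof (rule plot_locally_eq[OF Z])
    show "eopen n U" using plot_domain[OF B p] .
    fix u assume "u \<in> U"
    then obtain V q where V: "eopen n V" "u \<in> V" "plot E n V q" "\<And>v. v \<in> V \<Longrightarrow> \<pi> (q v) = p v"
      using subductionE[OF \<pi> p] by metis
    have "plot Z n V (\<lambda>v. g (\<pi> (q v)))" using smoothD[OF g V(3)] .
    then show "\<exists>V q. eopen n V \<and> u \<in> V \<and> plot Z n V q \<and> (\<forall>v\<in>V \<inter> U. g (p v) = q v)"
      using V by (intro exI[of _ V] exI[of _ "\<lambda>v. g (\<pi> (q v))"]) auto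
  qed
qed

text \<open>The universal property of a quotient. Sections, weights, homotopies and classifying maps
  on base spaces are all obtained from invariant maps on total spaces in this way.\<close>

lemma subduction_descend:
  assumes B: "diffeological_space B" and E: "diffeological_space E" and Z: "diffeological_space Z"
    and \<pi>: "subduction E B \<pi>" and F: "smooth E Z F"
    and inv: "\<And>x y. x \<in> pts E \<Longrightarrow> y \<in> pts E \<Longrightarrow> \<pi> x = \<pi> y \<Longrightarrow> F x = F y"
  obtains g where "smooth B Z g" "\<And>x. x \<in> pts E \<Longrightarrow> g (\<pi> x) = F x"
proof -
  define g where "g b = F (SOME x. x \<in> pts E \<and> \<pi> x = b)" for b
  have g: "g (\<pi> x) = F x" if "x \<in> pts E" for x
  proof -
    have "\<exists>y. y \<in> pts E \<and> \<pi> y = \<pi> x" using that by blast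
    then have "(SOME y. y \<in> pts E \<and> \<pi> y = \<pi> x) \<in> pts E \<and> \<pi> (SOME y. y \<in> pts E \<and> \<pi> y = \<pi> x) = \<pi> x"
      by (rule someI_ex)
    then show ?thesis unfolding g_def using inv that by blast
  qed
  have "smooth E Z (\<lambda>x. g (\<pi> x))"
    by (rule smooth_cong[OF E Z F g])
  then have "smooth B Z g" by (rule smooth_via_subduction[OF B E Z \<pi>])
  then show ?thesis using g that by blast
qed

text \<open>Lets homotopies descend: a local lift of the first component, paired with the unchanged
  time, is a local lift.\<close>

lemma subduction_times_real:
  assumes B: "diffeological_space B" and \<pi>: "subduction E B \<pi>"
  shows "subduction (prod_dspace E real_dspace) (prod_dspace B real_dspace) (\<lambda>(x, s). (\<pi> x, s))"
  unfolding subduction_def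
proof (intro conjI allI impI ballI)
  show "smooth (prod_dspace E real_dspace) (prod_dspace B real_dspace) (\<lambda>(x, s). (\<pi> x, s))"
    unfolding case_prod_unfold
    by (intro smooth_Pair smooth_snd smooth_compose[OF smooth_fst subduction_smooth[OF \<pi>]])
  fix n U p u assume p: "plot (prod_dspace B real_dspace) n U p" and u: "u \<in> U"
  have p1: "plot B n U (\<lambda>u. fst (p u))" and p2: "plot real_dspace n U (\<lambda>u. snd (p u))"
    using p by (auto simp: prod_dspace_def comp_def)
  obtain V q where V: "eopen n V" "u \<in> V" "V \<subseteq> U" "plot E n V q" "\<And>v. v \<in> V \<Longrightarrow> \<pi> (q v) = fst (p v)"
    using subductionE[OF \<pi> p1 u] by metis
  have "plot real_dspace n V (\<lambda>u. snd (p u))"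
    using plot_restrict[OF diffeological_space_real p2 V(1,3)] .
  then have "plot (prod_dspace E real_dspace) n V (\<lambda>v. (q v, snd (p v)))"
    using V(4) by (simp add: prod_dspace_def comp_def)
  then show "\<exists>V q. eopen n V \<and> u \<in> V \<and> V \<subseteq> U \<and> plot (prod_dspace E real_dspace) n V q \<and>
      (\<forall>v\<in>V. (case q v of (x, s) \<Rightarrow> (\<pi> x, s)) = p v)"
    using V by (intro exI[of _ V] exI[of _ "\<lambda>v. (q v, snd (p v))"]) auto
qed

lemma subduction_quot:
  assumes X: "diffeological_space X"
  shows "subduction X (quot_dspace X r) (\<lambda>x. r `` {x})"
  unfolding subduction_def
proof (intro conjI allI impI ballI smoothI)
  fix n U p assume "plot X n U p"
  then show "plot (quot_dspace X r) n U (\<lambda>u. r `` {p u})"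
    using plot_domain[OF X, of n U p] by (auto simp: quot_dspace_def)
next
  fix n U p u assume "plot (quot_dspace X r) n U p" "u \<in> U"
  then show "\<exists>V q. eopen n V \<and> u \<in> V \<and> V \<subseteq> U \<and> plot X n V q \<and> (\<forall>v\<in>V. r `` {q v} = p v)"
    by (simp add: quot_dspace_def) metis
qed (auto simp: quot_dspace_def intro: quotientI)

section \<open>Smooth homotopies\<close>

definition smoothstep :: "real \<Rightarrow> real \<Rightarrow> real \<Rightarrow> real" where
  "smoothstep b c s = flat (s - b) / (flat (s - b) + flat (c - s))"

text \<open>Every \<open>s\<close> satisfies \<open>s > b\<close> or \<open>s < c\<close>, so one of
  the two summands is positive.\<close>

lemma smoothstep_denom: "b < c \<Longrightarrow> flat (s - b) + flat (c - s) > 0"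
  using flat_pos[of "s - b"] flat_pos[of "c - s"] flat_nonneg[of "s - b"] flat_nonneg[of "c - s"]
  by (cases "s > b") (auto intro: add_pos_nonneg add_nonneg_pos)

lemma smoothstep_0: "s \<le> b \<Longrightarrow> smoothstep b c s = 0"
  by (simp add: smoothstep_def flat_zero)

lemma smoothstep_1: "b < c \<Longrightarrow> c \<le> s \<Longrightarrow> smoothstep b c s = 1"
  using smoothstep_denom[of b c s] by (simp add: smoothstep_def flat_zero)

lemma smoothstep_bounds: "0 \<le> smoothstep b c s" "smoothstep b c s \<le> 1"
  unfolding smoothstep_def using flat_nonneg[of "s - b"] flat_nonneg[of "c - s"]
  by (auto simp: divide_le_eq_1 intro: divide_nonneg_nonneg)

lemma smooth_real_smoothstep:
  assumes "diffeological_space X" "smooth X real_dspace f" "b < c"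
  shows "smooth X real_dspace (\<lambda>x. smoothstep b c (f x))"
  unfolding smoothstep_def using assms smoothstep_denom[OF assms(3)]
  by (intro smooth_real_intros) (auto simp: less_imp_neq[symmetric])

lemma smoothly_homotopic_sym:
  assumes X: "diffeological_space X" and h: "smoothly_homotopic X Y f g"
  shows "smoothly_homotopic X Y g f"
proof -
  obtain F where F: "smooth (prod_dspace X real_dspace) Y F" "\<forall>x\<in>pts X. F (x, 0) = f x \<and> F (x, 1) = g x"
    using h by (auto simp: smoothly_homotopic_def)
  have "smooth (prod_dspace X real_dspace) Y (\<lambda>z. F (fst z, 1 - snd z))"
    using X by (intro smooth_compose[OF _ F(1)] smooth_Pair smooth_fst smooth_real_intros smooth_snd
        diffeological_space_prod diffeological_space_real)
  then show ?thesis
    unfolding smoothly_homotopic_def using F(2) by (intro exI conjI) auto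
qed

text \<open>Two smooth homotopies need not fit together smoothly where they meet. Both are therefore
  reparametrised so as to equal \<open>g\<close> for all times in [1/3, 2/3]; on the D-open sets
  \<open>snd z < 2/3\<close> and \<open>snd z > 1/3\<close>, which cover everything, the
  concatenation then agrees with one smooth map.\<close>

lemma smoothly_homotopic_trans:
  assumes X: "diffeological_space X" and Y: "diffeological_space Y"
    and h1: "smoothly_homotopic X Y f g" and h2: "smoothly_homotopic X Y g k"
  shows "smoothly_homotopic X Y f k"
proof -
  let ?Z = "prod_dspace X real_dspace"
  obtain F where F: "smooth ?Z Y F" "\<forall>x\<in>pts X. F (x, 0) = f x \<and> F (x, 1) = g x"
    using h1 by (auto simp: smoothly_homotopic_def)
  obtain H where H: "smooth ?Z Y H" "\<forall>x\<in>pts X. H (x, 0) = g x \<and> H (x, 1) = k x"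
    using h2 by (auto simp: smoothly_homotopic_def)
  have Z: "diffeological_space ?Z" using X by (intro diffeological_space_prod diffeological_space_real)
  define a where "a = (\<lambda>s::real. smoothstep 0 (1/3) s)"
  define b where "b = (\<lambda>s::real. smoothstep (2/3) 1 s)"
  have F': "smooth ?Z Y (\<lambda>z. F (fst z, a (snd z)))"
    unfolding a_def by (intro smooth_compose[OF _ F(1)] smooth_Pair smooth_fst smooth_real_smoothstep smooth_snd Z) auto
  have H': "smooth ?Z Y (\<lambda>z. H (fst z, b (snd z)))"
    unfolding b_def by (intro smooth_compose[OF _ H(1)] smooth_Pair smooth_fst smooth_real_smoothstep smooth_snd Z) auto
  define K where "K = (\<lambda>z. if snd z < 1/2 then F (fst z, a (snd z)) else H (fst z, b (snd z)))"
  have a1: "a s = 1" if "s \<ge> 1/3" for s using that by (simp add: a_def smoothstep_1)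
  have b0: "b s = 0" if "s \<le> 2/3" for s using that by (simp add: b_def smoothstep_0)
  have "smooth ?Z Y K"
  proof (rule smooth_locally_eq[OF Z Y])
    fix z assume z: "z \<in> pts ?Z"
    show "\<exists>N g. D_open ?Z N \<and> z \<in> N \<and> smooth ?Z Y g \<and> (\<forall>y\<in>N. K y = g y)"
    proof (cases "snd z < 2/3")
      case True
      have "D_open ?Z {z\<in>pts ?Z. snd z < 2/3}" by (rule D_open_less[OF Z smooth_snd])
      moreover have "\<forall>y\<in>{z\<in>pts ?Z. snd z < 2/3}. K y = F (fst y, a (snd y))"
        using F(2) H(2) by (auto simp: K_def a1 b0)
      ultimately show ?thesis using F' True z by blast
    next
      case False
      have "D_open ?Z {z\<in>pts ?Z. snd z > 1/3}" by (rule D_open_less[OF Z smooth_snd])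
      moreover have "\<forall>y\<in>{z\<in>pts ?Z. snd z > 1/3}. K y = H (fst y, b (snd y))"
        using F(2) H(2) by (auto simp: K_def a1 b0)
      ultimately show ?thesis using H' False z by (intro exI[of _ "{z\<in>pts ?Z. snd z > 1/3}"] exI[of _ "\<lambda>z. H (fst z, b (snd z))"]) auto
    qed
  qed
  moreover have "a 0 = 0" "b 1 = 1" by (simp_all add: a_def b_def smoothstep_0 smoothstep_1)
  ultimately show ?thesis
    unfolding smoothly_homotopic_def using F(2) H(2) by (intro exI[of _ K]) (auto simp: K_def)
qed

section \<open>Locally finite families and partitions of unity\<close>

text \<open>Local finiteness of the nonzero sets instead of the supports. It is a pointwise
  condition, so \<open>loc_finite_map\<close> passes it to every family that vanishes where
  \<open>w\<close> does.\<close>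

definition loc_finite :: "'a dspace \<Rightarrow> 'i set \<Rightarrow> ('i \<Rightarrow> 'a \<Rightarrow> real) \<Rightarrow> bool" where
  "loc_finite X I w \<longleftrightarrow> (\<forall>x\<in>pts X. \<exists>N F. D_open X N \<and> x \<in> N \<and> finite F \<and> F \<subseteq> I \<and> (\<forall>i\<in>I - F. \<forall>y\<in>N. w i y = 0))"

lemma loc_finiteE:
  assumes "loc_finite X I w" "x \<in> pts X"
  obtains N F where "D_open X N" "x \<in> N" "finite F" "F \<subseteq> I" "\<And>i y. i \<in> I - F \<Longrightarrow> y \<in> N \<Longrightarrow> w i y = 0"
  using assms unfolding loc_finite_def by metis

lemma loc_finite_map:
  assumes "loc_finite X I w" "\<And>i x. i \<in> I \<Longrightarrow> w i x = 0 \<Longrightarrow> v i x = 0"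
  shows "loc_finite X I v"
  unfolding loc_finite_def
proof
  fix x assume "x \<in> pts X"
  from loc_finiteE[OF assms(1) this] obtain N F where
    "D_open X N" "x \<in> N" "finite F" "F \<subseteq> I" "\<And>i y. i \<in> I - F \<Longrightarrow> y \<in> N \<Longrightarrow> w i y = 0" by metis
  then show "\<exists>N F. D_open X N \<and> x \<in> N \<and> finite F \<and> F \<subseteq> I \<and> (\<forall>i\<in>I - F. \<forall>y\<in>N. v i y = 0)"
    using assms(2) by (intro exI[of _ N] exI[of _ F]) auto
qed

lemma loc_finite_finite: "loc_finite X I w \<Longrightarrow> x \<in> pts X \<Longrightarrow> finite {i\<in>I. w i x \<noteq> 0}"
  by (erule loc_finiteE, assumption) (erule finite_subset[rotated], auto)

lemma smooth_real_loc_finite_sum: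
  assumes X: "diffeological_space X" and lf: "loc_finite X I w"
    and w: "\<And>i. i \<in> I \<Longrightarrow> smooth X real_dspace (w i)"
  shows "smooth X real_dspace (\<lambda>x. \<Sum>i | i \<in> I \<and> w i x \<noteq> 0. w i x)"
proof (rule smooth_locally_eq[OF X diffeological_space_real])
  fix x assume "x \<in> pts X"
  from loc_finiteE[OF lf this] obtain N F where N:
    "D_open X N" "x \<in> N" "finite F" "F \<subseteq> I" "\<And>i y. i \<in> I - F \<Longrightarrow> y \<in> N \<Longrightarrow> w i y = 0" by metis
  have "(\<Sum>i | i \<in> I \<and> w i y \<noteq> 0. w i y) = (\<Sum>i\<in>F. w i y)" if "y \<in> N" for y
    using N that by (intro sum.mono_neutral_left) auto
  moreover have "smooth X real_dspace (\<lambda>y. \<Sum>i\<in>F. w i y)"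
    using N(4) w by (intro smooth_real_sum X) auto
  ultimately show "\<exists>N g. D_open X N \<and> x \<in> N \<and> smooth X real_dspace g \<and>
      (\<forall>y\<in>N. (\<Sum>i | i \<in> I \<and> w i y \<noteq> 0. w i y) = g y)"
    using N(1,2) by (intro exI[of _ N] exI[of _ "\<lambda>y. \<Sum>i\<in>F. w i y"]) auto
qed

text \<open>Near each point all but finitely many factors are 1, so the product is locally a finite
  one.\<close>

lemma smooth_real_loc_finite_prod:
  assumes X: "diffeological_space X" and lf: "loc_finite X I (\<lambda>i x. w i x - 1)"
    and w: "\<And>i. i \<in> I \<Longrightarrow> smooth X real_dspace (w i)"
  shows "smooth X real_dspace (\<lambda>x. \<Prod>i | i \<in> I \<and> w i x \<noteq> 1. w i x)"
proof (rule smooth_locally_eq[OF X diffeological_space_real])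
  fix x assume "x \<in> pts X"
  from loc_finiteE[OF lf this] obtain N F where N:
    "D_open X N" "x \<in> N" "finite F" "F \<subseteq> I" "\<And>i y. i \<in> I - F \<Longrightarrow> y \<in> N \<Longrightarrow> w i y - 1 = 0" by metis
  have "(\<Prod>i | i \<in> I \<and> w i y \<noteq> 1. w i y) = (\<Prod>i\<in>F. w i y)" if "y \<in> N" for y
    using N that by (intro prod.mono_neutral_left) auto
  moreover have "smooth X real_dspace (\<lambda>y. \<Prod>i\<in>F. w i y)"
    using N(4) w by (intro smooth_real_prod X) auto
  ultimately show "\<exists>N g. D_open X N \<and> x \<in> N \<and> smooth X real_dspace g \<and>
      (\<forall>y\<in>N. (\<Prod>i | i \<in> I \<and> w i y \<noteq> 1. w i y) = g y)"
    using N(1,2) by (intro exI[of _ N] exI[of _ "\<lambda>y. \<Prod>i\<in>F. w i y"]) auto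
qed

lemma topspace_D_topology: "diffeological_space X \<Longrightarrow> topspace (D_topology X) = pts X"
  using D_open_pts[of X] openin_D_topology[of X] D_open_subset[of X]
  by (metis openin_subset openin_topspace subset_antisym)

text \<open>A D-open set that misses the positive set also misses its closure. Supports are bounded
  from above by exhibiting such a set.\<close>

lemma D_supp_minimal:
  assumes X: "diffeological_space X" and U: "D_open X U"
    and zero: "\<And>x. x \<in> U \<Longrightarrow> f x \<le> 0"
  shows "D_supp X f \<inter> U = {}"
proof -
  have "U \<inter> D_topology X closure_of {x \<in> pts X. f x > 0} = {} \<longleftrightarrow> U \<inter> {x \<in> pts X. f x > 0} = {}"
    using U by (intro openin_Int_closure_of_eq_empty) (simp add: openin_D_topology)
  then show ?thesis using zero by (fastforce simp: D_supp_def)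
qed

lemma D_supp_subset_pts: "diffeological_space X \<Longrightarrow> D_supp X f \<subseteq> pts X"
  using closure_of_subset_topspace[of "D_topology X"] by (simp add: D_supp_def topspace_D_topology)

lemma in_D_supp: "diffeological_space X \<Longrightarrow> x \<in> pts X \<Longrightarrow> f x > 0 \<Longrightarrow> x \<in> D_supp X f"
  unfolding D_supp_def
  by (intro subsetD[OF closure_of_subset]) (auto simp: topspace_D_topology)

lemma not_in_D_supp:
  assumes "diffeological_space X" "x \<in> pts X" "x \<notin> D_supp X f"
  obtains N where "D_open X N" "x \<in> N" "\<And>y. y \<in> N \<Longrightarrow> \<not> f y > 0"
proof (rule that[of "pts X - D_supp X f"])
  have "closedin (D_topology X) (D_supp X f)" by (simp add: D_supp_def)
  then have "openin (D_topology X) (topspace (D_topology X) - D_supp X f)" by blast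
  then show "D_open X (pts X - D_supp X f)"
    using assms(1) by (simp add: openin_D_topology topspace_D_topology)
  show "\<not> f y > 0" if "y \<in> pts X - D_supp X f" for y
    using in_D_supp[OF assms(1), of y f] that by blast
qed (use assms in auto)

lemma ex_first_pos: "(\<exists>k. f k > (0::real)) \<Longrightarrow> (\<And>k. f k \<ge> 0) \<Longrightarrow> \<exists>k. f k > 0 \<and> (\<forall>j<k::nat. f j = 0)"
proof -
  assume "\<exists>k. f k > 0" and n: "\<And>k. f k \<ge> 0"
  then have "f (LEAST k. f k > 0) > 0" by (rule_tac LeastI_ex)
  moreover have "f j = 0" if "j < (LEAST k. f k > 0)" for j
    using not_less_Least[OF that] n[of j] by auto
  ultimately show ?thesis by blast
qed

text \<open>The sequence is first made locally finite by switching \<open>g\<^sub>k\<close> off where some earlier \<open>g\<^sub>j\<close>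
  exceeds about \<open>1/k\<close>; then the supports are shrunk by keeping only the points where \<open>w\<^sub>k\<close> is
  comparable to the largest member. The smooth quantity \<open>Q/W\<close> replaces the maximum.\<close>

lemma partition_of_unity_from_sequence:
  fixes f :: "nat \<Rightarrow> 'a \<Rightarrow> real"
  assumes X: "diffeological_space X" and f: "\<And>k. smooth X real_dspace (f k)"
    and f0: "\<And>k x. x \<in> pts X \<Longrightarrow> f k x \<ge> 0" and fpos: "\<And>x. x \<in> pts X \<Longrightarrow> \<exists>k. f k x > 0"
  obtains t where "\<And>k. smooth X real_dspace (t k)" "\<And>k x. x \<in> pts X \<Longrightarrow> t k x \<ge> 0"
    "loc_finite X UNIV t" "\<And>x. x \<in> pts X \<Longrightarrow> (\<Sum>k | t k x \<noteq> 0. t k x) = 1"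
    "\<And>k. D_supp X (t k) \<subseteq> {x\<in>pts X. f k x > 0}"
proof -
  \<comment> \<open>Same positive set as \<open>f k\<close>, but below 1: hence \<open>w k\<close>
    vanishes as soon as the subtracted term reaches 1.\<close>
  define g where "g k x = f k x / (1 + f k x)" for k x
  have g: "smooth X real_dspace (g k)" for k
    unfolding g_def using f0 by (intro smooth_real_intros X f) (force simp: add_nonneg_eq_0_iff)
  have g0: "g k x \<ge> 0" and g1: "g k x < 1" and gf: "g k x > 0 \<longleftrightarrow> f k x > 0" if "x \<in> pts X" for k x
    using f0[OF that, of k] by (auto simp: g_def divide_simps)
  define w where "w k x = flat (g k x - real k * (\<Sum>j<k. g j x))" for k x
  have w: "smooth X real_dspace (w k)" for k
    unfolding w_def by (intro smooth_real_intros X g)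
  have w0: "w k x \<ge> 0" for k x by (simp add: w_def flat_nonneg)
  have wf: "f k x > 0" if "w k x > 0" "x \<in> pts X" for k x
  proof -
    have "(\<Sum>j<k. g j x) \<ge> 0" using g0[OF that(2)] by (intro sum_nonneg) auto
    then have "real k * (\<Sum>j<k. g j x) \<ge> 0" by simp
    then have "g k x > 0" using that(1) by (auto simp: w_def flat_pos)
    then show ?thesis using gf[OF that(2)] by simp
  qed
  have wpos: "\<exists>k. w k x > 0" if x: "x \<in> pts X" for x
  proof -
    \<comment> \<open>At the first index with a positive value nothing is subtracted.\<close>
    have "\<exists>k. g k x > 0 \<and> (\<forall>j<k. g j x = 0)"
      using fpos[OF x] gf[OF x] g0[OF x] by (intro ex_first_pos) auto
    then obtain k where "g k x > 0" "\<forall>j<k. g j x = 0" by blast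
    then have "w k x > 0" by (simp add: w_def flat_pos)
    then show ?thesis by blast
  qed
  have lf: "loc_finite X UNIV w"
    unfolding loc_finite_def
  proof
    fix x assume x: "x \<in> pts X"
    obtain n where n: "g n x > 0" using fpos[OF x] gf[OF x] by blast
    let ?N = "{y\<in>pts X. g n y > g n x / 2}"
    \<comment> \<open>On \<open>?N\<close> one has \<open>g n y > g n x / 2\<close>. From index
      \<open>Suc n + m\<close> on, the sum contains \<open>g n\<close>, and its factor
      \<open>real k\<close> exceeds \<open>2 / g n x\<close>, so the subtracted term is at least
      1.\<close>
    obtain m :: nat where m: "real m > 2 / g n x" using reals_Archimedean2 by blast
    have "w k y = 0" if y: "y \<in> ?N" and k: "k \<ge> Suc n + m" for k y
    proof -
      have "g n y \<le> (\<Sum>j<k. g j y)"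
        using k g0 y by (intro member_le_sum) auto
      then have "g n x / 2 \<le> (\<Sum>j<k. g j y)" using y by auto
      moreover have "real k \<ge> 2 / g n x" using m k by linarith
      ultimately have "(2 / g n x) * (g n x / 2) \<le> real k * (\<Sum>j<k. g j y)"
        using n by (intro mult_mono) auto
      then have "1 \<le> real k * (\<Sum>j<k. g j y)" using n by simp
      then show ?thesis using g1[of y k] y by (simp add: w_def flat_zero)
    qed
    then show "\<exists>N F. D_open X N \<and> x \<in> N \<and> finite F \<and> F \<subseteq> UNIV \<and> (\<forall>i\<in>UNIV - F. \<forall>y\<in>N. w i y = 0)"
      using x n D_open_less(1)[OF X g[of n], of "g n x / 2"] by (intro exI[of _ ?N] exI[of _ "{..<Suc n + m}"]) auto
  qed
  define W where "W x = (\<Sum>k | k \<in> UNIV \<and> w k x \<noteq> 0. w k x)" for x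
  define Q where "Q x = (\<Sum>k | k \<in> UNIV \<and> w k x * w k x \<noteq> 0. w k x * w k x)" for x
  have W: "smooth X real_dspace W" unfolding W_def
    by (rule smooth_real_loc_finite_sum[OF X lf w])
  have Q: "smooth X real_dspace Q" unfolding Q_def
    by (intro smooth_real_loc_finite_sum[OF X loc_finite_map[OF lf]] smooth_real_intros X w) auto
  \<comment> \<open>Positive exactly where \<open>2 * w k x * W x > Q x\<close>. The largest
    \<open>w k x\<close> qualifies, as \<open>Q x\<close> is at most this maximum times
    \<open>W x\<close>. The weak inequality survives in the closure and still forces
    \<open>w k x > 0\<close>; the factor 2 leaves the slack that makes the first inequality
    strict.\<close>
  define v where "v k x = flat (2 * w k x * W x - Q x)" for k x
  have v: "smooth X real_dspace (v k)" for k
    unfolding v_def by (intro smooth_real_intros X w W Q)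
  have v0: "v k x \<ge> 0" for k x by (simp add: v_def flat_nonneg)
  have Q0: "Q x \<ge> 0" for x unfolding Q_def by (intro sum_nonneg) auto
  have lfv: "loc_finite X UNIV v"
    using Q0 by (intro loc_finite_map[OF lf]) (simp add: v_def flat_zero)
  have Qpos: "Q x > 0" and vpos: "\<exists>k. v k x > 0" if x: "x \<in> pts X" for x
  proof -
    let ?S = "{k. w k x \<noteq> 0}"
    have fin: "finite ?S" using loc_finite_finite[OF lf x] by simp
    have ne: "?S \<noteq> {}" using wpos[OF x] by force
    have Qe: "Q x = (\<Sum>k\<in>?S. w k x * w k x)" and We: "W x = (\<Sum>k\<in>?S. w k x)"
      by (simp_all add: Q_def W_def)
    have sp: "w k x > 0" if "k \<in> ?S" for k using that w0[of k x] by (simp add: order_less_le)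
    show Qp: "Q x > 0" unfolding Qe using fin ne sp by (intro sum_pos) auto
    define M where "M = Max ((\<lambda>k. w k x) ` ?S)"
    have "M \<in> (\<lambda>k. w k x) ` ?S" unfolding M_def using fin ne by (intro Max_in) auto
    then obtain m where m: "M = w m x" by auto
    have "w k x \<le> M" if "k \<in> ?S" for k using that fin by (auto simp: M_def)
    then have "Q x \<le> (\<Sum>k\<in>?S. M * w k x)"
      unfolding Qe by (intro sum_mono mult_right_mono) (auto simp: w0)
    also have "\<dots> = w m x * W x" by (simp add: We sum_distrib_left m)
    finally have "v m x > 0" using Qp by (simp add: v_def flat_pos)
    then show "\<exists>k. v k x > 0" by blast
  qed
  define T where "T x = (\<Sum>k | k \<in> UNIV \<and> v k x \<noteq> 0. v k x)" for x
  have T: "smooth X real_dspace T" unfolding T_def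
    by (rule smooth_real_loc_finite_sum[OF X lfv v])
  have Tpos: "T x > 0" if x: "x \<in> pts X" for x
  proof -
    have fin: "finite {k. v k x \<noteq> 0}" using loc_finite_finite[OF lfv x] by simp
    moreover have "{k. v k x \<noteq> 0} \<noteq> {}" using vpos[OF x] by force
    moreover have "v k x > 0" if "v k x \<noteq> 0" for k using that v0[of k x] by simp
    ultimately show ?thesis unfolding T_def by (intro sum_pos) auto
  qed
  define t where "t k x = v k x / T x" for k x
  show ?thesis
  proof (rule that[of t])
    show "smooth X real_dspace (t k)" for k
      unfolding t_def using Tpos by (intro smooth_real_intros X v T) force
    show "t k x \<ge> 0" if "x \<in> pts X" for k x
      using v0[of k x] Tpos[OF that] by (simp add: t_def)
    show "loc_finite X UNIV t" by (rule loc_finite_map[OF lfv]) (simp add: t_def)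
    show "(\<Sum>k | t k x \<noteq> 0. t k x) = 1" if x: "x \<in> pts X" for x
    proof -
      have "(\<Sum>k | t k x \<noteq> 0. t k x) = (\<Sum>k | v k x \<noteq> 0. v k x / T x)"
        by (rule sum.cong) (use Tpos[OF x] in \<open>auto simp: t_def\<close>)
      also have "\<dots> = (\<Sum>k | v k x \<noteq> 0. v k x) / T x" by (simp only: sum_divide_distrib)
      also have "(\<Sum>k | v k x \<noteq> 0. v k x) = T x" by (simp add: T_def)
      finally show ?thesis using Tpos[OF x] by simp
    qed
    show "D_supp X (t k) \<subseteq> {x\<in>pts X. f k x > 0}" for k
    proof
      fix x assume xs: "x \<in> D_supp X (t k)"
      then have x: "x \<in> pts X" using D_supp_subset_pts[OF X] by blast
      let ?U = "{y\<in>pts X. 2 * w k y * W y - Q y < 0}"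
      have "D_open X ?U"
        by (rule D_open_less[OF X]) (intro smooth_real_intros X w W Q)
      then have "D_supp X (t k) \<inter> ?U = {}"
        by (rule D_supp_minimal[OF X]) (simp add: t_def v_def flat_zero)
      then have "2 * w k x * W x \<ge> Q x" using x xs by auto
      then have "w k x * W x > 0" using Qpos[OF x] by linarith
      then have "w k x > 0" using w0[of k x] by (metis less_eq_real_def mult_zero_left order_less_irrefl)
      then show "x \<in> {x\<in>pts X. f k x > 0}" using wf x by simp
    qed
  qed
qed

section \<open>Bundles with equivariant charts\<close>

locale dgrp = fixes G :: "'g dgroup" (structure)
  assumes dgroup: "diffeological_group G"
begin

lemma is_group: "group G" and space_G: "diffeological_space (space_of G)"
  using dgroup by (auto simp: diffeological_group_def)

sublocale group G by (rule is_group)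

lemma smooth_inv:
  assumes "smooth X (space_of G) a"
  shows "smooth X (space_of G) (\<lambda>x. inv (a x))"
proof -
  have i: "smooth (space_of G) (space_of G) (\<lambda>x. inv x)"
    using dgroup by (simp add: diffeological_group_def)
  show ?thesis by (rule smooth_compose[OF assms i])
qed

lemma gplot_mult: "plot (space_of G) n U a \<Longrightarrow> plot (space_of G) n U b \<Longrightarrow> plot (space_of G) n U (\<lambda>u. a u \<otimes> b u)"
  using dgroup by (auto simp: diffeological_group_def prod_dspace_def comp_def
      dest!: smoothD[of _ _ "\<lambda>(x, y). x \<otimes> y" n U "\<lambda>u. (a u, b u)"])

lemma gplot_inv: "plot (space_of G) n U a \<Longrightarrow> plot (space_of G) n U (\<lambda>u. inv (a u))"
  using dgroup by (auto simp: diffeological_group_def dest!: smoothD)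

end

locale Gspace = dgrp G for G :: "'g dgroup" (structure) +
  fixes B :: "'b dspace" and P :: "('e, 'b, 'g) gbundle"
  assumes base: "diffeological_space B" and over: "G_space_over G B P"
begin

lemma total: "diffeological_space (tot P)" and prj_smooth: "smooth (tot P) B (prj P)"
  and action: "smooth_right_action G (tot P) (act P)"
  and prj_act: "x \<in> pts (tot P) \<Longrightarrow> g \<in> carrier G \<Longrightarrow> prj P (act P x g) = prj P x"
  using over by (auto simp: G_space_over_def)

lemma act_smooth0: "smooth (prod_dspace (tot P) (space_of G)) (tot P) (\<lambda>(x, g). act P x g)"
  and act_one: "x \<in> pts (tot P) \<Longrightarrow> act P x \<one> = x"
  and act_act: "x \<in> pts (tot P) \<Longrightarrow> g \<in> carrier G \<Longrightarrow> h \<in> carrier G \<Longrightarrow>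
     act P (act P x g) h = act P x (g \<otimes> h)"
  using action by (auto simp: smooth_right_action_def)

lemma act_smooth: "smooth X (tot P) a \<Longrightarrow> smooth X (space_of G) b \<Longrightarrow> smooth X (tot P) (\<lambda>x. act P (a x) (b x))"
  using smooth_compose[OF smooth_Pair act_smooth0, of X a b] by simp

lemma act_plot: "plot (tot P) n U a \<Longrightarrow> plot (space_of G) n U b \<Longrightarrow> plot (tot P) n U (\<lambda>u. act P (a u) (b u))"
  using smoothD[OF act_smooth0, of n U "\<lambda>u. (a u, b u)"] by (simp add: prod_dspace_def comp_def)

lemma act_pts: "x \<in> pts (tot P) \<Longrightarrow> g \<in> carrier G \<Longrightarrow> act P x g \<in> pts (tot P)"
  using smooth_pts[OF act_smooth0, of "(x, g)"] by simp

lemma prj_pts: "x \<in> pts (tot P) \<Longrightarrow> prj P x \<in> pts B"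
  using smooth_pts[OF prj_smooth] .

end

text \<open>The fibres are exactly the orbits and plots of the base lift. Freeness of the action is
  not assumed; it follows from charts in \<open>act_free\<close>.\<close>

locale Gtorsor = Gspace +
  assumes subd: "subduction (tot P) B (prj P)"
    and transitive: "x \<in> pts (tot P) \<Longrightarrow> y \<in> pts (tot P) \<Longrightarrow> prj P x = prj P y \<Longrightarrow>
       \<exists>g\<in>carrier G. y = act P x g"
begin

lemma surj: "b \<in> pts B \<Longrightarrow> \<exists>x\<in>pts (tot P). prj P x = b"
  by (rule subduction_surj[OF base total subd]) auto

text \<open>In each fibre \<open>act P x (inv (\<gamma> x))\<close> is the unique point at which
  \<gamma> takes the value \<one>. It depends only on the fibre, hence descends to a smooth section
  \<open>s\<close>, and \<open>act P (s b) g\<close> inverts the pair of \<open>prj P\<close> and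
  \<gamma>.\<close>

lemma trivial_bundle_of_equivariant:
  assumes \<gamma>: "smooth (tot P) (space_of G) \<gamma>"
    and eq: "\<And>x g. x \<in> pts (tot P) \<Longrightarrow> g \<in> carrier G \<Longrightarrow> \<gamma> (act P x g) = \<gamma> x \<otimes> g"
  shows "trivial_bundle G B P"
proof -
  have gc: "\<gamma> x \<in> carrier G" if "x \<in> pts (tot P)" for x using smooth_pts[OF \<gamma> that] by simp
  have F: "smooth (tot P) (tot P) (\<lambda>x. act P x (inv (\<gamma> x)))"
    by (intro act_smooth smooth_id smooth_inv \<gamma>)
  have inv: "act P x (inv (\<gamma> x)) = act P y (inv (\<gamma> y))"
    if xy: "x \<in> pts (tot P)" "y \<in> pts (tot P)" "prj P x = prj P y" for x y
  proof -
    obtain g where g: "g \<in> carrier G" "y = act P x g" using transitive[OF xy] by blast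
    then have "inv (\<gamma> y) = inv g \<otimes> inv (\<gamma> x)"
      using eq xy gc by (simp add: inv_mult_group)
    moreover have "g \<otimes> (inv g \<otimes> inv (\<gamma> x)) = inv (\<gamma> x)"
      using g gc[OF xy(1)] by (simp add: m_assoc[symmetric])
    ultimately show ?thesis using g xy gc by (simp add: act_act)
  qed
  obtain s where s: "smooth B (tot P) s" "\<And>x. x \<in> pts (tot P) \<Longrightarrow> s (prj P x) = act P x (inv (\<gamma> x))"
    using subduction_descend[OF base total total subd F inv] by metis
  let ?\<phi> = "\<lambda>x. (prj P x, \<gamma> x)" and ?\<psi> = "\<lambda>(b, g). act P (s b) g"
  have "diffeomorphism (tot P) (tot (product_bundle G B)) ?\<phi>"
    unfolding diffeomorphism_def
  proof (intro conjI exI[of _ ?\<psi>] ballI)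
    show "smooth (tot P) (tot (product_bundle G B)) ?\<phi>"
      by (simp add: product_bundle_def smooth_Pair[OF prj_smooth \<gamma>])
    show "smooth (tot (product_bundle G B)) (tot P) ?\<psi>"
      unfolding product_bundle_def case_prod_unfold gbundle.simps
      by (intro act_smooth smooth_compose[OF smooth_fst s(1)] smooth_snd)
    show "?\<psi> (?\<phi> x) = x" if x: "x \<in> pts (tot P)" for x
      using x gc by (simp add: s(2) act_act act_one)
    fix y assume "y \<in> pts (tot (product_bundle G B))"
    then obtain b g where y: "y = (b, g)" "b \<in> pts B" "g \<in> carrier G" by (auto simp: product_bundle_def)
    obtain x where x: "x \<in> pts (tot P)" "prj P x = b" using surj[OF y(2)] by blast
    have sb: "s b = act P x (inv (\<gamma> x))" "s b \<in> pts (tot P)" using s(2)[OF x(1)] x act_pts gc by auto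
    have "\<gamma> (s b) = \<one>" using x gc by (simp add: sb eq)
    then show "?\<phi> (?\<psi> y) = y"
      using y x gc sb(2) by (simp add: prj_act eq) (simp add: sb prj_act)
  qed
  then have "bundle_isomorphic G P (product_bundle G B)"
    unfolding bundle_isomorphic_def
    by (intro exI[of _ ?\<phi>]) (auto simp: product_bundle_def prj_act eq)
  then show ?thesis by (simp add: trivial_bundle_def over)
qed

lemma Gtorsor_restrict: "Gtorsor G (sub_dspace B A) (restrict_bundle P A)"
proof (intro Gtorsor.intro Gspace.intro Gspace_axioms.intro Gtorsor_axioms.intro dgrp_axioms)
  let ?R = "restrict_bundle P A"
  let ?T = "sub_dspace (tot P) {x. prj P x \<in> A}"
  have R: "tot ?R = ?T" "prj ?R = prj P" "act ?R = act P" by (simp_all add: restrict_bundle_def)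
  show "diffeological_space (sub_dspace B A)" by (rule diffeological_space_sub[OF base])
  have T: "diffeological_space ?T" by (rule diffeological_space_sub[OF total])
  show "G_space_over G (sub_dspace B A) ?R"
    unfolding G_space_over_def R smooth_right_action_def case_prod_unfold
  proof (intro conjI ballI T)
    show "smooth ?T (sub_dspace B A) (prj P)"
      by (intro smooth_into_sub T smooth_from_sub prj_smooth) auto
    show "smooth (prod_dspace ?T (space_of G)) ?T (\<lambda>p. act P (fst p) (snd p))"
      by (intro smooth_into_sub diffeological_space_prod T space_G act_smooth smooth_snd
          smooth_compose[OF smooth_fst smooth_from_sub[OF smooth_id]]) (auto simp: prj_act)
  qed (auto simp: act_one act_act prj_act)
  show "subduction (tot ?R) (sub_dspace B A) (prj ?R)"
    unfolding subduction_def R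
  proof (intro conjI allI impI ballI)
    show "smooth ?T (sub_dspace B A) (prj P)"
      by (intro smooth_into_sub T smooth_from_sub prj_smooth) auto
    fix n U p u assume p: "plot (sub_dspace B A) n U p" "u \<in> U"
    then have p': "plot B n U p" "p \<in> U \<rightarrow> A" by (auto simp: sub_dspace_def)
    from subductionE[OF subd p'(1) p(2)] obtain V q where
      "eopen n V" "u \<in> V" "V \<subseteq> U" "plot (tot P) n V q" "\<And>v. v \<in> V \<Longrightarrow> prj P (q v) = p v" by metis
    then show "\<exists>V q. eopen n V \<and> u \<in> V \<and> V \<subseteq> U \<and> plot ?T n V q \<and> (\<forall>v\<in>V. prj P (q v) = p v)"
      using p'(2) by (intro exI[of _ V] exI[of _ q]) (auto simp: sub_dspace_def)
  qed
  fix x y assume "x \<in> pts (tot ?R)" "y \<in> pts (tot ?R)" "prj ?R x = prj ?R y"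
  then show "\<exists>g\<in>carrier G. y = act ?R x g"
    unfolding R by (intro transitive) auto
qed

lemma Gtorsor_pullback:
  assumes C: "diffeological_space C" and h: "smooth C B h"
  shows "Gtorsor G C (pullback_bundle h C P)"
proof (intro Gtorsor.intro Gspace.intro Gspace_axioms.intro Gtorsor_axioms.intro dgrp_axioms)
  let ?R = "pullback_bundle h C P"
  let ?T = "sub_dspace (prod_dspace C (tot P)) {p. h (fst p) = prj P (snd p)}"
  have R: "tot ?R = ?T" "prj ?R = fst" "act ?R = (\<lambda>p g. (fst p, act P (snd p) g))"
    by (simp_all add: pullback_bundle_def case_prod_unfold)
  show "diffeological_space C" by (rule C)
  have T: "diffeological_space ?T" by (intro diffeological_space_sub diffeological_space_prod C total)
  show "G_space_over G C ?R"
    unfolding G_space_over_def R smooth_right_action_def case_prod_unfold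
  proof (intro conjI ballI T)
    show "smooth ?T C fst" by (intro smooth_from_sub smooth_fst)
    show "smooth (prod_dspace ?T (space_of G)) ?T
       (\<lambda>p. (fst (fst p), act P (snd (fst p)) (snd p)))"
      by (intro smooth_into_sub diffeological_space_prod T space_G act_smooth smooth_snd smooth_Pair
          smooth_compose[OF smooth_fst smooth_from_sub[OF smooth_fst]]
          smooth_compose[OF smooth_fst smooth_from_sub[OF smooth_snd]]) (auto simp: prj_act)
  qed (use T in \<open>auto simp: act_one act_act prj_act case_prod_unfold\<close>)
  show "subduction (tot ?R) C (prj ?R)"
    unfolding subduction_def R
  proof (intro conjI allI impI ballI)
    show "smooth ?T C fst" by (intro smooth_from_sub smooth_fst)
    fix n U p u assume p: "plot C n U p" "u \<in> U"
    from subductionE[OF subd smoothD[OF h p(1)] p(2)] obtain V q where V: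
      "eopen n V" "u \<in> V" "V \<subseteq> U" "plot (tot P) n V q" "\<And>v. v \<in> V \<Longrightarrow> prj P (q v) = h (p v)" by metis
    have "plot C n V p" using plot_restrict[OF C p(1) V(1,3)] .
    then have "plot ?T n V (\<lambda>v. (p v, q v))"
      using V by (auto simp: sub_dspace_def prod_dspace_def comp_def)
    then show "\<exists>V q. eopen n V \<and> u \<in> V \<and> V \<subseteq> U \<and> plot ?T n V q \<and> (\<forall>v\<in>V. fst (q v) = p v)"
      using V by (intro exI[of _ V] exI[of _ "\<lambda>v. (p v, q v)"]) auto
  qed
  fix x y assume xy: "x \<in> pts (tot ?R)" "y \<in> pts (tot ?R)" "prj ?R x = prj ?R y"
  then obtain g where "g \<in> carrier G" "snd y = act P (snd x) g"
    using transitive[of "snd x" "snd y"] unfolding R by auto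
  then show "\<exists>g\<in>carrier G. y = act ?R x g"
    using xy unfolding R by (intro bexI[of _ g]) (auto simp: case_prod_unfold prod_eq_iff)
qed

end

text \<open>The type variables are those of the imported locale after renaming: \<open>'a\<close>
  belongs to the group, \<open>'b\<close> to the base and \<open>'c\<close> to the total
  space.\<close>

locale charted = Gtorsor +
  fixes f :: "nat \<Rightarrow> 'b \<Rightarrow> real" and \<gamma> :: "nat \<Rightarrow> 'c \<Rightarrow> 'a"
  assumes f_smooth: "smooth B real_dspace (f k)"
    and f_nonneg: "b \<in> pts B \<Longrightarrow> f k b \<ge> 0"
    and f_pos: "b \<in> pts B \<Longrightarrow> \<exists>k. f k b > 0"
    and \<gamma>_smooth: "smooth (sub_dspace (tot P) {x. f k (prj P x) > 0}) (space_of G) (\<gamma> k)"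
    and \<gamma>_equiv: "x \<in> pts (tot P) \<Longrightarrow> f k (prj P x) > 0 \<Longrightarrow> g \<in> carrier G \<Longrightarrow> \<gamma> k (act P x g) = \<gamma> k x \<otimes> g"
begin

lemma \<gamma>_carrier: "x \<in> pts (tot P) \<Longrightarrow> f k (prj P x) > 0 \<Longrightarrow> \<gamma> k x \<in> carrier G"
  using smooth_pts[OF \<gamma>_smooth, of x k] by simp

text \<open>A chart turns the action into right multiplication, which can be cancelled.\<close>

lemma act_free:
  assumes "x \<in> pts (tot P)" "g \<in> carrier G" "h \<in> carrier G" "act P x g = act P x h"
  shows "g = h"
proof -
  obtain k where k: "f k (prj P x) > 0" using f_pos[OF prj_pts[OF assms(1)]] by blast
  then have "\<gamma> k x \<otimes> g = \<gamma> k x \<otimes> h" using \<gamma>_equiv[OF assms(1) k] assms by metis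
  then show ?thesis using \<gamma>_carrier[OF assms(1) k] assms(2,3) by simp
qed

definition "cdom k = {b\<in>pts B. f k b > 0}"

lemma D_open_cdom: "D_open B (cdom k)"
  unfolding cdom_def by (rule D_open_less[OF base f_smooth])

lemma trivial_restrict: "trivial_bundle G (sub_dspace B (cdom k)) (restrict_bundle P (cdom k))"
proof -
  interpret R: Gtorsor G "sub_dspace B (cdom k)" "restrict_bundle P (cdom k)" by (rule Gtorsor_restrict)
  show ?thesis
  proof (rule R.trivial_bundle_of_equivariant)
    show "smooth (tot (restrict_bundle P (cdom k))) (space_of G) (\<gamma> k)"
      unfolding restrict_bundle_def gbundle.simps
      by (rule smooth_from_sub_mono[OF total \<gamma>_smooth]) (simp add: cdom_def)
    show "\<gamma> k (act (restrict_bundle P (cdom k)) x g) = \<gamma> k x \<otimes> g"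
      if "x \<in> pts (tot (restrict_bundle P (cdom k)))" "g \<in> carrier G" for x g
      using that by (auto simp: restrict_bundle_def cdom_def intro: \<gamma>_equiv)
  qed
qed

lemma UN_cdom: "(\<Union>k. cdom k) = pts B"
  using f_pos by (auto simp: cdom_def)

lemma locally_trivial: "locally_trivial_bundle G B P"
  unfolding locally_trivial_bundle_def
  using over D_open_cdom trivial_restrict UN_cdom by (intro conjI exI[of _ "range cdom"]) auto

lemma charted_pullback:
  assumes C: "diffeological_space C" and h: "smooth C B h"
  shows "charted G C (pullback_bundle h C P) (\<lambda>k b. f k (h b)) (\<lambda>k x. \<gamma> k (snd x))"
proof -
  interpret R: Gtorsor G C "pullback_bundle h C P" by (rule Gtorsor_pullback[OF C h])
  let ?S = "sub_dspace (tot P) {x. f k (prj P x) > 0}"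
  show ?thesis
  proof
    fix k
    show "smooth C real_dspace (\<lambda>b. f k (h b))" by (rule smooth_compose[OF h f_smooth])
    let ?D = "sub_dspace (tot (pullback_bundle h C P)) {x. f k (h (prj (pullback_bundle h C P) x)) > 0}"
    have "smooth ?D (sub_dspace (tot P) {x. f k (prj P x) > 0}) snd"
      unfolding pullback_bundle_def gbundle.simps
      by (intro smooth_into_sub diffeological_space_sub diffeological_space_prod C total
          smooth_from_sub smooth_snd) auto
    then show "smooth ?D (space_of G) (\<lambda>x. \<gamma> k (snd x))"
      by (rule smooth_compose[OF _ \<gamma>_smooth])
  qed (use smooth_pts[OF h] f_nonneg f_pos in \<open>auto simp: pullback_bundle_def intro!: \<gamma>_equiv\<close>)
qed

text \<open>A plot is a smooth map from its domain with the standard diffeology, and charts pull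
  back along smooth maps.\<close>

lemma principal: "principal_bundle G B P"
  unfolding principal_bundle_def
proof (intro conjI allI impI over)
  fix n U p assume p: "plot B n U p"
  have U: "eopen n U" using plot_domain[OF base p] .
  have E: "diffeological_space (euclid_dspace n U)" by (rule diffeological_space_euclid[OF U])
  have "smooth (euclid_dspace n U) B p"
  proof (rule smoothI)
    fix m V q assume "plot (euclid_dspace n U) m V q"
    then show "plot B m V (\<lambda>u. p (q u))"
      using plot_compose[OF base p, of m V q] by (simp add: euclid_dspace_def comp_def)
  qed (use plot_pts[OF base p] in \<open>simp add: euclid_dspace_def\<close>)
  then interpret R: charted G "euclid_dspace n U" "pullback_bundle p (euclid_dspace n U) P"
    "\<lambda>k b. f k (p b)" "\<lambda>k x. \<gamma> k (snd x)"
    by (rule charted_pullback[OF E])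
  show "locally_trivial_bundle G (euclid_dspace n U) (pullback_bundle p (euclid_dspace n U) P)"
    by (rule R.locally_trivial)
qed

lemma D_numerable: "D_numerable G B P"
proof -
  obtain t where t: "\<And>k. smooth B real_dspace (t k)" "\<And>k x. x \<in> pts B \<Longrightarrow> t k x \<ge> 0"
    "loc_finite B UNIV t" "\<And>x. x \<in> pts B \<Longrightarrow> (\<Sum>k | t k x \<noteq> 0. t k x) = 1"
    "\<And>k. D_supp B (t k) \<subseteq> {x\<in>pts B. f k x > 0}"
    by (rule partition_of_unity_from_sequence[OF base f_smooth f_nonneg f_pos]) (blast+)
  \<comment> \<open>A dummy first component: \<open>Pair b0\<close> embeds \<open>nat\<close> into
    the index type \<open>'b \<times> nat\<close> that D-numerability prescribes.\<close>
  define b0 :: 'b where "b0 = undefined"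
  define I where "I = range (Pair b0 :: nat \<Rightarrow> 'b \<times> nat)"
  have "smooth_partition_of_unity B I (\<lambda>i. t (snd i))"
    unfolding smooth_partition_of_unity_def
  proof (intro conjI ballI)
    fix x assume x: "x \<in> pts B"
    from loc_finiteE[OF t(3) x] obtain N F where N:
      "D_open B N" "x \<in> N" "finite F" "\<And>i y. i \<in> UNIV - F \<Longrightarrow> y \<in> N \<Longrightarrow> t i y = 0" by metis
    have "D_supp B (t k) \<inter> N = {}" if "k \<notin> F" for k
      using N(4) that by (intro D_supp_minimal[OF base N(1)]) auto
    then have "k \<in> F" if "D_supp B (t k) \<inter> N \<noteq> {}" for k using that by blast
    then have "{i\<in>I. D_supp B (t (snd i)) \<inter> N \<noteq> {}} \<subseteq> Pair b0 ` F" unfolding I_def by force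
    then have "finite {i\<in>I. D_supp B (t (snd i)) \<inter> N \<noteq> {}}" using N(3) finite_surj by blast
    then show "\<exists>N. D_open B N \<and> x \<in> N \<and> finite {i\<in>I. D_supp B (t (snd i)) \<inter> N \<noteq> {}}"
      using N by blast
    have "(\<Sum>i | i \<in> I \<and> t (snd i) x \<noteq> 0. t (snd i) x) = (\<Sum>k | t k x \<noteq> 0. t k x)"
      by (rule sum.reindex_cong[of "Pair b0"]) (auto simp: I_def inj_on_def)
    then show "(\<Sum>i | i \<in> I \<and> t (snd i) x \<noteq> 0. t (snd i) x) = 1" using t(4)[OF x] by simp
  qed (use t in auto)
  moreover have "(\<Union>i\<in>I. cdom (snd i)) = pts B" using UN_cdom by (auto simp: I_def)
  ultimately show ?thesis
    unfolding D_numerable_def using principal D_open_cdom trivial_restrict t(5)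
    by (intro conjI exI[of _ I] exI[of _ "\<lambda>i. cdom (snd i)"] exI[of _ "\<lambda>i. t (snd i)"])
       (auto simp: cdom_def)
qed

end

section \<open>From D-numerable bundles to countably many charts\<close>

context Gspace
begin

text \<open>A trivialisation amounts to its group component \<gamma> together with the section
  \<sigma> at the unit. The section is recorded because at this stage neither lifting of plots nor
  transitivity on fibres is known; both are deduced from it.\<close>

lemma trivial_restrict_chart:
  assumes "trivial_bundle G (sub_dspace B A) (restrict_bundle P A)"
  shows "\<exists>\<gamma> \<sigma>. smooth (sub_dspace (tot P) {x. prj P x \<in> A}) (space_of G) \<gamma> \<and>
    (\<forall>x\<in>pts (tot P). \<forall>g\<in>carrier G. prj P x \<in> A \<longrightarrow> \<gamma> (act P x g) = \<gamma> x \<otimes> g) \<and>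
    smooth (sub_dspace B A) (tot P) \<sigma> \<and> (\<forall>b\<in>pts B. b \<in> A \<longrightarrow> prj P (\<sigma> b) = b) \<and>
    (\<forall>x\<in>pts (tot P). prj P x \<in> A \<longrightarrow> x = act P (\<sigma> (prj P x)) (\<gamma> x))"
proof -
  let ?T = "sub_dspace (tot P) {x. prj P x \<in> A}"
  let ?S = "sub_dspace B A"
  have S: "diffeological_space ?S" by (rule diffeological_space_sub[OF base])
  obtain \<phi> where \<phi>: "diffeomorphism ?T (prod_dspace ?S (space_of G)) \<phi>"
    "\<And>x. x \<in> pts ?T \<Longrightarrow> fst (\<phi> x) = prj P x"
    "\<And>x g. x \<in> pts ?T \<Longrightarrow> g \<in> carrier G \<Longrightarrow> \<phi> (act P x g) = (fst (\<phi> x), snd (\<phi> x) \<otimes> g)"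
    using assms unfolding trivial_bundle_def bundle_isomorphic_def
    by (auto simp: restrict_bundle_def product_bundle_def case_prod_unfold)
  then obtain \<psi> where \<psi>: "smooth (prod_dspace ?S (space_of G)) ?T \<psi>" "\<And>x. x \<in> pts ?T \<Longrightarrow> \<psi> (\<phi> x) = x"
      "\<And>y. y \<in> pts ?S \<times> carrier G \<Longrightarrow> \<phi> (\<psi> y) = y"
    by (auto simp: diffeomorphism_def)
  have \<phi>s: "smooth ?T (prod_dspace ?S (space_of G)) \<phi>" using \<phi>(1) by (simp add: diffeomorphism_def)
  have \<psi>p: "\<psi> (b, g) \<in> pts ?T" if "b \<in> pts ?S" "g \<in> carrier G" for b g
    using smooth_pts[OF \<psi>(1), of "(b, g)"] that by simp
  show ?thesis
  proof (intro exI[of _ "\<lambda>x. snd (\<phi> x)"] exI[of _ "\<lambda>b. \<psi> (b, \<one>)"] conjI ballI impI)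
    show "smooth ?T (space_of G) (\<lambda>x. snd (\<phi> x))" by (rule smooth_compose[OF \<phi>s smooth_snd])
    have "smooth ?S ?T (\<lambda>b. \<psi> (b, \<one>))"
      by (intro smooth_compose[OF _ \<psi>(1)] smooth_Pair smooth_id smooth_const S space_G) simp
    then show "smooth ?S (tot P) (\<lambda>b. \<psi> (b, \<one>))"
      by (rule smooth_compose[OF _ smooth_from_sub[OF smooth_id]])
    show "snd (\<phi> (act P x g)) = snd (\<phi> x) \<otimes> g" if "x \<in> pts (tot P)" "prj P x \<in> A" "g \<in> carrier G" for x g
      using that \<phi>(3) by simp
    show "prj P (\<psi> (b, \<one>)) = b" if "b \<in> pts B" "b \<in> A" for b
      using that \<phi>(2)[of "\<psi> (b, \<one>)"] \<psi>p[of b \<one>] \<psi>(3)[of "(b, \<one>)"] by simp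
    fix x assume x: "x \<in> pts (tot P)" "prj P x \<in> A"
    let ?b = "prj P x" and ?g = "snd (\<phi> x)"
    have b: "?b \<in> pts ?S" and g: "?g \<in> carrier G"
      using x prj_pts smooth_pts[OF \<phi>s, of x] by auto
    have \<phi>x: "\<phi> x = (?b, ?g)" using \<phi>(2)[of x] x by (simp add: prod_eq_iff)
    have "\<phi> (act P (\<psi> (?b, \<one>)) ?g) = (?b, ?g)"
      using \<phi>(3)[OF \<psi>p[OF b one_closed] g] \<psi>(3)[of "(?b, \<one>)"] b g by simp
    moreover have "act P (\<psi> (?b, \<one>)) ?g \<in> pts ?T"
      using \<psi>p[OF b one_closed] g act_pts prj_act by auto
    ultimately show "x = act P (\<psi> (?b, \<one>)) ?g"
      using \<psi>(2) \<phi>x x by (metis IntI mem_Collect_eq pts_sub)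
  qed
qed

text \<open>Uncountably many charts are merged into countably many: for a threshold \<open>a\<close>, the set of
  indices \<open>i\<close> with \<open>\<mu>\<^sub>i > a\<close> is locally constant on the open set where no \<open>\<mu>\<^sub>i\<close> equals \<open>a\<close>, so there a
  chart can be chosen as a function of this set alone. The polynomial \<open>(x/a - 1)\<^sup>2\<close> vanishes exactly
  at the threshold and is \<open>1\<close> at \<open>0\<close>, which makes the product locally finite.\<close>

lemma charted_of_D_numerable:
  assumes num: "D_numerable G B P"
  obtains f \<gamma> where "charted G B P f \<gamma>"
proof -
  obtain I :: "('b \<times> nat) set" and A \<mu> where
    *: "(\<forall>i\<in>I. D_open B (A i) \<and> trivial_bundle G (sub_dspace B (A i)) (restrict_bundle P (A i))) \<and>
        (\<Union>i\<in>I. A i) = pts B \<and> smooth_partition_of_unity B I \<mu> \<and> (\<forall>i\<in>I. D_supp B (\<mu> i) \<subseteq> A i)"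
    using num unfolding D_numerable_def by (elim conjE exE) (rule that, intro conjI)
  have A: "\<And>i. i \<in> I \<Longrightarrow> D_open B (A i)"
      "\<And>i. i \<in> I \<Longrightarrow> trivial_bundle G (sub_dspace B (A i)) (restrict_bundle P (A i))"
      "(\<Union>i\<in>I. A i) = pts B"
    and pou: "smooth_partition_of_unity B I \<mu>" and supp: "\<And>i. i \<in> I \<Longrightarrow> D_supp B (\<mu> i) \<subseteq> A i"
    using * by simp_all
  have \<mu>: "\<And>i. i \<in> I \<Longrightarrow> smooth B real_dspace (\<mu> i)" "\<And>i x. i \<in> I \<Longrightarrow> x \<in> pts B \<Longrightarrow> \<mu> i x \<ge> 0"
    "\<And>x. x \<in> pts B \<Longrightarrow> (\<Sum>i | i \<in> I \<and> \<mu> i x \<noteq> 0. \<mu> i x) = 1"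
    using pou by (auto simp: smooth_partition_of_unity_def)
  have lf: "loc_finite B I \<mu>"
    unfolding loc_finite_def
  proof
    fix x assume "x \<in> pts B"
    then have "\<exists>N. D_open B N \<and> x \<in> N \<and> finite {i\<in>I. D_supp B (\<mu> i) \<inter> N \<noteq> {}}"
      using pou by (simp add: smooth_partition_of_unity_def)
    then obtain N where N: "D_open B N" "x \<in> N" "finite {i\<in>I. D_supp B (\<mu> i) \<inter> N \<noteq> {}}"
      by (elim exE conjE) (rule that)
    have "\<mu> i y = 0" if "i \<in> I" "D_supp B (\<mu> i) \<inter> N = {}" "y \<in> N" for i y
    proof -
      have y: "y \<in> pts B" using D_open_subset[OF N(1)] that by blast
      then have "\<not> \<mu> i y > 0" using in_D_supp[OF base y, of "\<mu> i"] that by blast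
      then show ?thesis using \<mu>(2)[OF that(1) y] by simp
    qed
    then show "\<exists>N F. D_open B N \<and> x \<in> N \<and> finite F \<and> F \<subseteq> I \<and> (\<forall>i\<in>I - F. \<forall>y\<in>N. \<mu> i y = 0)"
      using N by (intro exI[of _ N] exI[of _ "{i\<in>I. D_supp B (\<mu> i) \<inter> N \<noteq> {}}"]) auto
  qed
  have \<mu>A: "x \<in> A i" if "i \<in> I" "x \<in> pts B" "\<mu> i x > 0" for i x
    using in_D_supp[OF base that(2), of "\<mu> i"] that supp by blast
  have "\<forall>i\<in>I. \<exists>\<gamma> \<sigma>. smooth (sub_dspace (tot P) {x. prj P x \<in> A i}) (space_of G) \<gamma> \<and>
    (\<forall>x\<in>pts (tot P). \<forall>g\<in>carrier G. prj P x \<in> A i \<longrightarrow> \<gamma> (act P x g) = \<gamma> x \<otimes> g) \<and>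
    smooth (sub_dspace B (A i)) (tot P) \<sigma> \<and> (\<forall>b\<in>pts B. b \<in> A i \<longrightarrow> prj P (\<sigma> b) = b) \<and>
    (\<forall>x\<in>pts (tot P). prj P x \<in> A i \<longrightarrow> x = act P (\<sigma> (prj P x)) (\<gamma> x))"
    by (intro ballI trivial_restrict_chart A(2))
  from bchoice[OF this] obtain \<Gamma> where "\<forall>i\<in>I. \<exists>\<sigma>. smooth (sub_dspace (tot P) {x. prj P x \<in> A i}) (space_of G) (\<Gamma> i) \<and>
    (\<forall>x\<in>pts (tot P). \<forall>g\<in>carrier G. prj P x \<in> A i \<longrightarrow> \<Gamma> i (act P x g) = \<Gamma> i x \<otimes> g) \<and>
    smooth (sub_dspace B (A i)) (tot P) \<sigma> \<and> (\<forall>b\<in>pts B. b \<in> A i \<longrightarrow> prj P (\<sigma> b) = b) \<and>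
    (\<forall>x\<in>pts (tot P). prj P x \<in> A i \<longrightarrow> x = act P (\<sigma> (prj P x)) (\<Gamma> i x))"
    by (elim exE) (rule that)
  from bchoice[OF this] obtain \<Sigma> where \<Gamma>\<Sigma>: "\<forall>i\<in>I. smooth (sub_dspace (tot P) {x. prj P x \<in> A i}) (space_of G) (\<Gamma> i) \<and>
    (\<forall>x\<in>pts (tot P). \<forall>g\<in>carrier G. prj P x \<in> A i \<longrightarrow> \<Gamma> i (act P x g) = \<Gamma> i x \<otimes> g) \<and>
    smooth (sub_dspace B (A i)) (tot P) (\<Sigma> i) \<and> (\<forall>b\<in>pts B. b \<in> A i \<longrightarrow> prj P (\<Sigma> i b) = b) \<and>
    (\<forall>x\<in>pts (tot P). prj P x \<in> A i \<longrightarrow> x = act P (\<Sigma> i (prj P x)) (\<Gamma> i x))"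
    by (elim exE) (rule that)
  have \<Gamma>: "\<And>i. i \<in> I \<Longrightarrow> smooth (sub_dspace (tot P) {x. prj P x \<in> A i}) (space_of G) (\<Gamma> i)"
      "\<And>i x g. i \<in> I \<Longrightarrow> x \<in> pts (tot P) \<Longrightarrow> prj P x \<in> A i \<Longrightarrow> g \<in> carrier G \<Longrightarrow> \<Gamma> i (act P x g) = \<Gamma> i x \<otimes> g"
    and \<Sigma>: "\<And>i. i \<in> I \<Longrightarrow> smooth (sub_dspace B (A i)) (tot P) (\<Sigma> i)"
      "\<And>i b. i \<in> I \<Longrightarrow> b \<in> pts B \<Longrightarrow> b \<in> A i \<Longrightarrow> prj P (\<Sigma> i b) = b"
      "\<And>i x. i \<in> I \<Longrightarrow> x \<in> pts (tot P) \<Longrightarrow> prj P x \<in> A i \<Longrightarrow> x = act P (\<Sigma> i (prj P x)) (\<Gamma> i x)"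
    using \<Gamma>\<Sigma> by simp_all
  have \<Gamma>c: "\<Gamma> i x \<in> carrier G" if "i \<in> I" "x \<in> pts (tot P)" "prj P x \<in> A i" for i x
    using smooth_pts[OF \<Gamma>(1)[OF that(1)], of x] that by simp
  have \<Sigma>p: "\<Sigma> i b \<in> pts (tot P)" if "i \<in> I" "b \<in> pts B" "b \<in> A i" for i b
    using smooth_pts[OF \<Sigma>(1)[OF that(1)], of b] that by simp
  \<comment> \<open>Plots lift through the local sections, and two points of a fibre differ by the
    quotient of their chart values.\<close>
  interpret Gtorsor G B P
  proof
    show "subduction (tot P) B (prj P)"
      unfolding subduction_def
    proof (intro conjI allI impI ballI prj_smooth)
      fix n U p u assume p: "plot B n U p" and u: "u \<in> U"
      have "p u \<in> pts B" using plot_pts[OF base p u] .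
      then obtain i where i: "i \<in> I" "p u \<in> A i" using A(3) by blast
      let ?V = "{u\<in>U. p u \<in> A i}"
      have V: "eopen n ?V" using D_open_plot[OF A(1)[OF i(1)] p] .
      have pV: "plot B n ?V p" using plot_restrict[OF base p V] by blast
      then have "plot (sub_dspace B (A i)) n ?V p" by (auto simp: sub_dspace_def)
      then have "plot (tot P) n ?V (\<lambda>v. \<Sigma> i (p v))" using smoothD[OF \<Sigma>(1)[OF i(1)]] by blast
      moreover have "prj P (\<Sigma> i (p v)) = p v" if "v \<in> ?V" for v
        using that \<Sigma>(2)[OF i(1)] plot_pts[OF base pV] by blast
      ultimately show "\<exists>V q. eopen n V \<and> u \<in> V \<and> V \<subseteq> U \<and> plot (tot P) n V q \<and> (\<forall>v\<in>V. prj P (q v) = p v)"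
        using V u i(2) by (intro exI[of _ ?V] exI[of _ "\<lambda>v. \<Sigma> i (p v)"]) auto
    qed
    fix x y assume xy: "x \<in> pts (tot P)" "y \<in> pts (tot P)" "prj P x = prj P y"
    obtain i where i: "i \<in> I" "prj P x \<in> A i" using A(3) prj_pts[OF xy(1)] by blast
    let ?s = "\<Sigma> i (prj P x)"
    have s: "?s \<in> pts (tot P)" using \<Sigma>p[OF i(1) prj_pts[OF xy(1)] i(2)] .
    have c: "\<Gamma> i x \<in> carrier G" "\<Gamma> i y \<in> carrier G" using \<Gamma>c i xy by auto
    have "act P x (inv (\<Gamma> i x) \<otimes> \<Gamma> i y) = act P ?s (\<Gamma> i x \<otimes> (inv (\<Gamma> i x) \<otimes> \<Gamma> i y))"
      using \<Sigma>(3)[OF i(1) xy(1) i(2)] act_act[OF s c(1), of "inv (\<Gamma> i x) \<otimes> \<Gamma> i y"] c by simp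
    also have "\<Gamma> i x \<otimes> (inv (\<Gamma> i x) \<otimes> \<Gamma> i y) = \<Gamma> i y" using c by (simp add: m_assoc[symmetric])
    also have "act P ?s (\<Gamma> i y) = y" using \<Sigma>(3)[OF i(1) xy(2)] i(2) xy(3) by simp
    finally show "\<exists>g\<in>carrier G. y = act P x g"
      using c by (intro bexI[of _ "inv (\<Gamma> i x) \<otimes> \<Gamma> i y"]) auto
  qed
  \<comment> \<open>Thresholds tending to 0 and pairwise distinct: at a given point only finitely
    many of them are values of some \<open>\<mu> i\<close>, so arbitrarily small ones are
    avoided.\<close>
  define a :: "nat \<Rightarrow> real" where "a k = inverse (real (Suc k))" for k
  have a0: "a k > 0" for k by (simp add: a_def)
  define \<kappa> where "\<kappa> k i b = (\<mu> i b / a k - 1) * (\<mu> i b / a k - 1)" for k i b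
  define \<rho> where "\<rho> k i b = flat (\<mu> i b - a k)" for k i b
  \<comment> \<open>The product vanishes where some \<open>\<mu> i\<close> equals the threshold, the
    sum where none exceeds it; both are nonnegative.\<close>
  define f where "f k b = (\<Prod>i | i \<in> I \<and> \<kappa> k i b \<noteq> 1. \<kappa> k i b) * (\<Sum>i | i \<in> I \<and> \<rho> k i b \<noteq> 0. \<rho> k i b)" for k b
  have \<kappa>1: "\<kappa> k i b = 1" if "\<mu> i b = 0" for k i b using that by (simp add: \<kappa>_def)
  have \<rho>0: "\<rho> k i b = 0" if "\<mu> i b = 0" for k i b using that a0[of k] by (simp add: \<rho>_def flat_zero)
  have \<kappa>0: "\<kappa> k i b \<ge> 0" for k i b unfolding \<kappa>_def by (rule zero_le_square)
  have fs: "smooth B real_dspace (f k)" for k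
    unfolding f_def
  proof (rule smooth_real_mult[OF base smooth_real_loc_finite_prod[OF base] smooth_real_loc_finite_sum[OF base]])
    show "loc_finite B I (\<lambda>i x. \<kappa> k i x - 1)" by (rule loc_finite_map[OF lf]) (simp add: \<kappa>1)
    show "loc_finite B I (\<rho> k)" by (rule loc_finite_map[OF lf \<rho>0])
    show "smooth B real_dspace (\<kappa> k i)" if "i \<in> I" for i
      unfolding \<kappa>_def using a0[of k] by (intro smooth_real_intros base \<mu>(1)[OF that]) auto
    show "smooth B real_dspace (\<rho> k i)" if "i \<in> I" for i
      unfolding \<rho>_def by (intro smooth_real_intros base \<mu>(1)[OF that])
  qed
  have fin: "finite {i\<in>I. \<mu> i b \<noteq> 0}" if "b \<in> pts B" for b
    using loc_finite_finite[OF lf that] .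
  have fpos: "f k b > 0 \<longleftrightarrow> (\<forall>i\<in>I. \<mu> i b \<noteq> a k) \<and> (\<exists>i\<in>I. \<mu> i b > a k)" if b: "b \<in> pts B" for k b
  proof -
    have key: "0 \<le> p \<Longrightarrow> p = 0 \<longleftrightarrow> C \<Longrightarrow> 0 \<le> s \<Longrightarrow> s = 0 \<longleftrightarrow> \<not> D \<Longrightarrow> p * s > 0 \<longleftrightarrow> \<not> C \<and> D"
      for p s :: real and C D by (auto simp: zero_less_mult_iff order_less_le)
    have f1: "finite {i. i \<in> I \<and> \<kappa> k i b \<noteq> 1}" and f2: "finite {i. i \<in> I \<and> \<rho> k i b \<noteq> 0}"
      using \<kappa>1 \<rho>0 by (auto intro!: finite_subset[OF _ fin[OF b]])
    have k0: "\<kappa> k i b = 0 \<longleftrightarrow> \<mu> i b = a k" for i using a0[of k] by (auto simp: \<kappa>_def)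
    have "(\<Prod>i | i \<in> I \<and> \<kappa> k i b \<noteq> 1. \<kappa> k i b) \<ge> 0" by (intro prod_nonneg) (auto simp: \<kappa>0)
    moreover have "(\<Prod>i | i \<in> I \<and> \<kappa> k i b \<noteq> 1. \<kappa> k i b) = 0 \<longleftrightarrow> (\<exists>i\<in>I. \<mu> i b = a k)"
    proof -
      have "(\<Prod>i | i \<in> I \<and> \<kappa> k i b \<noteq> 1. \<kappa> k i b) = 0 \<longleftrightarrow> (\<exists>i\<in>I. \<kappa> k i b = 0)"
        unfolding prod_zero_iff[OF f1] by (metis (mono_tags, lifting) mem_Collect_eq zero_neq_one)
      then show ?thesis by (simp add: k0)
    qed
    moreover have "(\<Sum>i | i \<in> I \<and> \<rho> k i b \<noteq> 0. \<rho> k i b) \<ge> 0"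
      by (intro sum_nonneg) (auto simp: \<rho>_def flat_nonneg)
    moreover have "(\<Sum>i | i \<in> I \<and> \<rho> k i b \<noteq> 0. \<rho> k i b) = 0 \<longleftrightarrow> \<not> (\<exists>i\<in>I. \<mu> i b > a k)"
    proof -
      have "(\<Sum>i | i \<in> I \<and> \<rho> k i b \<noteq> 0. \<rho> k i b) = 0 \<longleftrightarrow> (\<forall>i\<in>{i. i \<in> I \<and> \<rho> k i b \<noteq> 0}. \<rho> k i b = 0)"
        using f2 by (intro sum_nonneg_eq_0_iff) (auto simp: \<rho>_def flat_nonneg)
      also have "\<dots> \<longleftrightarrow> (\<forall>i\<in>I. \<rho> k i b = 0)" by auto
      also have "\<dots> \<longleftrightarrow> \<not> (\<exists>i\<in>I. \<mu> i b > a k)"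
        using flat_pos[of "\<mu> _ b - a k"] flat_zero[of "\<mu> _ b - a k"] by (force simp: \<rho>_def)
      finally show ?thesis .
    qed
    ultimately have "f k b > 0 \<longleftrightarrow> \<not> (\<exists>i\<in>I. \<mu> i b = a k) \<and> (\<exists>i\<in>I. \<mu> i b > a k)"
      unfolding f_def by (rule key)
    then show ?thesis by blast
  qed
  have fnn: "f k b \<ge> 0" for k b
    unfolding f_def by (intro mult_nonneg_nonneg prod_nonneg sum_nonneg) (auto simp: \<kappa>0 \<rho>_def flat_nonneg)
  have fex: "\<exists>k. f k b > 0" if b: "b \<in> pts B" for b
  proof -
    have "\<exists>i\<in>I. \<mu> i b > 0"
    proof (rule ccontr)
      assume "\<not> ?thesis"
      then have "{i. i \<in> I \<and> \<mu> i b \<noteq> 0} = {}" using \<mu>(2)[OF _ b] by (auto simp: not_less order_antisym)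
      then have "(\<Sum>i | i \<in> I \<and> \<mu> i b \<noteq> 0. \<mu> i b) = 0" by (simp only: sum.empty)
      then show False using \<mu>(3)[OF b] by simp
    qed
    then obtain i where i: "i \<in> I" "\<mu> i b > 0" by blast
    obtain m where m: "inverse (real (Suc m)) < \<mu> i b" using reals_Archimedean[OF i(2)] by blast
    have "inj a" by (auto simp: inj_def a_def)
    have "finite (a -` ((\<lambda>i. \<mu> i b) ` {i\<in>I. \<mu> i b \<noteq> 0}))"
      using fin[OF b] \<open>inj a\<close> by (intro finite_vimageI) auto
    then have "infinite ({m..} - a -` ((\<lambda>i. \<mu> i b) ` {i\<in>I. \<mu> i b \<noteq> 0}))"
      by (simp add: Diff_infinite_finite infinite_Ici)
    then obtain k where "k \<in> {m..} - a -` ((\<lambda>i. \<mu> i b) ` {i\<in>I. \<mu> i b \<noteq> 0})"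
      using infinite_imp_nonempty by blast
    then have k: "k \<ge> m" "a k \<notin> (\<lambda>i. \<mu> i b) ` {i\<in>I. \<mu> i b \<noteq> 0}" by auto
    have "\<mu> j b \<noteq> a k" if "j \<in> I" for j using k(2) a0[of k] that by force
    moreover have "a k \<le> a m" using k(1) by (simp add: a_def)
    then have "\<mu> i b > a k" using m unfolding a_def by linarith
    ultimately have "f k b > 0" using fpos[OF b] i(1) by blast
    then show ?thesis by blast
  qed
  define ch where "ch S = (SOME i. i \<in> S)" for S :: "('b \<times> nat) set"
  define S where "S k b = {i\<in>I. \<mu> i b > a k}" for k b
  define \<gamma> where "\<gamma> k x = \<Gamma> (ch (S k (prj P x))) x" for k x
  have ch: "ch (S k b) \<in> I \<and> \<mu> (ch (S k b)) b > a k" if "b \<in> pts B" "f k b > 0" for k b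
  proof -
    have "\<exists>i. i \<in> S k b" using fpos that by (auto simp: S_def)
    then have "ch (S k b) \<in> S k b" unfolding ch_def by (rule someI_ex)
    then show ?thesis by (simp add: S_def)
  qed
  have chA: "b \<in> A (ch (S k b))" if "b \<in> pts B" "f k b > 0" for k b
    using ch[OF that] a0[of k] by (intro \<mu>A that) auto
  have "charted G B P f \<gamma>"
  proof
    fix k
    show "smooth B real_dspace (f k)" by (rule fs)
    show "0 \<le> f k b" for b by (rule fnn)
    show "\<exists>k. 0 < f k b" if "b \<in> pts B" for b using fex[OF that] .
    show "\<gamma> k (act P x g) = \<gamma> k x \<otimes> g"
      if "x \<in> pts (tot P)" "0 < f k (prj P x)" "g \<in> carrier G" for x g
      using that ch[OF prj_pts[OF that(1)] that(2)] chA[OF prj_pts[OF that(1)] that(2)]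
      by (auto simp: \<gamma>_def prj_act intro!: \<Gamma>(2))
    let ?Z = "sub_dspace (tot P) {x. 0 < f k (prj P x)}"
    have Z: "diffeological_space ?Z" by (rule diffeological_space_sub[OF total])
    show "smooth ?Z (space_of G) (\<gamma> k)"
    proof (rule smooth_locally[OF Z space_G])
      fix x assume "x \<in> pts ?Z"
      then have x: "x \<in> pts (tot P)" "f k (prj P x) > 0" by auto
      let ?b = "prj P x"
      have b: "?b \<in> pts B" using prj_pts[OF x(1)] .
      define i where "i = ch (S k ?b)"
      have i: "i \<in> I" "\<mu> i ?b > a k" using ch[OF b x(2)] by (auto simp: i_def)
      from loc_finiteE[OF lf b] obtain N F where N: "D_open B N" "?b \<in> N" "finite F" "F \<subseteq> I"
        "\<And>i y. i \<in> I - F \<Longrightarrow> y \<in> N \<Longrightarrow> \<mu> i y = 0" by metis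
      \<comment> \<open>Positivity of \<open>f k\<close> excludes equality with the threshold, so
        each of the finitely many comparisons for \<open>j \<in> F\<close> is strict and persists
        nearby. The other indices have value 0, below the threshold.\<close>
      define Nb where "Nb j = (if \<mu> j ?b > a k then {y\<in>pts B. \<mu> j y > a k} else {y\<in>pts B. \<mu> j y < a k})" for j
      have Nb: "D_open B (Nb j)" if "j \<in> F" for j
      proof -
        have j: "j \<in> I" using that N(4) by blast
        show ?thesis by (simp add: Nb_def D_open_less[OF base \<mu>(1)[OF j]])
      qed
      have bNb: "?b \<in> Nb j" if "j \<in> F" for j
        using fpos[OF b] x(2) that N(4) b by (auto simp: Nb_def not_less order_less_le)
      define M where "M = N \<inter> {y\<in>pts B. \<forall>j\<in>F. y \<in> Nb j}"
      have M: "D_open B M" "?b \<in> M"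
        unfolding M_def using N b bNb by (auto intro!: D_open_Int D_open_finite_INT[OF N(3) base] Nb)
      have SM: "S k y = S k ?b" if "y \<in> M" for y
      proof -
        have "(\<mu> j y > a k) = (\<mu> j ?b > a k)" if "j \<in> I" for j
        proof (cases "j \<in> F")
          case True
          then have "y \<in> Nb j" using \<open>y \<in> M\<close> by (auto simp: M_def)
          then show ?thesis by (auto simp: Nb_def split: if_splits)
        next
          case False
          then have "\<mu> j y = 0" "\<mu> j ?b = 0" using N \<open>y \<in> M\<close> that by (auto simp: M_def)
          then show ?thesis by simp
        qed
        then show ?thesis by (auto simp: S_def)
      qed
      have MA: "y \<in> A i" if "y \<in> M" for y
      proof -
        have y: "y \<in> pts B" using that D_open_subset[OF M(1)] by blast
        have "i \<in> S k y" using SM[OF that] i by (simp add: S_def)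
        then have "\<mu> i y > 0" using a0[of k] by (auto simp: S_def)
        then show ?thesis using \<mu>A i(1) y by blast
      qed
      let ?N = "{y\<in>pts ?Z. prj P y \<in> M}"
      have "smooth (sub_dspace ?Z ?N) (space_of G) (\<Gamma> i)"
      proof (rule smoothI)
        fix n U p assume "plot (sub_dspace ?Z ?N) n U p"
        then have "plot (sub_dspace (tot P) {x. prj P x \<in> A i}) n U p"
          using MA by (auto simp: sub_dspace_def)
        then show "plot (space_of G) n U (\<lambda>u. \<Gamma> i (p u))" using smoothD[OF \<Gamma>(1)[OF i(1)]] by blast
      qed (use MA \<Gamma>c[OF i(1)] in auto)
      moreover have "D_open ?Z ?N"
        by (rule D_open_preimage[OF Z smooth_from_sub[OF prj_smooth] M(1)])
      moreover have "\<forall>y\<in>?N. \<gamma> k y = \<Gamma> i y" using SM by (auto simp: \<gamma>_def i_def)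
      ultimately show "\<exists>N g. D_open ?Z N \<and> x \<in> N \<and> smooth (sub_dspace ?Z N) (space_of G) g \<and> (\<forall>y\<in>N. \<gamma> k y = g y)"
        using x M(2) by (intro exI[of _ ?N] exI[of _ "\<Gamma> i"]) auto
    qed
  qed
  then show ?thesis by (rule that)
qed

end

section \<open>The bundle EG over BG\<close>

text \<open>Any finite set containing the support may carry the sum. This is convenient after
  coordinates have been moved, when the exact support is awkward to describe.\<close>

lemma Delta_iff:
  "t \<in> pts Delta_omega \<longleftrightarrow> (\<forall>i. t i \<ge> 0) \<and> (\<exists>S. finite S \<and> (\<forall>i. i \<notin> S \<longrightarrow> t i = 0) \<and> (\<Sum>i\<in>S. t i) = 1)"
proof
  assume "t \<in> pts Delta_omega"
  then show "(\<forall>i. t i \<ge> 0) \<and> (\<exists>S. finite S \<and> (\<forall>i. i \<notin> S \<longrightarrow> t i = 0) \<and> (\<Sum>i\<in>S. t i) = 1)"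
    by (auto simp: Delta_omega_def intro!: exI[of _ "{i. t i \<noteq> 0}"])
next
  assume "(\<forall>i. t i \<ge> 0) \<and> (\<exists>S. finite S \<and> (\<forall>i. i \<notin> S \<longrightarrow> t i = 0) \<and> (\<Sum>i\<in>S. t i) = 1)"
  then obtain S where S: "\<forall>i. t i \<ge> 0" "finite S" "\<And>i. i \<notin> S \<Longrightarrow> t i = 0" "(\<Sum>i\<in>S. t i) = 1" by blast
  have sub: "{i. t i \<noteq> 0} \<subseteq> S" using S(3) by blast
  have "(\<Sum>i | t i \<noteq> 0. t i) = (\<Sum>i\<in>S. t i)"
    using S(2) sub by (intro sum.mono_neutral_left) auto
  then show "t \<in> pts Delta_omega"
    using S finite_subset[OF sub] by (simp add: Delta_omega_def)
qed

lemma Delta_plotI: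
  assumes U: "eopen n U" and t: "\<And>u. u \<in> U \<Longrightarrow> t u \<in> pts Delta_omega"
    and s: "\<And>i. smooth_fun_on n U (\<lambda>u. t u i)"
    and loc: "\<And>u. u \<in> U \<Longrightarrow> \<exists>V S. eopen n V \<and> u \<in> V \<and> finite S \<and> (\<forall>v\<in>V \<inter> U. \<forall>i. i \<notin> S \<longrightarrow> t v i = 0)"
  shows "plot Delta_omega n U t"
proof -
  have "\<exists>V N. eopen n V \<and> u \<in> V \<and> V \<subseteq> U \<and> (\<forall>i>N. \<forall>v\<in>V. t v i = 0)" if u: "u \<in> U" for u
  proof -
    obtain V S where V: "eopen n V" "u \<in> V" "finite S" "\<forall>v\<in>V \<inter> U. \<forall>i. i \<notin> S \<longrightarrow> t v i = 0"
      using loc[OF u] by blast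
    obtain N where N: "\<And>i. i \<in> S \<Longrightarrow> i \<le> N" using V(3) by (meson finite_nat_set_iff_bounded_le)
    show ?thesis
      using V u N U by (intro exI[of _ "V \<inter> U"] exI[of _ N]) (auto simp: not_le[symmetric])
  qed
  then show ?thesis using U t s by (auto simp: Delta_omega_def)
qed

lemma Delta_plot_smooth: "plot Delta_omega n U t \<Longrightarrow> smooth_fun_on n U (\<lambda>u. t u i)"
  and Delta_plot_open: "plot Delta_omega n U t \<Longrightarrow> eopen n U"
  and Delta_plot_pts: "plot Delta_omega n U t \<Longrightarrow> u \<in> U \<Longrightarrow> t u \<in> pts Delta_omega"
  by (auto simp: Delta_omega_def)

lemma Delta_plotE:
  assumes "plot Delta_omega n U t" "u \<in> U"
  obtains V N where "eopen n V" "u \<in> V" "V \<subseteq> U" "\<And>i v. i > N \<Longrightarrow> v \<in> V \<Longrightarrow> t v i = 0"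
proof -
  have "\<exists>V N. eopen n V \<and> u \<in> V \<and> V \<subseteq> U \<and> (\<forall>i>N. \<forall>v\<in>V. t v i = 0)"
    using assms by (simp add: Delta_omega_def)
  then show ?thesis using that by (elim exE conjE) blast
qed

lemma diffeological_space_Delta: "diffeological_space Delta_omega"
proof
  fix n U p assume "plot Delta_omega n U p"
  then show "eopen n U" "p \<in> U \<rightarrow> pts Delta_omega" by (auto simp: Delta_omega_def)
next
  fix n U and p q :: "(nat \<Rightarrow> real) \<Rightarrow> nat \<Rightarrow> real"
  assume p: "plot Delta_omega n U p" and q: "\<And>u. u \<in> U \<Longrightarrow> q u = p u"
  show "plot Delta_omega n U q"
  proof (rule Delta_plotI)
    show "eopen n U" using Delta_plot_open[OF p] .
    show "smooth_fun_on n U (\<lambda>u. q u i)" for i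
      by (rule smooth_fun_on_cong[OF Delta_plot_open[OF p] _ Delta_plot_smooth[OF p]]) (simp add: q)
    show "\<exists>V S. eopen n V \<and> u \<in> V \<and> finite S \<and> (\<forall>v\<in>V \<inter> U. \<forall>i. i \<notin> S \<longrightarrow> q v i = 0)" if u: "u \<in> U" for u
    proof -
      obtain V N where "eopen n V" "u \<in> V" "V \<subseteq> U" "\<And>i v. i > N \<Longrightarrow> v \<in> V \<Longrightarrow> p v i = 0"
        using Delta_plotE[OF p u] by metis
      then show ?thesis using q by (intro exI[of _ V] exI[of _ "{..N}"]) auto
    qed
  qed (use q Delta_plot_pts[OF p] in simp)
next
  fix n U and x :: "nat \<Rightarrow> real"
  assume U: "eopen n U" and x: "x \<in> pts Delta_omega"
  then obtain S where "finite S" "\<forall>i. i \<notin> S \<longrightarrow> x i = 0" by (auto simp: Delta_iff)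
  then show "plot Delta_omega n U (\<lambda>u. x)"
    using U x by (intro Delta_plotI smooth_fun_on_const) auto
next
  fix n U m V f and p :: "(nat \<Rightarrow> real) \<Rightarrow> nat \<Rightarrow> real"
  assume p: "plot Delta_omega n U p" and f: "euclid_smooth m V n U f"
  have fU: "f \<in> V \<rightarrow> U" and V: "eopen m V" using f by (auto simp: euclid_smooth_def)
  show "plot Delta_omega m V (p \<circ> f)"
  proof (rule Delta_plotI[OF V])
    show "smooth_fun_on m V (\<lambda>u. (p \<circ> f) u i)" for i
      using smooth_fun_on_compose[OF f Delta_plot_smooth[OF p, of i]] by simp
    fix v assume v: "v \<in> V"
    then show "(p \<circ> f) v \<in> pts Delta_omega" using fU Delta_plot_pts[OF p] by auto
    obtain W N where W: "eopen n W" "f v \<in> W" "W \<subseteq> U" "\<And>i v. i > N \<Longrightarrow> v \<in> W \<Longrightarrow> p v i = 0"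
      using Delta_plotE[OF p, of "f v"] v fU by (metis PiE)
    have "eopen m {v\<in>V. f v \<in> W}" using euclid_smooth_preimage[OF f W(1)] .
    then show "\<exists>W S. eopen m W \<and> v \<in> W \<and> finite S \<and> (\<forall>w\<in>W \<inter> V. \<forall>i. i \<notin> S \<longrightarrow> (p \<circ> f) w i = 0)"
      using v W by (intro exI[of _ "{v\<in>V. f v \<in> W}"] exI[of _ "{..N}"]) auto
  qed
next
  fix n U and p :: "(nat \<Rightarrow> real) \<Rightarrow> nat \<Rightarrow> real"
  assume U: "eopen n U" and *: "\<And>u. u \<in> U \<Longrightarrow> \<exists>V. eopen n V \<and> u \<in> V \<and> V \<subseteq> U \<and> plot Delta_omega n V p"
  show "plot Delta_omega n U p"
  proof (rule Delta_plotI[OF U])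
    show "smooth_fun_on n U (\<lambda>u. p u i)" for i
    proof (rule smooth_fun_on_local[OF U])
      fix u assume "u \<in> U"
      from *[OF this] show "\<exists>V. eopen n V \<and> u \<in> V \<and> V \<subseteq> U \<and> smooth_fun_on n V (\<lambda>u. p u i)"
        using Delta_plot_smooth by blast
    qed
    fix u assume "u \<in> U"
    from *[OF this] obtain V where V: "u \<in> V" "plot Delta_omega n V p" by blast
    show "p u \<in> pts Delta_omega" using Delta_plot_pts[OF V(2,1)] .
    obtain W N where "eopen n W" "u \<in> W" "W \<subseteq> V" "\<And>i v. i > N \<Longrightarrow> v \<in> W \<Longrightarrow> p v i = 0"
      using Delta_plotE[OF V(2,1)] by metis
    then show "\<exists>W S. eopen n W \<and> u \<in> W \<and> finite S \<and> (\<forall>w\<in>W \<inter> U. \<forall>i. i \<notin> S \<longrightarrow> p w i = 0)"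
      by (intro exI[of _ W] exI[of _ "{..N}"]) auto
  qed
qed

lemma pts_pre_EG: "pts (pre_EG G) = pts Delta_omega \<times> {g. \<forall>i. g i \<in> carrier G}"
  by (simp add: pre_EG_def seq_dspace_def)

lemma plot_pre_EG:
  "plot (pre_EG G) n U p \<longleftrightarrow> plot Delta_omega n U (\<lambda>u. fst (p u)) \<and> (\<forall>i. plot (space_of G) n U (\<lambda>u. snd (p u) i))"
  by (simp add: pre_EG_def prod_dspace_def seq_dspace_def comp_def)

section \<open>Points and plots of EG\<close>

context dgrp
begin

lemma diffeological_space_pre_EG: "diffeological_space (pre_EG G)"
  unfolding pre_EG_def by (intro diffeological_space_prod diffeological_space_Delta diffeological_space_seq space_G)

lemma diffeological_space_EG: "diffeological_space (EG G)"
  unfolding EG_def by (rule diffeological_space_quot[OF diffeological_space_pre_EG])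

lemma diffeological_space_BG: "diffeological_space (BG G)"
  unfolding BG_def by (rule diffeological_space_quot[OF diffeological_space_EG])

definition pt :: "(nat \<Rightarrow> real) \<Rightarrow> (nat \<Rightarrow> 'g) \<Rightarrow> ((nat \<Rightarrow> real) \<times> (nat \<Rightarrow> 'g)) set" where
  "pt t g = EG_rel G `` {(t, g)}"

text \<open>Coordinates of a chosen representative. On points of \<open>EG\<close> the weights do
  not depend on the choice; the group elements of \<open>el\<close> are independent of it only where
  the weight is nonzero.\<close>

definition wt :: "((nat \<Rightarrow> real) \<times> (nat \<Rightarrow> 'g)) set \<Rightarrow> nat \<Rightarrow> real" where
  "wt x = fst (SOME y. y \<in> x)"

definition el :: "((nat \<Rightarrow> real) \<times> (nat \<Rightarrow> 'g)) set \<Rightarrow> nat \<Rightarrow> 'g" where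
  "el x = snd (SOME y. y \<in> x)"

lemma equiv_EG_rel: "equiv (pts (pre_EG G)) (EG_rel G)"
  by (rule equivI) (auto simp: EG_rel_def refl_on_def sym_def trans_def)

lemma pt_eq:
  assumes "t \<in> pts Delta_omega" "\<And>i. g i \<in> carrier G" "t' \<in> pts Delta_omega" "\<And>i. g' i \<in> carrier G"
  shows "pt t g = pt t' g' \<longleftrightarrow> t = t' \<and> (\<forall>i. t i \<noteq> 0 \<longrightarrow> g i = g' i)"
proof -
  have "pt t g = pt t' g' \<longleftrightarrow> ((t, g), (t', g')) \<in> EG_rel G"
    unfolding pt_def using assms by (intro eq_equiv_class_iff[OF equiv_EG_rel]) (auto simp: pts_pre_EG)
  also have "\<dots> \<longleftrightarrow> t = t' \<and> (\<forall>i. t i \<noteq> 0 \<longrightarrow> g i = g' i)"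
    using assms by (auto simp: EG_rel_def pts_pre_EG)
  finally show ?thesis .
qed

lemma pt_cong:
  assumes "t \<in> pts Delta_omega" "\<And>i. g i \<in> carrier G" "\<And>i. g' i \<in> carrier G" "\<And>i. t i = t' i"
    "\<And>i. t i \<noteq> 0 \<Longrightarrow> g i = g' i"
  shows "pt t g = pt t' g'"
proof -
  have "t = t'" using assms(4) by auto
  then show ?thesis using assms pt_eq[of t g t' g'] by auto
qed

lemma pt_pts: "t \<in> pts Delta_omega \<Longrightarrow> (\<And>i. g i \<in> carrier G) \<Longrightarrow> pt t g \<in> pts (EG G)"
  by (auto simp: pt_def EG_def quot_dspace_def pts_pre_EG intro: quotientI)

lemma pt_rep:
  assumes "x \<in> pts (EG G)"
  shows "wt x \<in> pts Delta_omega" "el x i \<in> carrier G" "x = pt (wt x) (el x)"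
proof -
  obtain y where y: "y \<in> pts (pre_EG G)" "x = EG_rel G `` {y}"
    using assms by (auto simp: EG_def quot_dspace_def elim: quotientE)
  then have "y \<in> x" using equiv_class_self[OF equiv_EG_rel] by blast
  then have s: "(SOME y. y \<in> x) \<in> x" by (rule someI)
  then have "(SOME y. y \<in> x) \<in> pts (pre_EG G)" using y by (auto simp: EG_rel_def)
  then show "wt x \<in> pts Delta_omega" "el x i \<in> carrier G"
    by (auto simp: wt_def el_def pts_pre_EG)
  have "(y, SOME y. y \<in> x) \<in> EG_rel G" using s y by blast
  then have "x = EG_rel G `` {SOME y. y \<in> x}"
    using y equiv_class_eq[OF equiv_EG_rel] by blast
  then show "x = pt (wt x) (el x)" by (simp add: pt_def wt_def el_def)
qed

lemma wt_pt: "t \<in> pts Delta_omega \<Longrightarrow> (\<And>i. g i \<in> carrier G) \<Longrightarrow> wt (pt t g) = t"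
  and el_pt: "t \<in> pts Delta_omega \<Longrightarrow> (\<And>i. g i \<in> carrier G) \<Longrightarrow> t i \<noteq> 0 \<Longrightarrow> el (pt t g) i = g i"
  using pt_eq[of t g "wt (pt t g)" "el (pt t g)"] pt_rep[OF pt_pts, of t g] by auto

lemma EG_cases:
  assumes "x \<in> pts (EG G)"
  obtains t g where "t \<in> pts Delta_omega" "\<And>i. g i \<in> carrier G" "x = pt t g"
  using pt_rep[OF assms] that by metis

lemma EG_plot_of_lift:
  assumes "plot Delta_omega n U t" "\<And>i. plot (space_of G) n U (\<lambda>u. g u i)"
  shows "plot (EG G) n U (\<lambda>u. pt (t u) (g u))"
proof -
  have "plot (pre_EG G) n U (\<lambda>u. (t u, g u))" using assms by (simp add: plot_pre_EG)
  then show ?thesis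
    using smoothD[OF subduction_smooth[OF subduction_quot[OF diffeological_space_pre_EG]]]
    by (simp add: EG_def pt_def)
qed

lemma EG_plotE:
  assumes "plot (EG G) n U p" "u \<in> U"
  obtains V t g where "eopen n V" "u \<in> V" "V \<subseteq> U" "plot Delta_omega n V t"
    "\<And>i. plot (space_of G) n V (\<lambda>v. g v i)" "\<And>v. v \<in> V \<Longrightarrow> p v = pt (t v) (g v)"
proof -
  from subductionE[OF subduction_quot[OF diffeological_space_pre_EG] assms(1)[unfolded EG_def] assms(2)]
  obtain V q where V: "eopen n V" "u \<in> V" "V \<subseteq> U" "plot (pre_EG G) n V q" "\<And>v. v \<in> V \<Longrightarrow> EG_rel G `` {q v} = p v"
    by metis
  show ?thesis
  proof (rule that[of V "\<lambda>v. fst (q v)" "\<lambda>v. snd (q v)"])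
    show "p v = pt (fst (q v)) (snd (q v))" if "v \<in> V" for v
      using V(5)[OF that] by (simp add: pt_def)
  qed (use V in \<open>auto simp: plot_pre_EG\<close>)
qed

text \<open>Smoothness into \<open>EG\<close> can be checked one coordinate at a time, because near each point only
  finitely many coordinates matter.\<close>

lemma EG_plotI:
  assumes t: "plot Delta_omega n U t" and g: "\<And>u i. u \<in> U \<Longrightarrow> g u i \<in> carrier G"
    and loc: "\<And>u i. u \<in> U \<Longrightarrow> \<exists>V h. eopen n V \<and> u \<in> V \<and> plot (space_of G) n V h \<and>
        (\<forall>v\<in>V \<inter> U. t v i \<noteq> 0 \<longrightarrow> g v i = h v)"
  shows "plot (EG G) n U (\<lambda>u. pt (t u) (g u))"
proof (rule plot_locally_eq[OF diffeological_space_EG Delta_plot_open[OF t]])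
  fix u assume u: "u \<in> U"
  obtain V0 N where V0: "eopen n V0" "u \<in> V0" "V0 \<subseteq> U" "\<And>i v. i > N \<Longrightarrow> v \<in> V0 \<Longrightarrow> t v i = 0"
    using Delta_plotE[OF t u] by metis
  obtain V h where V: "\<And>i. eopen n (V i)" "\<And>i. u \<in> V i" "\<And>i. plot (space_of G) n (V i) (h i)"
    "\<And>i v. v \<in> V i \<inter> U \<Longrightarrow> t v i \<noteq> 0 \<Longrightarrow> g v i = h i v"
    using loc[OF u] by metis
  define W where "W = V0 \<inter> (\<Inter>i\<in>{..N}. V i)"
  have W: "eopen n W" unfolding W_def
    using V V0 by (intro openin_Int openin_INT2) auto
  have uW: "u \<in> W" and WU: "W \<subseteq> U" using V V0 by (auto simp: W_def)
  \<comment> \<open>Above \<open>N\<close> the weights vanish on \<open>W\<close>, so the default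
    \<one> leaves the point of \<open>EG\<close> unchanged while every coordinate becomes a plot on
    all of \<open>W\<close>.\<close>
  define g' where "g' v i = (if i \<le> N then h i v else \<one>)" for v i
  have g': "plot (space_of G) n W (\<lambda>v. g' v i)" for i
  proof (cases "i \<le> N")
    case True
    then have "W \<subseteq> V i" by (auto simp: W_def)
    then show ?thesis
      using True plot_restrict[OF space_G V(3) W] by (simp add: g'_def)
  next
    case False
    then show ?thesis using plot_const[OF space_G W] by (simp add: g'_def)
  qed
  have tW: "plot Delta_omega n W t"
    using plot_restrict[OF diffeological_space_Delta t W WU] .
  have "pt (t v) (g v) = pt (t v) (g' v)" if v: "v \<in> W" for v
  proof (rule pt_cong)
    show "t v \<in> pts Delta_omega" using Delta_plot_pts[OF tW v] .
    show "g v i \<in> carrier G" for i using g v WU by blast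
    show "g' v i \<in> carrier G" for i
      using plot_pts[OF space_G g' v] by simp
    show "g v i = g' v i" if "t v i \<noteq> 0" for i
    proof -
      have "i \<le> N" using V0(4)[of i v] that v by (force simp: W_def)
      then show ?thesis using V(4)[of v i] that v WU by (auto simp: W_def g'_def)
    qed
  qed simp
  then show "\<exists>V q. eopen n V \<and> u \<in> V \<and> plot (EG G) n V q \<and> (\<forall>v\<in>V \<inter> U. pt (t v) (g v) = q v)"
    using W uW EG_plot_of_lift[OF tW g'] by (intro exI[of _ W] exI[of _ "\<lambda>v. pt (t v) (g' v)"]) auto
qed

text \<open>\<open>EG_act\<close> translates all representatives and collects their classes.
  Translation respects the relation, so this is a single class.\<close>

lemma EG_act_pt:
  assumes t: "t \<in> pts Delta_omega" and g: "\<And>i. g i \<in> carrier G" and a: "a \<in> carrier G"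
  shows "EG_act G (pt t g) a = pt t (\<lambda>i. g i \<otimes> a)"
proof -
  let ?S = "{(t', \<lambda>i. g' i \<otimes> a) | t' g'. (t', g') \<in> pt t g}"
  have "EG_rel G `` {y} = pt t (\<lambda>i. g i \<otimes> a)" if y: "y \<in> ?S" for y
  proof -
    obtain t' g' where g': "y = (t', \<lambda>i. g' i \<otimes> a)" "((t, g), (t', g')) \<in> EG_rel G"
      using y by (auto simp: pt_def)
    then have e: "t' = t" "\<And>i. t i \<noteq> 0 \<Longrightarrow> g' i = g i" "\<And>i. g' i \<in> carrier G"
      by (auto simp: EG_rel_def pts_pre_EG)
    have "pt t' (\<lambda>i. g' i \<otimes> a) = pt t (\<lambda>i. g i \<otimes> a)"
      using e t g a by (intro pt_cong) auto
    then show ?thesis using g' by (simp add: pt_def)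
  qed
  moreover have "(t, \<lambda>i. g i \<otimes> a) \<in> ?S"
    using t g equiv_class_self[OF equiv_EG_rel, of "(t, g)"] by (auto simp: pt_def pts_pre_EG)
  moreover have "EG_rel G `` ?S = (\<Union>y\<in>?S. EG_rel G `` {y})" by blast
  ultimately show ?thesis unfolding EG_act_def by blast
qed

section \<open>EG as a principal bundle over BG\<close>

definition EGB :: "(((nat \<Rightarrow> real) \<times> (nat \<Rightarrow> 'g)) set, ((nat \<Rightarrow> real) \<times> (nat \<Rightarrow> 'g)) set set, 'g) gbundle" where
  "EGB = \<lparr>tot = EG G, prj = (\<lambda>x. orbit_rel G (EG G) (EG_act G) `` {x}), act = EG_act G\<rparr>"

lemma EGB_simps [simp]: "tot EGB = EG G" "act EGB = EG_act G"
  by (simp_all add: EGB_def)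

lemma EG_act_pts: "x \<in> pts (EG G) \<Longrightarrow> a \<in> carrier G \<Longrightarrow> EG_act G x a \<in> pts (EG G)"
  by (erule EG_cases) (simp add: EG_act_pt pt_pts)

lemma EG_act_act:
  assumes "x \<in> pts (EG G)" "a \<in> carrier G" "b \<in> carrier G"
  shows "EG_act G (EG_act G x a) b = EG_act G x (a \<otimes> b)"
  using assms by (elim EG_cases) (simp add: EG_act_pt m_assoc)

lemma EG_act_one: "x \<in> pts (EG G) \<Longrightarrow> EG_act G x \<one> = x"
  by (erule EG_cases) (simp add: EG_act_pt)

lemma equiv_orbit_rel: "equiv (pts (EG G)) (orbit_rel G (EG G) (EG_act G))"
proof (rule equivI)
  show "orbit_rel G (EG G) (EG_act G) \<subseteq> pts (EG G) \<times> pts (EG G)" by (auto simp: orbit_rel_def)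
  show "refl_on (pts (EG G)) (orbit_rel G (EG G) (EG_act G))"
    using EG_act_one by (auto simp: orbit_rel_def refl_on_def intro!: bexI[of _ \<one>])
  show "sym (orbit_rel G (EG G) (EG_act G))"
  proof (rule symI)
    fix x y assume "(x, y) \<in> orbit_rel G (EG G) (EG_act G)"
    then obtain g where g: "x \<in> pts (EG G)" "y \<in> pts (EG G)" "g \<in> carrier G" "y = EG_act G x g"
      by (auto simp: orbit_rel_def)
    then have "x = EG_act G y (inv g)" by (simp add: EG_act_act EG_act_one)
    then show "(y, x) \<in> orbit_rel G (EG G) (EG_act G)"
      using g by (auto simp: orbit_rel_def)
  qed
  show "trans (orbit_rel G (EG G) (EG_act G))"
  proof (rule transI)
    fix x y z assume "(x, y) \<in> orbit_rel G (EG G) (EG_act G)" "(y, z) \<in> orbit_rel G (EG G) (EG_act G)"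
    then obtain g h where "x \<in> pts (EG G)" "z \<in> pts (EG G)" "g \<in> carrier G" "h \<in> carrier G"
        "z = EG_act G (EG_act G x g) h"
      by (auto simp: orbit_rel_def)
    then show "(x, z) \<in> orbit_rel G (EG G) (EG_act G)"
      by (auto simp: orbit_rel_def EG_act_act intro!: bexI[of _ "g \<otimes> h"])
  qed
qed

lemma EGB_prj_eq_iff:
  "x \<in> pts (EG G) \<Longrightarrow> y \<in> pts (EG G) \<Longrightarrow> prj EGB x = prj EGB y \<longleftrightarrow> (\<exists>g\<in>carrier G. y = EG_act G x g)"
  using eq_equiv_class_iff[OF equiv_orbit_rel, of x y] by (auto simp: EGB_def orbit_rel_def)

lemma EGB_prj_act:
  assumes "x \<in> pts (EG G)" "g \<in> carrier G"
  shows "prj EGB (EG_act G x g) = prj EGB x"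
  using EGB_prj_eq_iff[OF assms(1) EG_act_pts[OF assms]] assms(2) by auto

lemma subduction_EGB: "subduction (EG G) (BG G) (prj EGB)"
  using subduction_quot[OF diffeological_space_EG] by (simp add: EGB_def BG_def)

lemma smooth_wt: "smooth (EG G) real_dspace (\<lambda>x. wt x i)"
proof (rule smoothI)
  fix n U p assume p: "plot (EG G) n U p"
  show "plot real_dspace n U (\<lambda>u. wt (p u) i)"
  proof (rule plot_locally_eq[OF diffeological_space_real])
    show "eopen n U" using plot_domain[OF diffeological_space_EG p] .
    fix u assume "u \<in> U"
    from EG_plotE[OF p this] obtain V t g where V: "eopen n V" "u \<in> V" "plot Delta_omega n V t"
      "\<And>i. plot (space_of G) n V (\<lambda>v. g v i)" "\<And>v. v \<in> V \<Longrightarrow> p v = pt (t v) (g v)" by metis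
    have "g v i \<in> carrier G" if "v \<in> V" for v i
      using plot_pts[OF space_G V(4) that] by simp
    then have "wt (p v) i = t v i" if "v \<in> V" for v
      using V(5)[OF that] wt_pt[OF Delta_plot_pts[OF V(3) that], of "g v"] that by simp
    then show "\<exists>V q. eopen n V \<and> u \<in> V \<and> plot real_dspace n V q \<and> (\<forall>v\<in>V \<inter> U. wt (p v) i = q v)"
      using V Delta_plot_smooth[OF V(3)]
      by (intro exI[of _ V] exI[of _ "\<lambda>v. t v i"]) (auto simp: real_dspace_def)
  qed
qed simp

text \<open>Where the weight is positive, every local lift of a plot has the same group coordinate,
  so the choice hidden in \<open>el\<close> does no harm.\<close>

lemma smooth_el: "smooth (sub_dspace (EG G) {x. wt x i > 0}) (space_of G) (\<lambda>x. el x i)"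
proof (rule smoothI)
  fix n U p assume "plot (sub_dspace (EG G) {x. wt x i > 0}) n U p"
  then have p: "plot (EG G) n U p" "\<And>u. u \<in> U \<Longrightarrow> wt (p u) i > 0" by (auto simp: sub_dspace_def)
  show "plot (space_of G) n U (\<lambda>u. el (p u) i)"
  proof (rule plot_locally_eq[OF space_G])
    show "eopen n U" using plot_domain[OF diffeological_space_EG p(1)] .
    fix u assume "u \<in> U"
    from EG_plotE[OF p(1) this] obtain V t g where V: "eopen n V" "u \<in> V" "V \<subseteq> U" "plot Delta_omega n V t"
      "\<And>i. plot (space_of G) n V (\<lambda>v. g v i)" "\<And>v. v \<in> V \<Longrightarrow> p v = pt (t v) (g v)" by metis
    have c: "g v i \<in> carrier G" if "v \<in> V" for v i
      using plot_pts[OF space_G V(5) that] by simp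
    have "el (p v) i = g v i" if v: "v \<in> V" for v
    proof -
      have "wt (p v) i > 0" using p(2) v V(3) by blast
      then show ?thesis
        using V(6)[OF v] wt_pt[OF Delta_plot_pts[OF V(4) v], of "g v"] el_pt[OF Delta_plot_pts[OF V(4) v], of "g v"]
          c[OF v] by simp
    qed
    then show "\<exists>V q. eopen n V \<and> u \<in> V \<and> plot (space_of G) n V q \<and> (\<forall>v\<in>V \<inter> U. el (p v) i = q v)"
      using V(1,2,5) by (intro exI[of _ V] exI[of _ "\<lambda>v. g v i"]) auto
  qed
qed (use pt_rep(2) in auto)

lemma wt_act: "x \<in> pts (EG G) \<Longrightarrow> a \<in> carrier G \<Longrightarrow> wt (EG_act G x a) = wt x"
  by (erule EG_cases) (simp add: EG_act_pt wt_pt)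

lemma el_act: "x \<in> pts (EG G) \<Longrightarrow> a \<in> carrier G \<Longrightarrow> wt x i \<noteq> 0 \<Longrightarrow> el (EG_act G x a) i = el x i \<otimes> a"
  by (erule EG_cases) (simp add: EG_act_pt wt_pt el_pt)

text \<open>The weights are invariant under the action and descend to \<open>BG\<close>; at each
  point they sum to 1, so one of them is positive. Local triviality and D-numerability follow from
  the results on charted bundles.\<close>

lemma charted_EGB: "\<exists>f. charted G (BG G) EGB f (\<lambda>k x. el x k) \<and> (\<forall>x\<in>pts (EG G). \<forall>k. f k (prj EGB x) = wt x k)"
proof -
  have "\<exists>f. smooth (BG G) real_dspace f \<and> (\<forall>x\<in>pts (EG G). f (prj EGB x) = wt x k)" for k
  proof (rule subduction_descend[OF diffeological_space_BG diffeological_space_EG diffeological_space_real subduction_EGB smooth_wt])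
    show "wt x k = wt y k" if "x \<in> pts (EG G)" "y \<in> pts (EG G)" "prj EGB x = prj EGB y" for x y
      using that EGB_prj_eq_iff[OF that(1,2)] wt_act by auto
  qed blast
  then obtain f where f: "\<And>k. smooth (BG G) real_dspace (f k)"
    "\<And>k x. x \<in> pts (EG G) \<Longrightarrow> f k (prj EGB x) = wt x k"
    by metis
  have surj: "\<exists>x\<in>pts (EG G). prj EGB x = b" if "b \<in> pts (BG G)" for b
    by (rule subduction_surj[OF diffeological_space_BG diffeological_space_EG subduction_EGB that]) blast
  have act: "smooth (prod_dspace (EG G) (space_of G)) (EG G) (\<lambda>(x, g). EG_act G x g)"
  proof (rule smoothI)
    fix n U p assume p: "plot (prod_dspace (EG G) (space_of G)) n U p"
    then have p1: "plot (EG G) n U (\<lambda>u. fst (p u))" and p2: "plot (space_of G) n U (\<lambda>u. snd (p u))"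
      by (auto simp: prod_dspace_def comp_def)
    show "plot (EG G) n U (\<lambda>u. case p u of (x, g) \<Rightarrow> EG_act G x g)"
    proof (rule plot_locally_eq[OF diffeological_space_EG])
      show "eopen n U" using plot_domain[OF diffeological_space_EG p1] .
      fix u assume "u \<in> U"
      from EG_plotE[OF p1 this] obtain V t g where V: "eopen n V" "u \<in> V" "V \<subseteq> U" "plot Delta_omega n V t"
        "\<And>i. plot (space_of G) n V (\<lambda>v. g v i)" "\<And>v. v \<in> V \<Longrightarrow> fst (p v) = pt (t v) (g v)" by metis
      have p2V: "plot (space_of G) n V (\<lambda>u. snd (p u))"
        using plot_restrict[OF space_G p2 V(1,3)] .
      have "plot (EG G) n V (\<lambda>v. pt (t v) (\<lambda>i. g v i \<otimes> snd (p v)))"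
        by (intro EG_plot_of_lift V(4) gplot_mult V(5) p2V)
      moreover have "(case p v of (x, g) \<Rightarrow> EG_act G x g) = pt (t v) (\<lambda>i. g v i \<otimes> snd (p v))" if v: "v \<in> V" for v
        using V(6)[OF v] Delta_plot_pts[OF V(4) v] plot_pts[OF space_G V(5) v]
          plot_pts[OF space_G p2V v]
        by (simp add: case_prod_unfold EG_act_pt)
      ultimately show "\<exists>V q. eopen n V \<and> u \<in> V \<and> plot (EG G) n V q \<and>
          (\<forall>v\<in>V \<inter> U. (case p v of (x, g) \<Rightarrow> EG_act G x g) = q v)"
        using V(1,2) by (intro exI[of _ V] exI[of _ "\<lambda>v. pt (t v) (\<lambda>i. g v i \<otimes> snd (p v))"]) auto
    qed
  qed (use EG_act_pts in auto)
  have wt0: "wt x k \<ge> 0" "\<exists>k. wt x k > 0" if x: "x \<in> pts (EG G)" for x k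
  proof -
    have w: "wt x \<in> pts Delta_omega" using pt_rep(1)[OF x] .
    then show "wt x k \<ge> 0" by (simp add: Delta_iff)
    obtain S where S: "finite S" "(\<Sum>i\<in>S. wt x i) = 1" using w by (auto simp: Delta_iff)
    have "\<exists>i\<in>S. wt x i \<noteq> 0"
    proof (rule ccontr)
      assume "\<not> ?thesis"
      then have "(\<Sum>i\<in>S. wt x i) = 0" by (intro sum.neutral) auto
      then show False using S(2) by simp
    qed
    then show "\<exists>k. wt x k > 0" using w by (force simp: Delta_iff order_less_le)
  qed
  have "charted G (BG G) EGB f (\<lambda>k x. el x k)"
  proof (intro charted.intro Gtorsor.intro Gspace.intro Gspace_axioms.intro Gtorsor_axioms.intro
      charted_axioms.intro dgrp_axioms diffeological_space_BG)
    show "G_space_over G (BG G) EGB"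
      using act EG_act_act EG_act_one diffeological_space_EG
        subduction_smooth[OF subduction_EGB] EGB_prj_act
      by (auto simp: G_space_over_def smooth_right_action_def)
    show "subduction (tot EGB) (BG G) (prj EGB)" using subduction_EGB by simp
    show "\<exists>g\<in>carrier G. y = act EGB x g" if "x \<in> pts (tot EGB)" "y \<in> pts (tot EGB)" "prj EGB x = prj EGB y" for x y
      using that EGB_prj_eq_iff by simp
    show "smooth (BG G) real_dspace (f k)" for k by (rule f(1))
    show "0 \<le> f k b" "\<exists>k. 0 < f k b" if "b \<in> pts (BG G)" for b k
      using surj[OF that] f(2) wt0 by auto
    show "smooth (sub_dspace (tot EGB) {x. 0 < f k (prj EGB x)}) (space_of G) (\<lambda>x. el x k)" for k
      unfolding EGB_simps by (rule smooth_from_sub_mono[OF _ smooth_el]) (use diffeological_space_EG f(2) in auto)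
    show "el (act EGB x g) k = el x k \<otimes> g"
      if "x \<in> pts (tot EGB)" "0 < f k (prj EGB x)" "g \<in> carrier G" for x k g
      using that f(2) by (simp add: el_act)
  qed
  then show ?thesis using f(2) by blast
qed

end

section \<open>Classifying maps\<close>

text \<open>At the boundary of a chart domain the group coordinate breaks down, and this is
  invisible in \<open>EG\<close> only if the weight vanishes on a whole neighbourhood. Hence the
  supports of the \<open>t k\<close>, and not just their positive sets, must lie in the chart
  domains.\<close>

lemma (in charted) classifying_map:
  obtains H where "smooth (tot P) (EG G) H"
    "\<And>x g. x \<in> pts (tot P) \<Longrightarrow> g \<in> carrier G \<Longrightarrow> H (act P x g) = EG_act G (H x) g"
proof -
  obtain t where t: "\<And>k. smooth B real_dspace (t k)" "\<And>k x. x \<in> pts B \<Longrightarrow> t k x \<ge> 0"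
    "loc_finite B UNIV t" "\<And>x. x \<in> pts B \<Longrightarrow> (\<Sum>k | t k x \<noteq> 0. t k x) = 1"
    "\<And>k. D_supp B (t k) \<subseteq> {x\<in>pts B. f k x > 0}"
    by (rule partition_of_unity_from_sequence[OF base f_smooth f_nonneg f_pos]) (blast+)
  define T where "T x k = t k (prj P x)" for x k
  \<comment> \<open>Outside the chart domain the weight is 0, so \<one> serves as a mere placeholder
    in the carrier.\<close>
  define \<Gamma> where "\<Gamma> x k = (if f k (prj P x) > 0 then \<gamma> k x else \<one>)" for x k
  have T: "T x \<in> pts Delta_omega" if x: "x \<in> pts (tot P)" for x
  proof -
    let ?S = "{k. t k (prj P x) \<noteq> 0}"
    have b: "prj P x \<in> pts B" using prj_pts[OF x] .
    have "finite ?S" using loc_finite_finite[OF t(3) b] by simp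
    then show ?thesis unfolding Delta_iff
      using t(2,4)[OF b] by (auto simp: T_def intro!: exI[of _ ?S])
  qed
  have \<Gamma>: "\<Gamma> x k \<in> carrier G" if x: "x \<in> pts (tot P)" for x k
    using \<gamma>_carrier[OF x] by (simp add: \<Gamma>_def)
  have Tpos: "f k (prj P x) > 0" if "x \<in> pts (tot P)" "T x k \<noteq> 0" for x k
  proof -
    have b: "prj P x \<in> pts B" using prj_pts[OF that(1)] .
    have "t k (prj P x) > 0" using t(2)[OF b, of k] that(2) by (simp add: T_def)
    then show ?thesis using in_D_supp[OF base b, of "t k"] t(5) by blast
  qed
  show ?thesis
  proof (rule that[of "\<lambda>x. pt (T x) (\<Gamma> x)"])
    show "pt (T (act P x g)) (\<Gamma> (act P x g)) = EG_act G (pt (T x) (\<Gamma> x)) g"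
      if x: "x \<in> pts (tot P)" and g: "g \<in> carrier G" for x g
    proof -
      have "pt (T (act P x g)) (\<Gamma> (act P x g)) = pt (T x) (\<lambda>k. \<Gamma> x k \<otimes> g)"
      proof (rule pt_cong)
        show "T (act P x g) k = T x k" for k using x g by (simp add: T_def prj_act)
        then show "\<Gamma> (act P x g) k = \<Gamma> x k \<otimes> g" if "T (act P x g) k \<noteq> 0" for k
          using Tpos[OF x, of k] that x g by (simp add: \<Gamma>_def prj_act \<gamma>_equiv)
      qed (use T \<Gamma> x g act_pts in auto)
      then show ?thesis using EG_act_pt[OF T[OF x] \<Gamma>[OF x] g] by simp
    qed
    show "smooth (tot P) (EG G) (\<lambda>x. pt (T x) (\<Gamma> x))"
    proof (rule smoothI)
      fix n U p assume p: "plot (tot P) n U p"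
      have U: "eopen n U" using plot_domain[OF total p] .
      have pp: "p u \<in> pts (tot P)" if "u \<in> U" for u
        using plot_pts[OF total p that] .
      have q: "plot B n U (\<lambda>u. prj P (p u))" using smoothD[OF prj_smooth p] .
      show "plot (EG G) n U (\<lambda>u. pt (T (p u)) (\<Gamma> (p u)))"
      proof (rule EG_plotI)
        show "plot Delta_omega n U (\<lambda>u. T (p u))"
        proof (rule Delta_plotI[OF U])
          show "smooth_fun_on n U (\<lambda>u. T (p u) i)" for i
            using t(1)[of i] q by (auto simp: T_def smooth_real_iff[OF base])
          fix u assume u: "u \<in> U"
          show "T (p u) \<in> pts Delta_omega" using T pp u by blast
          from loc_finiteE[OF t(3) prj_pts[OF pp[OF u]]] obtain N F where N:
            "D_open B N" "prj P (p u) \<in> N" "finite F" "\<And>i y. i \<in> UNIV - F \<Longrightarrow> y \<in> N \<Longrightarrow> t i y = 0" by metis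
          show "\<exists>V S. eopen n V \<and> u \<in> V \<and> finite S \<and> (\<forall>v\<in>V \<inter> U. \<forall>i. i \<notin> S \<longrightarrow> T (p v) i = 0)"
            using D_open_plot[OF N(1) q] u N(2-4)
            by (intro exI[of _ "{u\<in>U. prj P (p u) \<in> N}"] exI[of _ F]) (auto simp: T_def)
        qed
        show "\<Gamma> (p u) i \<in> carrier G" if "u \<in> U" for u i using \<Gamma> pp that by blast
        fix u i assume u: "u \<in> U"
        have b: "prj P (p u) \<in> pts B" using prj_pts[OF pp[OF u]] .
        show "\<exists>V h. eopen n V \<and> u \<in> V \<and> plot (space_of G) n V h \<and>
          (\<forall>v\<in>V \<inter> U. T (p v) i \<noteq> 0 \<longrightarrow> \<Gamma> (p v) i = h v)"
        proof (cases "f i (prj P (p u)) > 0")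
          case True
          let ?V = "{u\<in>U. prj P (p u) \<in> cdom i}"
          have V: "eopen n ?V" using D_open_plot[OF D_open_cdom q] .
          have "plot (tot P) n ?V p" using plot_restrict[OF total p V] by blast
          then have "plot (sub_dspace (tot P) {x. f i (prj P x) > 0}) n ?V p"
            by (auto simp: sub_dspace_def cdom_def)
          then have "plot (space_of G) n ?V (\<lambda>v. \<gamma> i (p v))" using smoothD[OF \<gamma>_smooth] by blast
          then show ?thesis
            using V u True b by (intro exI[of _ ?V] exI[of _ "\<lambda>v. \<gamma> i (p v)"]) (auto simp: \<Gamma>_def cdom_def)
        next
          \<comment> \<open>The base point is off the closed support of \<open>t i\<close>: the
            weight vanishes nearby and a constant group coordinate will do.\<close>
          case False
          then have "prj P (p u) \<notin> D_supp B (t i)" using t(5) by blast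
          from not_in_D_supp[OF base b this] obtain N where N: "D_open B N" "prj P (p u) \<in> N"
            "\<And>y. y \<in> N \<Longrightarrow> \<not> t i y > 0" by metis
          let ?V = "{u\<in>U. prj P (p u) \<in> N}"
          have V: "eopen n ?V" using D_open_plot[OF N(1) q] .
          have "T (p v) i = 0" if "v \<in> ?V" for v
            using N(3)[of "prj P (p v)"] that t(2)[OF prj_pts[OF pp], of v i] by (auto simp: T_def)
          then show ?thesis
            using V u N(2) plot_const[OF space_G V, of \<one>]
            by (intro exI[of _ ?V] exI[of _ "\<lambda>v. \<one>"]) auto
        qed
      qed
    qed (use T \<Gamma> pt_pts in blast)
  qed
qed

section \<open>Homotopies of equivariant maps\<close>

text \<open>The push-forward of a vector along an injection of index sets.\<close>

definition spread :: "(nat \<Rightarrow> nat) \<Rightarrow> (nat \<Rightarrow> real) \<Rightarrow> nat \<Rightarrow> real" where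
  "spread \<alpha> u m = (if m \<in> range \<alpha> then u (the_inv \<alpha> m) else 0)"

lemma spread_zero:
  assumes "inj \<alpha>" "m \<notin> \<alpha> ` S" "\<And>i. i \<notin> S \<Longrightarrow> u i = 0"
  shows "spread \<alpha> u m = 0"
proof (cases "m \<in> range \<alpha>")
  case True
  then obtain i where i: "m = \<alpha> i" by blast
  then have "i \<notin> S" using assms(2) by blast
  then show ?thesis using assms(1,3) by (simp add: spread_def i the_inv_f_f)
qed (simp add: spread_def)

lemma sum_spread:
  assumes "inj \<alpha>" "finite S'" "\<alpha> ` S \<subseteq> S'" "\<And>i. i \<notin> S \<Longrightarrow> u i = 0"
  shows "(\<Sum>m\<in>S'. spread \<alpha> u m) = (\<Sum>i\<in>S. u i)"
proof -
  have "(\<Sum>m\<in>S'. spread \<alpha> u m) = (\<Sum>m\<in>\<alpha> ` S. spread \<alpha> u m)"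
  proof (rule sum.mono_neutral_right[OF assms(2,3)])
    show "\<forall>m\<in>S' - \<alpha> ` S. spread \<alpha> u m = 0"
    proof
      fix m assume "m \<in> S' - \<alpha> ` S"
      then show "spread \<alpha> u m = 0" by (intro spread_zero[OF assms(1) _ assms(4)]) simp_all
    qed
  qed
  also have "\<dots> = (\<Sum>i\<in>S. spread \<alpha> u (\<alpha> i))"
    using assms(1) by (intro sum.reindex_cong[of \<alpha>]) (auto intro: inj_on_subset)
  finally show ?thesis using the_inv_f_f[OF assms(1)] by (simp add: spread_def)
qed

lemma smooth_fun_on_spread:
  "eopen n V \<Longrightarrow> (\<And>i. smooth_fun_on n V (\<lambda>v. u v i)) \<Longrightarrow> smooth_fun_on n V (\<lambda>v. spread \<alpha> (u v) m)"
  by (cases "m \<in> range \<alpha>") (auto simp: spread_def smooth_fun_on_const)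

text \<open>The endpoints run through the sequence 1 - 1/n, n = 1, 2, ...: the first window opens at
  0, successive windows are separated by gaps, and infinitely many of them fit before time
  1.\<close>

definition win_lo :: "nat \<Rightarrow> real" where "win_lo m = 1 - 1 / (2 * real m + 1)"
definition win_hi :: "nat \<Rightarrow> real" where "win_hi m = 1 - 1 / (2 * real m + 2)"
definition lam :: "nat \<Rightarrow> real \<Rightarrow> real" where "lam m s = smoothstep (win_lo m) (win_hi m) s"

lemma win_less: "win_lo m < win_hi m" "i < m \<Longrightarrow> win_hi i < win_lo m" "0 \<le> win_lo m" "win_hi m < 1"
  by (auto simp: win_lo_def win_hi_def intro!: divide_strict_left_mono)

lemma lam_0: "s \<le> win_lo m \<Longrightarrow> lam m s = 0" and lam_1: "win_hi m \<le> s \<Longrightarrow> lam m s = 1"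
  and lam_bounds: "0 \<le> lam m s" "lam m s \<le> 1"
  using win_less(1)[of m] by (auto simp: lam_def smoothstep_0 smoothstep_1 smoothstep_bounds)

text \<open>An open set is a diffeological space whose identity is a plot, so the statement for
  \<open>smooth\<close> specialises to it.\<close>

lemma smooth_fun_on_smoothstep:
  assumes U: "eopen n U" "smooth_fun_on n U r" "b < c"
  shows "smooth_fun_on n U (\<lambda>u. smoothstep b c (r u))"
proof -
  have D: "diffeological_space (euclid_dspace n U)" by (rule diffeological_space_euclid[OF U(1)])
  have r: "smooth (euclid_dspace n U) real_dspace r"
    unfolding smooth_real_iff[OF D] using smooth_fun_on_compose[OF _ U(2)] by (auto simp: euclid_dspace_def)
  have "plot (euclid_dspace n U) n U (\<lambda>u. u)"
    using euclid_smooth_inclusion[OF U(1) U(1)] by (simp add: euclid_dspace_def)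
  then show ?thesis
    using smooth_real_smoothstep[OF D r U(3)] by (auto simp: smooth_real_iff[OF D])
qed

text \<open>\<open>mv \<alpha>\<close> moves the weight of each coordinate \<open>i\<close> from position \<open>\<alpha> i\<close> (time \<open>0\<close>) to position
  \<open>i\<close> (time \<open>1\<close>), during the time window \<open>[win_lo i, win_hi i]\<close>. The windows are disjoint and
  increasing and \<open>i < \<alpha> i\<close>, so position \<open>\<alpha> i\<close> has been vacated by coordinate \<open>i\<close> before coordinate
  \<open>\<alpha> i\<close> arrives; hence no position ever carries two group elements.\<close>

definition mv_wt :: "(nat \<Rightarrow> nat) \<Rightarrow> (nat \<Rightarrow> real) \<Rightarrow> real \<Rightarrow> nat \<Rightarrow> real" where
  "mv_wt \<alpha> t s m = lam m s * t m + spread \<alpha> (\<lambda>i. (1 - lam i s) * t i) m"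

text \<open>The switch at \<open>win_lo m\<close> happens while position \<open>m\<close> is empty:
  the coordinate that started there has left, and coordinate \<open>m\<close> has not begun to
  arrive.\<close>

definition mv_el :: "(nat \<Rightarrow> nat) \<Rightarrow> (nat \<Rightarrow> 'g) \<Rightarrow> real \<Rightarrow> nat \<Rightarrow> 'g" where
  "mv_el \<alpha> g s m = (if s \<le> win_lo m \<and> m \<in> range \<alpha> then g (the_inv \<alpha> m) else g m)"

text \<open>Linear interpolation of the two spread vectors. The time parameter ranges over all
  reals, and \<open>smoothstep\<close> keeps the combination convex.\<close>

definition join_wt :: "(nat \<Rightarrow> nat) \<Rightarrow> (nat \<Rightarrow> nat) \<Rightarrow> (nat \<Rightarrow> real) \<Rightarrow> (nat \<Rightarrow> real) \<Rightarrow> real \<Rightarrow> nat \<Rightarrow> real" where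
  "join_wt \<alpha> \<beta> t t' s m = spread \<alpha> (\<lambda>i. (1 - smoothstep 0 1 s) * t i) m + spread \<beta> (\<lambda>i. smoothstep 0 1 s * t' i) m"

definition join_el :: "(nat \<Rightarrow> nat) \<Rightarrow> (nat \<Rightarrow> nat) \<Rightarrow> (nat \<Rightarrow> 'g) \<Rightarrow> (nat \<Rightarrow> 'g) \<Rightarrow> nat \<Rightarrow> 'g" where
  "join_el \<alpha> \<beta> g g' m = (if m \<in> range \<alpha> then g (the_inv \<alpha> m) else if m \<in> range \<beta> then g' (the_inv \<beta> m) else g m)"

lemma mv_wt_Delta:
  assumes "inj \<alpha>" "t \<in> pts Delta_omega"
  shows "mv_wt \<alpha> t s \<in> pts Delta_omega"
proof -
  obtain S where t: "\<And>i. t i \<ge> 0" and S: "finite S" "\<And>i. i \<notin> S \<Longrightarrow> t i = 0" "(\<Sum>i\<in>S. t i) = 1"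
    using assms(2) by (auto simp: Delta_iff)
  let ?S = "S \<union> \<alpha> ` S"
  have "(\<Sum>m\<in>?S. mv_wt \<alpha> t s m) = (\<Sum>m\<in>?S. lam m s * t m) + (\<Sum>m\<in>?S. spread \<alpha> (\<lambda>i. (1 - lam i s) * t i) m)"
    by (simp add: mv_wt_def sum.distrib)
  also have "(\<Sum>m\<in>?S. lam m s * t m) = (\<Sum>m\<in>S. lam m s * t m)"
    using S by (intro sum.mono_neutral_right) auto
  also have "(\<Sum>m\<in>?S. spread \<alpha> (\<lambda>i. (1 - lam i s) * t i) m) = (\<Sum>i\<in>S. (1 - lam i s) * t i)"
    using S assms(1) by (intro sum_spread) auto
  also have "(\<Sum>m\<in>S. lam m s * t m) + \<dots> = (\<Sum>m\<in>S. t m)"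
    unfolding sum.distrib[symmetric] by (intro sum.cong) (auto simp: algebra_simps)
  also have "\<dots> = 1" by (rule S(3))
  finally have "(\<Sum>m\<in>?S. mv_wt \<alpha> t s m) = 1" .
  moreover have "mv_wt \<alpha> t s m = 0" if "m \<notin> ?S" for m
    using that S(2) spread_zero[OF assms(1), of m S "\<lambda>i. (1 - lam i s) * t i"] by (simp add: mv_wt_def)
  moreover have "mv_wt \<alpha> t s m \<ge> 0" for m
    using t lam_bounds by (auto simp: mv_wt_def spread_def)
  ultimately show ?thesis using S(1) unfolding Delta_iff by (intro conjI allI exI[of _ ?S]) auto
qed

lemma join_wt_Delta:
  assumes "inj \<alpha>" "inj \<beta>" "t \<in> pts Delta_omega" "t' \<in> pts Delta_omega"
  shows "join_wt \<alpha> \<beta> t t' s \<in> pts Delta_omega"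
proof -
  let ?w = "smoothstep 0 1 s"
  obtain S where t: "\<And>i. t i \<ge> 0" and S: "finite S" "\<And>i. i \<notin> S \<Longrightarrow> t i = 0" "(\<Sum>i\<in>S. t i) = 1"
    using assms(3) by (auto simp: Delta_iff)
  obtain R where t': "\<And>i. t' i \<ge> 0" and R: "finite R" "\<And>i. i \<notin> R \<Longrightarrow> t' i = 0" "(\<Sum>i\<in>R. t' i) = 1"
    using assms(4) by (auto simp: Delta_iff)
  let ?S = "\<alpha> ` S \<union> \<beta> ` R"
  have "(\<Sum>m\<in>?S. join_wt \<alpha> \<beta> t t' s m) = (\<Sum>m\<in>?S. spread \<alpha> (\<lambda>i. (1 - ?w) * t i) m) + (\<Sum>m\<in>?S. spread \<beta> (\<lambda>i. ?w * t' i) m)"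
    by (simp add: join_wt_def sum.distrib)
  also have "(\<Sum>m\<in>?S. spread \<alpha> (\<lambda>i. (1 - ?w) * t i) m) = (\<Sum>i\<in>S. (1 - ?w) * t i)"
    using S R assms by (intro sum_spread) auto
  also have "(\<Sum>m\<in>?S. spread \<beta> (\<lambda>i. ?w * t' i) m) = (\<Sum>i\<in>R. ?w * t' i)"
    using S R assms by (intro sum_spread) auto
  finally have "(\<Sum>m\<in>?S. join_wt \<alpha> \<beta> t t' s m) = 1"
    using S(3) R(3) by (simp add: sum_distrib_left[symmetric])
  moreover have "join_wt \<alpha> \<beta> t t' s m = 0" if "m \<notin> ?S" for m
    using that S(2) R(2) spread_zero[OF assms(1), of m S "\<lambda>i. (1 - ?w) * t i"]
      spread_zero[OF assms(2), of m R "\<lambda>i. ?w * t' i"] by (simp add: join_wt_def)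
  moreover have "join_wt \<alpha> \<beta> t t' s m \<ge> 0" for m
    using t t' smoothstep_bounds[of 0 1 s] by (auto simp: join_wt_def spread_def)
  ultimately show ?thesis using S(1) R(1) unfolding Delta_iff by (intro conjI allI exI[of _ ?S]) auto
qed

section \<open>Moving and joining points of EG\<close>

context dgrp
begin

text \<open>Independence of the representative: whenever position \<open>m\<close> has nonzero
  weight, the group element used there belongs to a coordinate whose original weight is nonzero.
  After \<open>win_lo m\<close> this is coordinate \<open>m\<close>, because
  \<open>i < \<alpha> i\<close> puts the window of the previous occupant earlier.\<close>

lemma mv_el_relevant:
  assumes "inj \<alpha>" "\<And>i. i < \<alpha> i" "mv_wt \<alpha> t s m \<noteq> 0" "\<And>i. t i \<noteq> 0 \<Longrightarrow> g i = g' i"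
  shows "mv_el \<alpha> g s m = mv_el \<alpha> g' s m"
proof (cases "s \<le> win_lo m")
  case True
  then have "spread \<alpha> (\<lambda>i. (1 - lam i s) * t i) m \<noteq> 0" using assms(3) by (simp add: mv_wt_def lam_0)
  then have "m \<in> range \<alpha>" "t (the_inv \<alpha> m) \<noteq> 0" by (auto simp: spread_def split: if_splits)
  then show ?thesis using True assms(4) by (simp add: mv_el_def)
next
  case False
  have "spread \<alpha> (\<lambda>i. (1 - lam i s) * t i) m = 0"
  proof (cases "m \<in> range \<alpha>")
    case True
    then obtain i where i: "m = \<alpha> i" by blast
    then have "win_hi i < s" using win_less(2)[OF assms(2)[of i]] False by simp
    then show ?thesis by (simp add: spread_def i the_inv_f_f[OF assms(1)] lam_1)
  qed (simp add: spread_def)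
  then have "t m \<noteq> 0" using assms(3) by (auto simp: mv_wt_def)
  then show ?thesis using False assms(4) by (simp add: mv_el_def)
qed

text \<open>Since the ranges are disjoint, at most one of the two points contributes at a position,
  and it does so with nonzero weight.\<close>

lemma join_el_relevant:
  assumes "range \<alpha> \<inter> range \<beta> = {}" "join_wt \<alpha> \<beta> t t' s m \<noteq> 0"
    "\<And>i. t i \<noteq> 0 \<Longrightarrow> g i = k i" "\<And>i. t' i \<noteq> 0 \<Longrightarrow> g' i = k' i"
  shows "join_el \<alpha> \<beta> g g' m = join_el \<alpha> \<beta> k k' m"
proof (cases "m \<in> range \<alpha>")
  case True
  then have "m \<notin> range \<beta>" using assms(1) by blast
  then have "t (the_inv \<alpha> m) \<noteq> 0" using assms(2) True by (auto simp: join_wt_def spread_def)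
  then show ?thesis using True assms(3) by (simp add: join_el_def)
next
  case False
  then have "m \<in> range \<beta>" "t' (the_inv \<beta> m) \<noteq> 0"
    using assms(2) by (auto simp: join_wt_def spread_def split: if_splits)
  then show ?thesis using False assms(4) by (simp add: join_el_def)
qed

definition mv :: "(nat \<Rightarrow> nat) \<Rightarrow> ((nat \<Rightarrow> real) \<times> (nat \<Rightarrow> 'g)) set \<times> real \<Rightarrow> ((nat \<Rightarrow> real) \<times> (nat \<Rightarrow> 'g)) set" where
  "mv \<alpha> z = pt (mv_wt \<alpha> (wt (fst z)) (snd z)) (mv_el \<alpha> (el (fst z)) (snd z))"

definition join where
  "join \<alpha> \<beta> x y s = pt (join_wt \<alpha> \<beta> (wt x) (wt y) s) (join_el \<alpha> \<beta> (el x) (el y))"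

lemma mv_pt:
  assumes "inj \<alpha>" "\<And>i. i < \<alpha> i" "t \<in> pts Delta_omega" "\<And>i. g i \<in> carrier G"
  shows "mv \<alpha> (pt t g, s) = pt (mv_wt \<alpha> t s) (mv_el \<alpha> g s)"
  unfolding mv_def
proof (rule pt_cong)
  have w: "wt (pt t g) = t" using wt_pt assms by blast
  show "mv_wt \<alpha> (wt (fst (pt t g, s))) (snd (pt t g, s)) i = mv_wt \<alpha> t s i" for i by (simp add: w)
  show "mv_wt \<alpha> (wt (fst (pt t g, s))) (snd (pt t g, s)) \<in> pts Delta_omega"
    using assms by (simp add: w mv_wt_Delta)
  show "mv_el \<alpha> (el (fst (pt t g, s))) (snd (pt t g, s)) i = mv_el \<alpha> g s i"
    if "mv_wt \<alpha> (wt (fst (pt t g, s))) (snd (pt t g, s)) i \<noteq> 0" for i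
    using that el_pt[OF assms(3,4)] by (auto simp: w intro!: mv_el_relevant[OF assms(1,2)])
qed (use assms pt_rep(2)[OF pt_pts[OF assms(3,4)]] in \<open>auto simp: mv_el_def\<close>)

lemma join_pt:
  assumes "inj \<alpha>" "inj \<beta>" "range \<alpha> \<inter> range \<beta> = {}" "t \<in> pts Delta_omega" "\<And>i. g i \<in> carrier G"
    "t' \<in> pts Delta_omega" "\<And>i. g' i \<in> carrier G"
  shows "join \<alpha> \<beta> (pt t g) (pt t' g') s = pt (join_wt \<alpha> \<beta> t t' s) (join_el \<alpha> \<beta> g g')"
  unfolding join_def
proof (rule pt_cong)
  have w: "wt (pt t g) = t" "wt (pt t' g') = t'" using wt_pt assms by blast+
  show "join_wt \<alpha> \<beta> (wt (pt t g)) (wt (pt t' g')) s i = join_wt \<alpha> \<beta> t t' s i" for i by (simp add: w)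
  show "join_wt \<alpha> \<beta> (wt (pt t g)) (wt (pt t' g')) s \<in> pts Delta_omega"
    using assms by (simp add: w join_wt_Delta)
  show "join_el \<alpha> \<beta> (el (pt t g)) (el (pt t' g')) i = join_el \<alpha> \<beta> g g' i"
    if "join_wt \<alpha> \<beta> (wt (pt t g)) (wt (pt t' g')) s i \<noteq> 0" for i
    using that el_pt[OF assms(4,5)] el_pt[OF assms(6,7)] by (auto simp: w intro!: join_el_relevant[OF assms(3)])
qed (use assms pt_rep(2)[OF pt_pts[OF assms(4,5)]] pt_rep(2)[OF pt_pts[OF assms(6,7)]] in \<open>auto simp: join_el_def\<close>)

text \<open>Let \<open>m = \<alpha> i\<close>. For times below \<open>win_lo m\<close> the group
  coordinate is that of \<open>i\<close>. For times above \<open>win_hi i\<close>, a nonzero weight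
  at \<open>m\<close> forces the time past \<open>win_lo m\<close>, and the coordinate is that of
  \<open>m\<close>. Because of the gap between the windows these two open conditions cover all
  times, and \<open>EG_plotI\<close> accepts one local plot for each.\<close>

lemma smooth_mv:
  assumes \<alpha>: "inj \<alpha>" "\<And>i. i < \<alpha> i"
  shows "smooth (prod_dspace (EG G) real_dspace) (EG G) (mv \<alpha>)"
proof (rule smoothI)
  fix z assume "z \<in> pts (prod_dspace (EG G) real_dspace)"
  then have "fst z \<in> pts (EG G)" by auto
  then show "mv \<alpha> z \<in> pts (EG G)"
    unfolding mv_def using pt_rep \<alpha> by (intro pt_pts mv_wt_Delta) (auto simp: mv_el_def)
next
  fix n U p assume p: "plot (prod_dspace (EG G) real_dspace) n U p"
  then have p1: "plot (EG G) n U (\<lambda>u. fst (p u))" and p2: "plot real_dspace n U (\<lambda>u. snd (p u))"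
    by (auto simp: prod_dspace_def comp_def)
  show "plot (EG G) n U (\<lambda>u. mv \<alpha> (p u))"
  proof (rule plot_locally_eq[OF diffeological_space_EG])
    show "eopen n U" using plot_domain[OF diffeological_space_EG p1] .
    fix u assume "u \<in> U"
    from EG_plotE[OF p1 this] obtain V t g where V: "eopen n V" "u \<in> V" "V \<subseteq> U" "plot Delta_omega n V t"
      "\<And>i. plot (space_of G) n V (\<lambda>v. g v i)" "\<And>v. v \<in> V \<Longrightarrow> fst (p v) = pt (t v) (g v)" by metis
    have gc: "g v i \<in> carrier G" if "v \<in> V" for v i
      using plot_pts[OF space_G V(5) that] by simp
    define r where "r = (\<lambda>v. snd (p v))"
    have "plot real_dspace n V r"
      using plot_restrict[OF diffeological_space_real p2 V(1,3)] by (simp add: r_def)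
    then have r: "smooth_fun_on n V r" by (simp add: real_dspace_def)
    have rc: "continuous_on V r" using smooth_fun_on_continuous[OF V(1) r] .
    have lam: "smooth_fun_on n V (\<lambda>v. lam i (r v))" for i
      unfolding lam_def by (rule smooth_fun_on_smoothstep[OF V(1) r win_less(1)])
    have lam': "smooth_fun_on n V (\<lambda>v. 1 - lam i (r v))" for i
      using smooth_fun_on_add[OF V(1) smooth_fun_on_const[OF V(1), of 1]
          smooth_fun_on_mult[OF V(1) smooth_fun_on_const[OF V(1), of "-1"] lam[of i]]] by simp
    have "plot (EG G) n V (\<lambda>v. pt (mv_wt \<alpha> (t v) (r v)) (mv_el \<alpha> (g v) (r v)))"
    proof (rule EG_plotI)
      show "plot Delta_omega n V (\<lambda>v. mv_wt \<alpha> (t v) (r v))"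
      proof (rule Delta_plotI[OF V(1)])
        show "mv_wt \<alpha> (t v) (r v) \<in> pts Delta_omega" if "v \<in> V" for v
          using mv_wt_Delta[OF \<alpha>(1) Delta_plot_pts[OF V(4) that]] .
        show "smooth_fun_on n V (\<lambda>v. mv_wt \<alpha> (t v) (r v) i)" for i
          unfolding mv_wt_def
          by (intro smooth_fun_on_add smooth_fun_on_mult smooth_fun_on_spread lam lam' V(1) Delta_plot_smooth[OF V(4)])
        fix v assume "v \<in> V"
        from Delta_plotE[OF V(4) this] obtain W N where W: "eopen n W" "v \<in> W" "W \<subseteq> V"
          "\<And>i v. i > N \<Longrightarrow> v \<in> W \<Longrightarrow> t v i = 0" by metis
        have "mv_wt \<alpha> (t w) (r w) i = 0" if "w \<in> W" "i \<notin> {..N} \<union> \<alpha> ` {..N}" for w i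
        proof -
          have "spread \<alpha> (\<lambda>i. (1 - lam i (r w)) * t w i) i = 0"
            using that W(4) by (intro spread_zero[OF \<alpha>(1), of _ "{..N}"]) auto
          then show ?thesis using that W(4) by (simp add: mv_wt_def)
        qed
        then show "\<exists>W S. eopen n W \<and> v \<in> W \<and> finite S \<and> (\<forall>w\<in>W \<inter> V. \<forall>i. i \<notin> S \<longrightarrow> mv_wt \<alpha> (t w) (r w) i = 0)"
          using W(1,2) by (intro exI[of _ W] exI[of _ "{..N} \<union> \<alpha> ` {..N}"]) auto
      qed
      show "mv_el \<alpha> (g v) (r v) i \<in> carrier G" if "v \<in> V" for v i
        using gc[OF that] by (simp add: mv_el_def)
      fix v m assume v: "v \<in> V"
      show "\<exists>W h. eopen n W \<and> v \<in> W \<and> plot (space_of G) n W h \<and>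
        (\<forall>w\<in>W \<inter> V. mv_wt \<alpha> (t w) (r w) m \<noteq> 0 \<longrightarrow> mv_el \<alpha> (g w) (r w) m = h w)"
      proof (cases "m \<in> range \<alpha>")
        case False
        then show ?thesis using V(1,5) v
          by (intro exI[of _ V] exI[of _ "\<lambda>w. g w m"]) (auto simp: mv_el_def)
      next
        case True
        then obtain i where i: "m = \<alpha> i" by blast
        have inv: "the_inv \<alpha> m = i" using i the_inv_f_f[OF \<alpha>(1)] by simp
        have less: "win_hi i < win_lo m" using win_less(2)[OF \<alpha>(2)[of i]] i by simp
        show ?thesis
        proof (cases "r v < win_lo m")
          case True
          let ?W = "{w\<in>V. r w \<in> {..<win_lo m}}"
          have W: "eopen n ?W" by (rule eopen_preimage[OF V(1) rc]) simp
          have "plot (space_of G) n ?W (\<lambda>w. g w i)"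
            using plot_restrict[OF space_G V(5) W] by blast
          then show ?thesis
            using W v True \<open>m \<in> range \<alpha>\<close> by (intro exI[of _ ?W] exI[of _ "\<lambda>w. g w i"]) (auto simp: mv_el_def inv)
        next
          case False
          let ?W = "{w\<in>V. r w \<in> {win_hi i<..}}"
          have W: "eopen n ?W" by (rule eopen_preimage[OF V(1) rc]) simp
          have g: "plot (space_of G) n ?W (\<lambda>w. g w m)"
            using plot_restrict[OF space_G V(5) W] by blast
          have "mv_el \<alpha> (g w) (r w) m = g w m" if "w \<in> ?W" "mv_wt \<alpha> (t w) (r w) m \<noteq> 0" for w
          proof -
            have "spread \<alpha> (\<lambda>i. (1 - lam i (r w)) * t w i) m = 0"
              using that(1) by (simp add: spread_def inv lam_1)
            then have "lam m (r w) \<noteq> 0" using that(2) by (auto simp: mv_wt_def)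
            then show ?thesis using lam_0[of "r w" m] by (auto simp: mv_el_def)
          qed
          then show ?thesis
            using W g v False less by (intro exI[of _ ?W] exI[of _ "\<lambda>w. g w m"]) auto
        qed
      qed
    qed
    moreover have "mv \<alpha> (p v) = pt (mv_wt \<alpha> (t v) (r v)) (mv_el \<alpha> (g v) (r v))" if v: "v \<in> V" for v
    proof -
      have "mv \<alpha> (pt (t v) (g v), r v) = pt (mv_wt \<alpha> (t v) (r v)) (mv_el \<alpha> (g v) (r v))"
        by (rule mv_pt[OF \<alpha> Delta_plot_pts[OF V(4) v]]) (rule gc[OF v])
      moreover have "p v = (pt (t v) (g v), r v)" using V(6)[OF v] by (simp add: r_def prod_eq_iff)
      ultimately show ?thesis by simp
    qed
    ultimately show "\<exists>V q. eopen n V \<and> u \<in> V \<and> plot (EG G) n V q \<and> (\<forall>v\<in>V \<inter> U. mv \<alpha> (p v) = q v)"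
      using V(1,2) by (intro exI[of _ V] exI[of _ "\<lambda>v. pt (mv_wt \<alpha> (t v) (r v)) (mv_el \<alpha> (g v) (r v))"]) auto
  qed
qed

text \<open>The positions do not depend on time, so \<open>join_el\<close> of two local lifts is
  itself a lift; only the weights vary with \<open>r\<close>.\<close>

lemma smooth_join:
  assumes \<alpha>: "inj \<alpha>" "inj \<beta>" "range \<alpha> \<inter> range \<beta> = {}"
    and f: "smooth X (EG G) f" and k: "smooth X (EG G) k" and r: "smooth X real_dspace r"
  shows "smooth X (EG G) (\<lambda>x. join \<alpha> \<beta> (f x) (k x) (r x))"
proof (rule smoothI)
  fix x assume "x \<in> pts X"
  then have "f x \<in> pts (EG G)" "k x \<in> pts (EG G)" using smooth_pts f k by metis+
  then show "join \<alpha> \<beta> (f x) (k x) (r x) \<in> pts (EG G)"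
    unfolding join_def using pt_rep \<alpha> by (intro pt_pts join_wt_Delta) (auto simp: join_el_def)
next
  fix n U p assume p: "plot X n U p"
  note p1 = smoothD[OF f p] and p2 = smoothD[OF k p]
  show "plot (EG G) n U (\<lambda>u. join \<alpha> \<beta> (f (p u)) (k (p u)) (r (p u)))"
  proof (rule plot_locally_eq[OF diffeological_space_EG])
    show U: "eopen n U" using plot_domain[OF diffeological_space_EG p1] .
    fix u assume u: "u \<in> U"
    from EG_plotE[OF p1 u] obtain V1 t g where V1: "eopen n V1" "u \<in> V1" "V1 \<subseteq> U" "plot Delta_omega n V1 t"
      "\<And>i. plot (space_of G) n V1 (\<lambda>v. g v i)" "\<And>v. v \<in> V1 \<Longrightarrow> f (p v) = pt (t v) (g v)" by metis
    from EG_plotE[OF p2 u] obtain V2 t' g' where V2: "eopen n V2" "u \<in> V2" "V2 \<subseteq> U" "plot Delta_omega n V2 t'"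
      "\<And>i. plot (space_of G) n V2 (\<lambda>v. g' v i)" "\<And>v. v \<in> V2 \<Longrightarrow> k (p v) = pt (t' v) (g' v)" by metis
    define V where "V = V1 \<inter> V2"
    have V: "eopen n V" "u \<in> V" "V \<subseteq> U" "V \<subseteq> V1" "V \<subseteq> V2"
      using V1 V2 by (auto simp: V_def)
    have t: "plot Delta_omega n V t" "plot Delta_omega n V t'"
      using plot_restrict[OF diffeological_space_Delta] V1 V2 V by metis+
    have g: "plot (space_of G) n V (\<lambda>v. g v i)" "plot (space_of G) n V (\<lambda>v. g' v i)" for i
      using plot_restrict[OF space_G V1(5) V(1,4)]
        plot_restrict[OF space_G V2(5) V(1,5)] by auto
    have gc: "g v i \<in> carrier G" "g' v i \<in> carrier G" if "v \<in> V" for v i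
      using plot_pts[OF space_G g(1) that] plot_pts[OF space_G g(2) that] by auto
    have "plot real_dspace n V (\<lambda>u. r (p u))"
      by (rule plot_restrict[OF diffeological_space_real smoothD[OF r p] V(1,3)])
    then have w: "smooth_fun_on n V (\<lambda>u. smoothstep 0 1 (r (p u)))"
      by (intro smooth_fun_on_smoothstep[OF V(1)]) (simp_all add: real_dspace_def)
    have w': "smooth_fun_on n V (\<lambda>u. 1 - smoothstep 0 1 (r (p u)))"
      using smooth_fun_on_add[OF V(1) smooth_fun_on_const[OF V(1), of 1]
          smooth_fun_on_mult[OF V(1) smooth_fun_on_const[OF V(1), of "-1"] w]] by simp
    have "plot (EG G) n V (\<lambda>v. pt (join_wt \<alpha> \<beta> (t v) (t' v) (r (p v))) (join_el \<alpha> \<beta> (g v) (g' v)))"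
    proof (rule EG_plot_of_lift)
      show "plot Delta_omega n V (\<lambda>v. join_wt \<alpha> \<beta> (t v) (t' v) (r (p v)))"
      proof (rule Delta_plotI[OF V(1)])
        show "join_wt \<alpha> \<beta> (t v) (t' v) (r (p v)) \<in> pts Delta_omega" if "v \<in> V" for v
          by (rule join_wt_Delta[OF \<alpha>(1,2) Delta_plot_pts[OF t(1) that] Delta_plot_pts[OF t(2) that]])
        show "smooth_fun_on n V (\<lambda>v. join_wt \<alpha> \<beta> (t v) (t' v) (r (p v)) i)" for i
          unfolding join_wt_def
          by (intro smooth_fun_on_add smooth_fun_on_mult smooth_fun_on_spread w w' V(1)
              Delta_plot_smooth[OF t(1)] Delta_plot_smooth[OF t(2)])
        fix v assume v: "v \<in> V"
        from Delta_plotE[OF t(1) v] obtain W N where W: "eopen n W" "v \<in> W" "W \<subseteq> V"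
          "\<And>i v. i > N \<Longrightarrow> v \<in> W \<Longrightarrow> t v i = 0" by metis
        from Delta_plotE[OF t(2) v] obtain W' N' where W': "eopen n W'" "v \<in> W'" "W' \<subseteq> V"
          "\<And>i v. i > N' \<Longrightarrow> v \<in> W' \<Longrightarrow> t' v i = 0" by metis
        let ?S = "\<alpha> ` {..N} \<union> \<beta> ` {..N'}"
        have "join_wt \<alpha> \<beta> (t w) (t' w) s i = 0" if "w \<in> W \<inter> W'" "i \<notin> ?S" for w i s
        proof -
          have "spread \<alpha> (\<lambda>i. (1 - smoothstep 0 1 s) * t w i) i = 0"
            using that W(4) by (intro spread_zero[OF \<alpha>(1), of _ "{..N}"]) auto
          moreover have "spread \<beta> (\<lambda>i. smoothstep 0 1 s * t' w i) i = 0"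
            using that W'(4) by (intro spread_zero[OF \<alpha>(2), of _ "{..N'}"]) auto
          ultimately show ?thesis by (simp add: join_wt_def)
        qed
        then show "\<exists>W S. eopen n W \<and> v \<in> W \<and> finite S \<and> (\<forall>w\<in>W \<inter> V. \<forall>i. i \<notin> S \<longrightarrow> join_wt \<alpha> \<beta> (t w) (t' w) (r (p w)) i = 0)"
          using W(1,2) W'(1,2) by (intro exI[of _ "W \<inter> W'"] exI[of _ ?S]) auto
      qed
      show "plot (space_of G) n V (\<lambda>v. join_el \<alpha> \<beta> (g v) (g' v) i)" for i
        using g by (cases "i \<in> range \<alpha>"; cases "i \<in> range \<beta>") (simp_all add: join_el_def)
    qed
    moreover have "join \<alpha> \<beta> (f (p v)) (k (p v)) (r (p v)) = pt (join_wt \<alpha> \<beta> (t v) (t' v) (r (p v))) (join_el \<alpha> \<beta> (g v) (g' v))"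
      if v: "v \<in> V" for v
    proof -
      have "join \<alpha> \<beta> (pt (t v) (g v)) (pt (t' v) (g' v)) (r (p v)) =
          pt (join_wt \<alpha> \<beta> (t v) (t' v) (r (p v))) (join_el \<alpha> \<beta> (g v) (g' v))"
        by (rule join_pt[OF \<alpha> Delta_plot_pts[OF t(1) v] _ Delta_plot_pts[OF t(2) v]]) (rule gc[OF v])+
      moreover have "f (p v) = pt (t v) (g v)" "k (p v) = pt (t' v) (g' v)"
        using V1(6) V2(6) V(4,5) v by blast+
      ultimately show ?thesis by simp
    qed
    ultimately show "\<exists>V q. eopen n V \<and> u \<in> V \<and> plot (EG G) n V q \<and>
        (\<forall>v\<in>V \<inter> U. join \<alpha> \<beta> (f (p v)) (k (p v)) (r (p v)) = q v)"
      using V(1,2) by (intro exI[of _ V]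
          exI[of _ "\<lambda>v. pt (join_wt \<alpha> \<beta> (t v) (t' v) (r (p v))) (join_el \<alpha> \<beta> (g v) (g' v))"]) auto
  qed
qed

lemma mv_act:
  assumes \<alpha>: "inj \<alpha>" "\<And>i. i < \<alpha> i" and "x \<in> pts (EG G)" and a: "a \<in> carrier G"
  shows "mv \<alpha> (EG_act G x a, s) = EG_act G (mv \<alpha> (x, s)) a"
proof -
  obtain t g where x: "t \<in> pts Delta_omega" "\<And>i. g i \<in> carrier G" "x = pt t g"
    using EG_cases[OF assms(3)] by metis
  have "mv_el \<alpha> g s i \<in> carrier G" for i using x(2) by (simp add: mv_el_def)
  moreover have "mv_el \<alpha> (\<lambda>i. g i \<otimes> a) s = (\<lambda>i. mv_el \<alpha> g s i \<otimes> a)" by (auto simp: mv_el_def)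
  ultimately show ?thesis
    using x a \<alpha> by (simp add: EG_act_pt mv_pt mv_wt_Delta)
qed

lemma join_act:
  assumes \<alpha>: "inj \<alpha>" "inj \<beta>" "range \<alpha> \<inter> range \<beta> = {}" and "x \<in> pts (EG G)" "y \<in> pts (EG G)" and a: "a \<in> carrier G"
  shows "join \<alpha> \<beta> (EG_act G x a) (EG_act G y a) s = EG_act G (join \<alpha> \<beta> x y s) a"
proof -
  obtain t g where x: "t \<in> pts Delta_omega" "\<And>i. g i \<in> carrier G" "x = pt t g"
    using EG_cases[OF assms(4)] by metis
  obtain t' g' where y: "t' \<in> pts Delta_omega" "\<And>i. g' i \<in> carrier G" "y = pt t' g'"
    using EG_cases[OF assms(5)] by metis
  have "join_el \<alpha> \<beta> g g' i \<in> carrier G" for i using x(2) y(2) by (simp add: join_el_def)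
  moreover have "join_el \<alpha> \<beta> (\<lambda>i. g i \<otimes> a) (\<lambda>i. g' i \<otimes> a) = (\<lambda>i. join_el \<alpha> \<beta> g g' i \<otimes> a)" by (auto simp: join_el_def)
  ultimately show ?thesis
    using x y a \<alpha> by (simp add: EG_act_pt join_pt join_wt_Delta)
qed

text \<open>All windows close before time 1, so every coordinate has arrived.\<close>

lemma mv_at_1:
  assumes "x \<in> pts (EG G)"
  shows "mv \<alpha> (x, 1) = x"
proof -
  have l: "lam i 1 = 1" for i using win_less(4)[of i] by (simp add: lam_1)
  have "mv_wt \<alpha> (wt x) 1 = wt x" by (auto simp: mv_wt_def l spread_def)
  moreover have "\<not> 1 \<le> win_lo i" for i using win_less(1,4)[of i] by linarith
  then have "mv_el \<alpha> (el x) 1 = el x" by (auto simp: mv_el_def)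
  ultimately show ?thesis using pt_rep(3)[OF assms] by (simp add: mv_def)
qed

lemma mv_wt_0: "mv_wt \<alpha> t 0 m = spread \<alpha> t m"
  using lam_0[of 0] win_less(3) by (simp add: mv_wt_def spread_def)

text \<open>Both sides place \<open>x\<close> at the positions \<open>\<alpha> i\<close>. Their
  group coordinates may differ off the range of \<alpha>, where the weight is 0. With
  \<open>join_at_1\<close> this matches the ends of the homotopies to be concatenated.\<close>

lemma join_at_0:
  assumes \<alpha>: "inj \<alpha>" "inj \<beta>" and x: "x \<in> pts (EG G)" "y \<in> pts (EG G)"
  shows "join \<alpha> \<beta> x y 0 = mv \<alpha> (x, 0)"
  unfolding join_def mv_def
proof (rule pt_cong)
  show "join_wt \<alpha> \<beta> (wt x) (wt y) 0 i = mv_wt \<alpha> (wt (fst (x, 0))) (snd (x, 0)) i" for i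
    by (simp add: mv_wt_0) (simp add: join_wt_def smoothstep_0 spread_def)
  then show "join_el \<alpha> \<beta> (el x) (el y) i = mv_el \<alpha> (el (fst (x, 0))) (snd (x, 0)) i"
    if "join_wt \<alpha> \<beta> (wt x) (wt y) 0 i \<noteq> 0" for i
    using that win_less(3)[of i] by (auto simp: mv_wt_0 spread_def join_el_def mv_el_def split: if_splits)
qed (use pt_rep[OF x(1)] pt_rep[OF x(2)] \<alpha> in \<open>auto simp: join_el_def mv_el_def intro: join_wt_Delta\<close>)

lemma join_at_1:
  assumes \<alpha>: "inj \<alpha>" "inj \<beta>" "range \<alpha> \<inter> range \<beta> = {}" and x: "x \<in> pts (EG G)" "y \<in> pts (EG G)"
  shows "join \<alpha> \<beta> x y 1 = mv \<beta> (y, 0)"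
  unfolding join_def mv_def
proof (rule pt_cong)
  show "join_wt \<alpha> \<beta> (wt x) (wt y) 1 i = mv_wt \<beta> (wt (fst (y, 0))) (snd (y, 0)) i" for i
    by (simp add: mv_wt_0) (simp add: join_wt_def smoothstep_1 spread_def)
  then show "join_el \<alpha> \<beta> (el x) (el y) i = mv_el \<beta> (el (fst (y, 0))) (snd (y, 0)) i"
    if "join_wt \<alpha> \<beta> (wt x) (wt y) 1 i \<noteq> 0" for i
    using that win_less(3)[of i] \<alpha>(3) by (auto simp: mv_wt_0 spread_def join_el_def mv_el_def split: if_splits)
qed (use pt_rep[OF x(1)] pt_rep[OF x(2)] \<alpha> in \<open>auto simp: join_el_def mv_el_def intro: join_wt_Delta\<close>)

section \<open>Homotopies of self-maps of BG\<close>

lemma descend_homotopy: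
  assumes K: "smooth (prod_dspace (EG G) real_dspace) (EG G) K"
    and eq: "\<And>x a s. x \<in> pts (EG G) \<Longrightarrow> a \<in> carrier G \<Longrightarrow> K (EG_act G x a, s) = EG_act G (K (x, s)) a"
  obtains F where "smooth (prod_dspace (BG G) real_dspace) (BG G) F"
    "\<And>x s. x \<in> pts (EG G) \<Longrightarrow> F (prj EGB x, s) = prj EGB (K (x, s))"
proof -
  let ?E = "prod_dspace (EG G) real_dspace" and ?B = "prod_dspace (BG G) real_dspace"
  have B: "diffeological_space ?B" and E: "diffeological_space ?E"
    by (intro diffeological_space_prod diffeological_space_BG diffeological_space_EG diffeological_space_real)+
  have F: "smooth ?E (BG G) (\<lambda>z. prj EGB (K z))"
    by (rule smooth_compose[OF K subduction_smooth[OF subduction_EGB]])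
  obtain F where F: "smooth ?B (BG G) F"
    "\<And>z. z \<in> pts ?E \<Longrightarrow> F (case z of (x, s) \<Rightarrow> (prj EGB x, s)) = prj EGB (K z)"
  proof (rule subduction_descend[OF B E diffeological_space_BG
        subduction_times_real[OF diffeological_space_BG subduction_EGB] F])
    fix z z' assume z: "z \<in> pts ?E" "z' \<in> pts ?E"
      and e: "(case z of (x, s) \<Rightarrow> (prj EGB x, s)) = (case z' of (x, s) \<Rightarrow> (prj EGB x, s))"
    obtain x s x' s' where zs: "z = (x, s)" "z' = (x', s')" "x \<in> pts (EG G)" "x' \<in> pts (EG G)" using z by auto
    then obtain a where a: "s' = s" "a \<in> carrier G" "x' = EG_act G x a"
      using e EGB_prj_eq_iff[of x x'] by auto
    have "K (x, s) \<in> pts (EG G)" using smooth_pts[OF K] zs by auto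
    then show "prj EGB (K z) = prj EGB (K z')" using zs a by (simp add: eq EGB_prj_act)
  qed blast
  show ?thesis using F(2) by (intro that[OF F(1)]) force
qed

lemma homotopic_of_equivariant:
  assumes K: "smooth (prod_dspace (EG G) real_dspace) (EG G) K"
    and eq: "\<And>x a s. x \<in> pts (EG G) \<Longrightarrow> a \<in> carrier G \<Longrightarrow> K (EG_act G x a, s) = EG_act G (K (x, s)) a"
    and "\<And>x. x \<in> pts (EG G) \<Longrightarrow> prj EGB (K (x, 0)) = f (prj EGB x)"
    and "\<And>x. x \<in> pts (EG G) \<Longrightarrow> prj EGB (K (x, 1)) = k (prj EGB x)"
  shows "smoothly_homotopic (BG G) (BG G) f k"
proof -
  obtain F where F: "smooth (prod_dspace (BG G) real_dspace) (BG G) F"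
    "\<And>x s. x \<in> pts (EG G) \<Longrightarrow> F (prj EGB x, s) = prj EGB (K (x, s))"
    using descend_homotopy[OF K eq] by metis
  have "F (b, 0) = f b \<and> F (b, 1) = k b" if b: "b \<in> pts (BG G)" for b
  proof -
    obtain x where "x \<in> pts (EG G)" "prj EGB x = b"
      using subduction_surj[OF diffeological_space_BG diffeological_space_EG subduction_EGB b] by metis
    then show ?thesis using F(2) assms(3,4) by metis
  qed
  then show ?thesis unfolding smoothly_homotopic_def using F(1) by blast
qed

text \<open>Three homotopies: \<open>H x\<close> is moved out to the odd positions
  (\<open>mv \<alpha>\<close> run backwards), exchanged linearly for a copy of \<open>x\<close> on
  even positions, and this copy is moved back by \<open>mv \<beta>\<close>. Each is equivariant and
  descends to \<open>BG\<close>.\<close>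

theorem equivariant_self_map_homotopic_id:
  assumes H: "smooth (EG G) (EG G) H"
    and eq: "\<And>x a. x \<in> pts (EG G) \<Longrightarrow> a \<in> carrier G \<Longrightarrow> H (EG_act G x a) = EG_act G (H x) a"
    and h: "\<And>x. x \<in> pts (EG G) \<Longrightarrow> prj EGB (H x) = h (prj EGB x)"
  shows "smoothly_homotopic (BG G) (BG G) h (\<lambda>b. b)"
proof -
  \<comment> \<open>Odd and even targets make the ranges disjoint; the offsets 1 and 2 make
    \<open>i < \<alpha> i\<close> and \<open>i < \<beta> i\<close> hold also for
    \<open>i = 0\<close>.\<close>
  define \<alpha> where "\<alpha> i = 2 * i + 1" for i :: nat
  define \<beta> where "\<beta> i = 2 * i + 2" for i :: nat
  have \<alpha>: "inj \<alpha>" "\<And>i. i < \<alpha> i" and \<beta>: "inj \<beta>" "\<And>i. i < \<beta> i"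
    by (auto simp: \<alpha>_def \<beta>_def inj_def)
  have dis: "range \<alpha> \<inter> range \<beta> = {}" by (auto simp: \<alpha>_def \<beta>_def) presburger
  let ?E = "prod_dspace (EG G) real_dspace"
  have Hp: "H x \<in> pts (EG G)" if "x \<in> pts (EG G)" for x using smooth_pts[OF H that] .
  define K1 where "K1 z = mv \<alpha> (H (fst z), snd z)" for z
  define K2 where "K2 z = join \<alpha> \<beta> (H (fst z)) (fst z) (snd z)" for z
  have Hf: "smooth ?E (EG G) (\<lambda>z. H (fst z))" by (rule smooth_compose[OF smooth_fst H])
  have K1: "smooth ?E (EG G) K1" unfolding K1_def
    by (rule smooth_compose[OF smooth_Pair[OF Hf smooth_snd] smooth_mv[OF \<alpha>]])
  have K1e: "K1 (EG_act G x a, s) = EG_act G (K1 (x, s)) a" if "x \<in> pts (EG G)" "a \<in> carrier G" for x a s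
    using that Hp \<alpha> by (simp add: K1_def eq mv_act)
  have K2: "smooth ?E (EG G) K2" unfolding K2_def
    by (rule smooth_join[OF \<alpha>(1) \<beta>(1) dis Hf smooth_fst smooth_snd])
  have K2e: "K2 (EG_act G x a, s) = EG_act G (K2 (x, s)) a" if "x \<in> pts (EG G)" "a \<in> carrier G" for x a s
    using that Hp \<alpha> \<beta> dis by (simp add: K2_def eq join_act)
  \<comment> \<open>The values of \<open>F1\<close> and \<open>F3\<close> at time 0 serve as the two
    intermediate self-maps of \<open>BG\<close>.\<close>
  obtain F1 where F1: "\<And>x s. x \<in> pts (EG G) \<Longrightarrow> F1 (prj EGB x, s) = prj EGB (K1 (x, s))"
    using descend_homotopy[OF K1 K1e] by metis
  obtain F3 where F3: "\<And>x s. x \<in> pts (EG G) \<Longrightarrow> F3 (prj EGB x, s) = prj EGB (mv \<beta> (x, s))"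
    using descend_homotopy[OF smooth_mv[OF \<beta>] mv_act[OF \<beta>]] by metis
  let ?f = "\<lambda>b. F1 (b, 0)" and ?k = "\<lambda>b. F3 (b, 0)"
  have 1: "smoothly_homotopic (BG G) (BG G) ?f h"
    by (rule homotopic_of_equivariant[OF K1 K1e]) (use F1 Hp h in \<open>simp_all add: K1_def mv_at_1\<close>)
  have 2: "smoothly_homotopic (BG G) (BG G) ?f ?k"
    by (rule homotopic_of_equivariant[OF K2 K2e])
      (use F1 F3 Hp \<alpha> \<beta> dis in \<open>simp_all add: K1_def K2_def join_at_0 join_at_1\<close>)
  have 3: "smoothly_homotopic (BG G) (BG G) ?k (\<lambda>b. b)"
    by (rule homotopic_of_equivariant[OF smooth_mv[OF \<beta>] mv_act[OF \<beta>]])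
      (use F3 in \<open>simp_all add: mv_at_1\<close>)
  note B = diffeological_space_BG
  show ?thesis
    by (rule smoothly_homotopic_trans[OF B B smoothly_homotopic_sym[OF B 1] smoothly_homotopic_trans[OF B B 2 3]])
qed

end

section \<open>Isomorphism classes\<close>

text \<open>An equivariant map covering \<open>g\<close> is automatically an isomorphism onto the
  pullback: freeness in \<open>P\<close> gives injectivity on fibres, transitivity gives
  surjectivity. Charts of \<open>P\<close> are used again to see that the inverse is smooth.\<close>

lemma (in charted) pullback_isomorphic:
  assumes P': "Gtorsor G C P'" and g: "smooth C B g" and \<Psi>: "smooth (tot P') (tot P) \<Psi>"
    and eq: "\<And>x a. x \<in> pts (tot P') \<Longrightarrow> a \<in> carrier G \<Longrightarrow> \<Psi> (act P' x a) = act P (\<Psi> x) a"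
    and cov: "\<And>x. x \<in> pts (tot P') \<Longrightarrow> prj P (\<Psi> x) = g (prj P' x)"
  shows "bundle_isomorphic G P' (pullback_bundle g C P)"
proof -
  interpret P': Gtorsor G C P' by (rule P')
  let ?R = "pullback_bundle g C P"
  let ?T = "sub_dspace (prod_dspace C (tot P)) {p. g (fst p) = prj P (snd p)}"
  have R: "tot ?R = ?T" "prj ?R = fst" "act ?R = (\<lambda>p a. (fst p, act P (snd p) a))"
    by (simp_all add: pullback_bundle_def case_prod_unfold)
  have T: "diffeological_space ?T"
    by (intro diffeological_space_sub diffeological_space_prod P'.base total)
  have \<Psi>p: "\<Psi> x \<in> pts (tot P)" if "x \<in> pts (tot P')" for x using smooth_pts[OF \<Psi> that] .
  have uniq: "x = y" if xy: "x \<in> pts (tot P')" "y \<in> pts (tot P')" "prj P' x = prj P' y" "\<Psi> x = \<Psi> y" for x y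
  proof -
    obtain a where a: "a \<in> carrier G" "y = act P' x a" using P'.transitive[OF xy(1-3)] by blast
    then have "act P (\<Psi> x) a = act P (\<Psi> x) \<one>" using xy(4) eq[OF xy(1) a(1)] act_one[OF \<Psi>p[OF xy(1)]] by simp
    then have "a = \<one>" using act_free[OF \<Psi>p[OF xy(1)] a(1) one_closed] by blast
    then show ?thesis using a P'.act_one xy(1) by simp
  qed
  define \<theta> where "\<theta> z = (SOME x. x \<in> pts (tot P') \<and> prj P' x = fst z \<and> \<Psi> x = snd z)" for z
  have \<theta>_eq: "\<theta> (prj P' x, \<Psi> x) = x" if x: "x \<in> pts (tot P')" for x
  proof -
    have "\<exists>y. y \<in> pts (tot P') \<and> prj P' y = fst (prj P' x, \<Psi> x) \<and> \<Psi> y = snd (prj P' x, \<Psi> x)" using x by auto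
    from someI_ex[OF this] show ?thesis unfolding \<theta>_def using uniq x by simp
  qed
  have ex: "\<exists>x\<in>pts (tot P'). z = (prj P' x, \<Psi> x)" if z: "z \<in> pts ?T" for z
  proof -
    obtain x0 where x0: "x0 \<in> pts (tot P')" "prj P' x0 = fst z" using P'.surj[of "fst z"] z by auto
    then obtain a where a: "a \<in> carrier G" "snd z = act P (\<Psi> x0) a"
      using transitive[of "\<Psi> x0" "snd z"] cov \<Psi>p z by auto
    show ?thesis
      using x0 a eq P'.act_pts P'.prj_act by (intro bexI[of _ "act P' x0 a"]) (auto simp: prod_eq_iff)
  qed
  have \<theta>s: "smooth ?T (tot P') \<theta>"
  proof (rule smoothI)
    show "\<theta> z \<in> pts (tot P')" if "z \<in> pts ?T" for z using ex[OF that] \<theta>_eq by auto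
    fix n U p assume p: "plot ?T n U p"
    have p1: "plot C n U (\<lambda>u. fst (p u))" and p2: "plot (tot P) n U (\<lambda>u. snd (p u))"
      using p by (auto simp: sub_dspace_def prod_dspace_def comp_def)
    have pT: "p u \<in> pts ?T" if "u \<in> U" for u using plot_pts[OF T p that] .
    show "plot (tot P') n U (\<lambda>u. \<theta> (p u))"
    proof (rule plot_locally_eq[OF P'.total])
      show "eopen n U" using plot_domain[OF T p] .
      fix u assume u: "u \<in> U"
      from subductionE[OF P'.subd p1 u] obtain V \<sigma> where V: "eopen n V" "u \<in> V" "V \<subseteq> U" "plot (tot P') n V \<sigma>"
        "\<And>v. v \<in> V \<Longrightarrow> prj P' (\<sigma> v) = fst (p v)" by metis
      have "fst (p u) \<in> pts C" using pT[OF u] by auto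
      then have "g (fst (p u)) \<in> pts B" by (rule smooth_pts[OF g])
      then obtain k where k: "f k (g (fst (p u))) > 0" using f_pos by blast
      have q: "plot B n V (\<lambda>v. g (fst (p v)))"
        by (rule plot_restrict[OF base smoothD[OF g p1] V(1,3)])
      let ?W = "{v\<in>V. g (fst (p v)) \<in> cdom k}"
      have W: "eopen n ?W" using D_open_plot[OF D_open_cdom q] .
      have WU: "?W \<subseteq> U" using V(3) by blast
      have \<sigma>: "plot (tot P') n ?W \<sigma>" using plot_restrict[OF P'.total V(4) W] by blast
      have \<sigma>p: "\<sigma> v \<in> pts (tot P')" if "v \<in> ?W" for v using plot_pts[OF P'.total \<sigma> that] .
      have fk: "f k (g (fst (p v))) > 0" if "v \<in> ?W" for v using that by (simp add: cdom_def)
      let ?S = "sub_dspace (tot P) {x. f k (prj P x) > 0}"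
      have s1: "plot ?S n ?W (\<lambda>v. \<Psi> (\<sigma> v))"
        using smoothD[OF \<Psi> \<sigma>] cov \<sigma>p V(5) fk by (auto simp: sub_dspace_def)
      have p2W: "plot (tot P) n ?W (\<lambda>v. snd (p v))" by (rule plot_restrict[OF total p2 W WU])
      have "prj P (snd (p v)) = g (fst (p v))" if "v \<in> ?W" for v using pT[of v] that WU by auto
      then have s2: "plot ?S n ?W (\<lambda>v. snd (p v))"
        using p2W fk by (simp add: sub_dspace_def Pi_iff)
      \<comment> \<open>The group element that carries the lift \<open>\<sigma> v\<close> to the
        wanted preimage of \<open>p v\<close>, read off after applying \<Psi> in the chart
        \<open>k\<close>; there it is a quotient of two smooth chart values.\<close>
      define \<delta> where "\<delta> v = inv (\<gamma> k (\<Psi> (\<sigma> v))) \<otimes> \<gamma> k (snd (p v))" for v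
      have "plot (space_of G) n ?W \<delta>" unfolding \<delta>_def
        by (intro gplot_mult gplot_inv smoothD[OF \<gamma>_smooth s1] smoothD[OF \<gamma>_smooth s2])
      then have pl: "plot (tot P') n ?W (\<lambda>v. act P' (\<sigma> v) (\<delta> v))" using P'.act_plot[OF \<sigma>] by blast
      have "\<theta> (p v) = act P' (\<sigma> v) (\<delta> v)" if v: "v \<in> ?W" for v
      proof -
        have pv: "p v \<in> pts ?T" using pT v WU by blast
        obtain x where x: "x \<in> pts (tot P')" "p v = (prj P' x, \<Psi> x)" using ex[OF pv] by blast
        obtain a where a: "a \<in> carrier G" "x = act P' (\<sigma> v) a"
          using P'.transitive[OF \<sigma>p[OF v] x(1)] V(5)[of v] v x(2) by auto
        have f0: "f k (prj P (\<Psi> (\<sigma> v))) > 0" using cov[OF \<sigma>p[OF v]] V(5)[of v] v fk[OF v] by simp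
        have "\<gamma> k (snd (p v)) = \<gamma> k (\<Psi> (\<sigma> v)) \<otimes> a"
          using x(2) a eq[OF \<sigma>p[OF v] a(1)] \<gamma>_equiv[OF \<Psi>p[OF \<sigma>p[OF v]] f0 a(1)] by simp
        then have "\<delta> v = a"
          using \<gamma>_carrier[OF \<Psi>p[OF \<sigma>p[OF v]] f0] a(1) by (simp add: \<delta>_def m_assoc[symmetric])
        then show ?thesis using x \<theta>_eq[OF x(1)] a(2) by simp
      qed
      then show "\<exists>V q. eopen n V \<and> u \<in> V \<and> plot (tot P') n V q \<and> (\<forall>v\<in>V \<inter> U. \<theta> (p v) = q v)"
        using W V(2) k pl \<open>g (fst (p u)) \<in> pts B\<close>
        by (intro exI[of _ ?W] exI[of _ "\<lambda>v. act P' (\<sigma> v) (\<delta> v)"]) (auto simp: cdom_def)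
    qed
  qed
  let ?\<phi> = "\<lambda>x. (prj P' x, \<Psi> x)"
  have "smooth (tot P') ?T ?\<phi>"
    by (intro smooth_into_sub P'.total smooth_Pair P'.prj_smooth \<Psi>) (simp add: cov)
  moreover have "?\<phi> (\<theta> z) = z" if "z \<in> pts ?T" for z using ex[OF that] \<theta>_eq by auto
  ultimately have "diffeomorphism (tot P') ?T ?\<phi>"
    unfolding diffeomorphism_def using \<theta>s \<theta>_eq by blast
  then show ?thesis
    unfolding bundle_isomorphic_def R using eq P'.prj_act by (intro exI[of _ ?\<phi>]) auto
qed

lemma bundle_isomorphic_refl: "bundle_isomorphic G P P"
  unfolding bundle_isomorphic_def diffeomorphism_def
  by (intro exI[of _ "\<lambda>x. x"] conjI smooth_id) auto

lemma bundle_isomorphic_trans: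
  assumes "bundle_isomorphic G P Q" "bundle_isomorphic G Q R"
  shows "bundle_isomorphic G P R"
proof -
  obtain \<phi> \<phi>' where \<phi>: "smooth (tot P) (tot Q) \<phi>" "smooth (tot Q) (tot P) \<phi>'"
    "\<And>x. x \<in> pts (tot P) \<Longrightarrow> \<phi>' (\<phi> x) = x" "\<And>y. y \<in> pts (tot Q) \<Longrightarrow> \<phi> (\<phi>' y) = y"
    "\<And>x. x \<in> pts (tot P) \<Longrightarrow> prj Q (\<phi> x) = prj P x"
    "\<And>x g. x \<in> pts (tot P) \<Longrightarrow> g \<in> carrier G \<Longrightarrow> \<phi> (act P x g) = act Q (\<phi> x) g"
    using assms(1) by (auto simp: bundle_isomorphic_def diffeomorphism_def)
  obtain \<psi> \<psi>' where \<psi>: "smooth (tot Q) (tot R) \<psi>" "smooth (tot R) (tot Q) \<psi>'"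
    "\<And>x. x \<in> pts (tot Q) \<Longrightarrow> \<psi>' (\<psi> x) = x" "\<And>y. y \<in> pts (tot R) \<Longrightarrow> \<psi> (\<psi>' y) = y"
    "\<And>x. x \<in> pts (tot Q) \<Longrightarrow> prj R (\<psi> x) = prj Q x"
    "\<And>x g. x \<in> pts (tot Q) \<Longrightarrow> g \<in> carrier G \<Longrightarrow> \<psi> (act Q x g) = act R (\<psi> x) g"
    using assms(2) by (auto simp: bundle_isomorphic_def diffeomorphism_def)
  show ?thesis
    unfolding bundle_isomorphic_def diffeomorphism_def
  proof (intro exI[of _ "\<lambda>x. \<psi> (\<phi> x)"] exI[of _ "\<lambda>x. \<phi>' (\<psi>' x)"] conjI ballI)
    show "smooth (tot P) (tot R) (\<lambda>x. \<psi> (\<phi> x))" by (rule smooth_compose[OF \<phi>(1) \<psi>(1)])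
    show "smooth (tot R) (tot P) (\<lambda>x. \<phi>' (\<psi>' x))" by (rule smooth_compose[OF \<psi>(2) \<phi>(2)])
  qed (use \<phi> \<psi> smooth_pts[OF \<phi>(1)] smooth_pts[OF \<psi>(2)] in auto)
qed

text \<open>The hypothesis on \<open>P\<close> keeps the action inside \<open>pts (tot P)\<close>,
  where the inverse cancels; this yields equivariance of the inverse.\<close>

lemma bundle_isomorphic_sym:
  assumes "G_space_over G B P" "bundle_isomorphic G P Q"
  shows "bundle_isomorphic G Q P"
proof -
  obtain \<phi> \<phi>' where \<phi>: "smooth (tot P) (tot Q) \<phi>" "smooth (tot Q) (tot P) \<phi>'"
    "\<And>x. x \<in> pts (tot P) \<Longrightarrow> \<phi>' (\<phi> x) = x" "\<And>y. y \<in> pts (tot Q) \<Longrightarrow> \<phi> (\<phi>' y) = y"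
    "\<And>x. x \<in> pts (tot P) \<Longrightarrow> prj Q (\<phi> x) = prj P x"
    "\<And>x g. x \<in> pts (tot P) \<Longrightarrow> g \<in> carrier G \<Longrightarrow> \<phi> (act P x g) = act Q (\<phi> x) g"
    using assms(2) by (auto simp: bundle_isomorphic_def diffeomorphism_def)
  have "smooth (prod_dspace (tot P) (space_of G)) (tot P) (\<lambda>(x, g). act P x g)"
    using assms(1) by (simp add: G_space_over_def smooth_right_action_def)
  then have ap: "act P x g \<in> pts (tot P)" if "x \<in> pts (tot P)" "g \<in> carrier G" for x g
    using smooth_pts[of _ _ "\<lambda>(x, g). act P x g" "(x, g)"] that by fastforce
  have \<phi>'p: "\<phi>' y \<in> pts (tot P)" if "y \<in> pts (tot Q)" for y using smooth_pts[OF \<phi>(2) that] .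
  show ?thesis
    unfolding bundle_isomorphic_def diffeomorphism_def
  proof (intro exI[of _ \<phi>'] exI[of _ \<phi>] conjI ballI)
    show "prj P (\<phi>' y) = prj Q y" if "y \<in> pts (tot Q)" for y
      using \<phi>(5)[OF \<phi>'p[OF that]] \<phi>(4)[OF that] by simp
    show "\<phi>' (act Q y g) = act P (\<phi>' y) g" if "y \<in> pts (tot Q)" "g \<in> carrier G" for y g
      using \<phi>(6)[OF \<phi>'p[OF that(1)] that(2)] \<phi>(4)[OF that(1)] \<phi>(3)[OF ap[OF \<phi>'p[OF that(1)] that(2)]] by simp
  qed (use \<phi> in auto)
qed

lemma equiv_bundle_rel: "equiv {P. D_numerable G B P} (bundle_rel G B)"
proof (rule equivI)
  show "sym (bundle_rel G B)"
    by (auto simp: sym_def bundle_rel_def D_numerable_def principal_bundle_def intro: bundle_isomorphic_sym)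
  show "trans (bundle_rel G B)"
    by (auto simp: trans_def bundle_rel_def intro: bundle_isomorphic_trans)
qed (auto simp: bundle_rel_def refl_on_def bundle_isomorphic_refl)

section \<open>Copies of spaces along injections\<close>

definition image_dspace :: "('a \<Rightarrow> 'b) \<Rightarrow> 'a dspace \<Rightarrow> 'b dspace" where
  "image_dspace j X = \<lparr>pts = j ` pts X,
     plot = (\<lambda>n U p. p \<in> U \<rightarrow> j ` pts X \<and> plot X n U (\<lambda>u. the_inv_into (pts X) j (p u)))\<rparr>"

lemma pts_image_dspace [simp]: "pts (image_dspace j X) = j ` pts X"
  by (simp add: image_dspace_def)

lemma smooth_image_dspace:
  assumes X: "diffeological_space X" and j: "inj_on j (pts X)"
  shows "diffeological_space (image_dspace j X)" "smooth X (image_dspace j X) j"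
    "smooth (image_dspace j X) X (the_inv_into (pts X) j)"
proof -
  interpret diffeological_space X by (rule X)
  have inv: "the_inv_into (pts X) j (j x) = x" if "x \<in> pts X" for x
    using the_inv_into_f_f[OF j that] .
  show "diffeological_space (image_dspace j X)"
  proof
    fix n U p q assume p: "plot (image_dspace j X) n U p" and q: "\<And>u. u \<in> U \<Longrightarrow> q u = p u"
    have "plot X n U (\<lambda>u. the_inv_into (pts X) j (q u))"
      by (rule plot_cong[of n U "\<lambda>u. the_inv_into (pts X) j (p u)"]) (use p q in \<open>auto simp: image_dspace_def\<close>)
    then show "plot (image_dspace j X) n U q" using p q by (auto simp: image_dspace_def Pi_iff)
  next
    fix n U p m V f assume p: "plot (image_dspace j X) n U p" and f: "euclid_smooth m V n U f"
    have "plot X m V ((\<lambda>u. the_inv_into (pts X) j (p u)) \<circ> f)"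
      using p f by (intro plot_compose[of n U]) (auto simp: image_dspace_def)
    then show "plot (image_dspace j X) m V (p \<circ> f)"
      using p f by (auto simp: image_dspace_def euclid_smooth_def comp_def Pi_iff)
  next
    fix n U p assume U: "eopen n U"
      "\<And>u. u \<in> U \<Longrightarrow> \<exists>V. eopen n V \<and> u \<in> V \<and> V \<subseteq> U \<and> plot (image_dspace j X) n V p"
    have "plot X n U (\<lambda>u. the_inv_into (pts X) j (p u))"
      by (rule plot_local[OF U(1)]) (use U(2) in \<open>fastforce simp: image_dspace_def\<close>)
    moreover have "p \<in> U \<rightarrow> j ` pts X" using U(2) by (fastforce simp: image_dspace_def)
    ultimately show "plot (image_dspace j X) n U p" by (simp add: image_dspace_def)
  qed (auto simp: image_dspace_def inv plot_const dest: plot_domain)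
  show "smooth X (image_dspace j X) j"
  proof (rule smoothI)
    fix n U p assume p: "plot X n U p"
    have "plot X n U (\<lambda>u. the_inv_into (pts X) j (j (p u)))"
      by (rule plot_cong[OF p]) (use plot_pts[OF p] inv in auto)
    then show "plot (image_dspace j X) n U (\<lambda>u. j (p u))"
      using plot_pts[OF p] by (auto simp: image_dspace_def)
  qed simp
  show "smooth (image_dspace j X) X (the_inv_into (pts X) j)"
    by (rule smoothI) (auto simp: image_dspace_def inv)
qed

definition image_bundle :: "('e \<Rightarrow> 'u) \<Rightarrow> ('b \<Rightarrow> 'v) \<Rightarrow> ('e, 'b, 'g) gbundle \<Rightarrow> ('u, 'v, 'g) gbundle" where
  "image_bundle i j P = \<lparr>tot = image_dspace i (tot P), prj = (\<lambda>x. j (prj P (the_inv_into (pts (tot P)) i x))),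
     act = (\<lambda>x g. i (act P (the_inv_into (pts (tot P)) i x) g))\<rparr>"

text \<open>Transport of structure. Copying the charts spares copying trivialisations and partitions
  of unity: D-numerability of the copy follows from its charts.\<close>

lemma (in charted) charted_image:
  assumes i: "inj_on i (pts (tot P))" and j: "inj_on j (pts B)"
  shows "charted G (image_dspace j B) (image_bundle i j P) (\<lambda>k b. f k (the_inv_into (pts B) j b))
     (\<lambda>k x. \<gamma> k (the_inv_into (pts (tot P)) i x))"
proof -
  let ?i = "the_inv_into (pts (tot P)) i" and ?j = "the_inv_into (pts B) j"
  let ?E = "image_dspace i (tot P)" and ?B = "image_dspace j B" and ?R = "image_bundle i j P"
  note I = smooth_image_dspace[OF total i] and J = smooth_image_dspace[OF base j]
  have ii: "?i (i x) = x" if "x \<in> pts (tot P)" for x using the_inv_into_f_f[OF i that] .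
  have jj: "?j (j b) = b" if "b \<in> pts B" for b using the_inv_into_f_f[OF j that] .
  have R: "tot ?R = ?E" "prj ?R = (\<lambda>x. j (prj P (?i x)))" "act ?R = (\<lambda>x g. i (act P (?i x) g))"
    by (simp_all add: image_bundle_def)
  have prjs: "smooth ?E ?B (\<lambda>x. j (prj P (?i x)))"
    by (rule smooth_compose[OF smooth_compose[OF I(3) prj_smooth] J(2)])
  show ?thesis
  proof (intro charted.intro Gtorsor.intro Gspace.intro Gspace_axioms.intro Gtorsor_axioms.intro
      charted_axioms.intro dgrp_axioms)
    show "diffeological_space ?B" by (rule J(1))
    show "G_space_over G ?B ?R"
      unfolding G_space_over_def R smooth_right_action_def case_prod_unfold
    proof (intro conjI ballI I(1) prjs)
      show "smooth (prod_dspace ?E (space_of G)) ?E (\<lambda>p. i (act P (?i (fst p)) (snd p)))"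
        by (intro smooth_compose[OF act_smooth I(2)] smooth_compose[OF smooth_fst I(3)] smooth_snd)
    qed (auto simp: ii act_one act_act act_pts prj_act)
    show "subduction (tot ?R) ?B (prj ?R)"
      unfolding subduction_def R
    proof (intro conjI allI impI ballI prjs)
      fix n U p u assume p: "plot ?B n U p" and u: "u \<in> U"
      from subductionE[OF subd smoothD[OF J(3) p] u] obtain V q where V:
        "eopen n V" "u \<in> V" "V \<subseteq> U" "plot (tot P) n V q" "\<And>v. v \<in> V \<Longrightarrow> prj P (q v) = ?j (p v)" by metis
      have "j (prj P (?i (i (q v)))) = p v" if v: "v \<in> V" for v
      proof -
        have "p v \<in> j ` pts B" using plot_pts[OF J(1) p] v V(3) by auto
        then have "j (?j (p v)) = p v" using f_the_inv_into_f[OF j] by blast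
        then show ?thesis using ii[OF plot_pts[OF total V(4) v]] V(5)[OF v] by simp
      qed
      then show "\<exists>V q. eopen n V \<and> u \<in> V \<and> V \<subseteq> U \<and> plot ?E n V q \<and> (\<forall>v\<in>V. j (prj P (?i (q v))) = p v)"
        using V(1-3) smoothD[OF I(2) V(4)] by (intro exI[of _ V] exI[of _ "\<lambda>v. i (q v)"]) auto
    qed
    fix x y assume xy: "x \<in> pts (tot ?R)" "y \<in> pts (tot ?R)" "prj ?R x = prj ?R y"
    then obtain a b where ab: "a \<in> pts (tot P)" "x = i a" "b \<in> pts (tot P)" "y = i b" unfolding R by auto
    then have "prj P a = prj P b" using xy(3) jj prj_pts unfolding R by (metis ii)
    then show "\<exists>g\<in>carrier G. y = act ?R x g" using transitive[OF ab(1,3)] ab ii unfolding R by auto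
  next
    show "smooth ?B real_dspace (\<lambda>b. f k (?j b))" for k by (rule smooth_compose[OF J(3) f_smooth])
    show "0 \<le> f k (?j b)" "\<exists>k. 0 < f k (?j b)" if "b \<in> pts ?B" for b k
      using that f_nonneg f_pos by (auto simp: jj)
    fix k
    have T: "diffeological_space (sub_dspace ?E A)" for A by (rule diffeological_space_sub[OF I(1)])
    have "smooth (sub_dspace ?E {x. 0 < f k (?j (prj ?R x))}) (sub_dspace (tot P) {x. f k (prj P x) > 0}) ?i"
      by (intro smooth_into_sub T smooth_from_sub I(3)) (auto simp: R jj ii prj_pts)
    then show "smooth (sub_dspace (tot ?R) {x. 0 < f k (?j (prj ?R x))}) (space_of G) (\<lambda>x. \<gamma> k (?i x))"
      unfolding R(1) by (rule smooth_compose[OF _ \<gamma>_smooth])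
    show "\<gamma> k (?i (act ?R x g)) = \<gamma> k (?i x) \<otimes> g"
      if "x \<in> pts (tot ?R)" "0 < f k (?j (prj ?R x))" "g \<in> carrier G" for x g
      using that by (auto simp: R ii jj act_pts prj_pts intro!: \<gamma>_equiv)
  qed
qed

section \<open>Cardinality of EG and BG\<close>

fun encode :: "('u \<times> 'u \<Rightarrow> 'u) \<Rightarrow> 'u \<Rightarrow> 'u list \<Rightarrow> 'u" where
  "encode c z [] = z"
| "encode c z (x # xs) = c (x, encode c z xs)"

text \<open>Equal lengths are required because \<open>z\<close> may itself be a value of
  \<open>c\<close>, so lists of different lengths can have the same code.\<close>

lemma encode_inj: "inj c \<Longrightarrow> length xs = length ys \<Longrightarrow> encode c z xs = encode c z ys \<Longrightarrow> xs = ys"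
  by (induction xs ys rule: list_induct2') (auto dest: injD)

text \<open>Only finitely many weights of a point are nonzero, so the point is determined by a
  finite list of reals and group elements. The type \<open>'g\<close> contains the reals, is
  therefore infinite and in bijection with its square, and so admits the pairing \<open>c\<close>
  that codes such lists.\<close>

lemma (in dgrp) EG_injects:
  assumes "\<exists>j :: real \<Rightarrow> 'g. inj j"
  shows "\<exists>i :: ((nat \<Rightarrow> real) \<times> (nat \<Rightarrow> 'g)) set \<Rightarrow> 'g. inj_on i (pts (EG G))"
proof -
  obtain j :: "real \<Rightarrow> 'g" where j: "inj j" using assms by blast
  have "infinite (UNIV :: 'g set)"
    using j finite_imageD[of j UNIV] infinite_UNIV_char_0 finite_subset[of "range j" UNIV] by blast
  then have "(card_of (UNIV \<times> UNIV :: ('g \<times> 'g) set), card_of (UNIV :: 'g set)) \<in> ordLeq"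
    using card_of_Times_same_infinite ordIso_iff_ordLeq by blast
  then obtain c :: "'g \<times> 'g \<Rightarrow> 'g" where c: "inj c"
    unfolding card_of_ordLeq[symmetric] by auto
  define N where "N x = (LEAST n. \<forall>i\<ge>n. wt x i = 0)" for x :: "((nat \<Rightarrow> real) \<times> (nat \<Rightarrow> 'g)) set"
  have N: "wt x i = 0" if x: "x \<in> pts (EG G)" and i: "i \<ge> N x" for x i
  proof -
    obtain S where S: "finite S" "\<forall>i. i \<notin> S \<longrightarrow> wt x i = 0"
      using pt_rep(1)[OF x] by (auto simp: Delta_iff)
    then obtain n where "\<forall>i\<in>S. i < n" by (meson finite_nat_set_iff_bounded)
    then have "\<exists>n. \<forall>i\<ge>n. wt x i = 0" using S(2) by (intro exI[of _ n]) (meson not_le)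
    then have "\<forall>i\<ge>N x. wt x i = 0" unfolding N_def by (rule LeastI_ex)
    then show ?thesis using i by blast
  qed
  define l where "l x = map (\<lambda>i. c (j (wt x i), el x i)) [0..<N x]" for x
  \<comment> \<open>The length \<open>N x\<close> is stored beside the list, as
    \<open>encode\<close> does not reveal it.\<close>
  define code where "code x = c (j (real (N x)), encode c (j 0) (l x))" for x
  have "inj_on code (pts (EG G))"
  proof (rule inj_onI)
    fix x y assume x: "x \<in> pts (EG G)" and y: "y \<in> pts (EG G)" and e: "code x = code y"
    have "j (real (N x)) = j (real (N y)) \<and> encode c (j 0) (l x) = encode c (j 0) (l y)"
      using e injD[OF c] by (auto simp: code_def)
    then have Ne: "N x = N y" and le: "encode c (j 0) (l x) = encode c (j 0) (l y)" using injD[OF j, of "real (N x)" "real (N y)"] by auto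
    have "l x = l y" by (rule encode_inj[OF c _ le]) (simp add: l_def Ne)
    then have "c (j (wt x i), el x i) = c (j (wt y i), el y i)" if "i < N x" for i
      using that by (simp add: l_def Ne)
    then have we: "wt x i = wt y i \<and> el x i = el y i" if "i < N x" for i
      using injD[OF c] injD[OF j] that by blast
    have "pt (wt x) (el x) = pt (wt y) (el y)"
    proof (rule pt_cong)
      show "wt x i = wt y i" for i using we[of i] N[OF x, of i] N[OF y, of i] Ne by (cases "i < N x") auto
      show "el x i = el y i" if "wt x i \<noteq> 0" for i using we[of i] N[OF x, of i] that by (cases "i < N x") auto
    qed (use pt_rep x y in auto)
    then show "x = y" using pt_rep(3) x y by metis
  qed
  then show ?thesis by blast
qed

text \<open>A choice of one point in each orbit embeds \<open>BG\<close> into \<open>EG\<close> as a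
  set.\<close>

lemma (in dgrp) BG_injects:
  fixes i :: "((nat \<Rightarrow> real) \<times> (nat \<Rightarrow> 'g)) set \<Rightarrow> 'u"
  assumes "inj_on i (pts (EG G))"
  shows "\<exists>j :: ((nat \<Rightarrow> real) \<times> (nat \<Rightarrow> 'g)) set set \<Rightarrow> 'u. inj_on j (pts (BG G))"
proof -
  define s where "s b = (SOME x. x \<in> pts (EG G) \<and> prj EGB x = b)" for b
  have s: "s b \<in> pts (EG G) \<and> prj EGB (s b) = b" if b: "b \<in> pts (BG G)" for b
  proof -
    have "\<exists>x. x \<in> pts (EG G) \<and> prj EGB x = b"
      using subduction_surj[OF diffeological_space_BG diffeological_space_EG subduction_EGB b] by metis
    then show ?thesis unfolding s_def by (rule someI_ex)
  qed
  have "inj_on (\<lambda>b. i (s b)) (pts (BG G))"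
    using s assms by (intro inj_onI) (metis inj_on_def)
  then show ?thesis by blast
qed

lemma htpy_rel_refl:
  assumes "smooth X Y f"
  shows "(f, f) \<in> htpy_rel X Y"
proof -
  have "smooth (prod_dspace X real_dspace) Y (\<lambda>z. f (fst z))" by (rule smooth_compose[OF smooth_fst assms])
  then have "smoothly_homotopic X Y f f" unfolding smoothly_homotopic_def by (intro exI conjI) auto
  then show ?thesis using assms by (simp add: htpy_rel_def)
qed

section \<open>Uniqueness of the classifying space\<close>

theorem corollary5p12:
  fixes G :: "'u dgroup"
    and X :: "'u dspace"
    and \<Phi> :: "'u dspace \<Rightarrow> ('u \<Rightarrow> 'u) set \<Rightarrow> ('u, 'u, 'u) gbundle set"
  assumes universe: "\<exists>j :: real \<Rightarrow> 'u. inj j"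
    and G: "diffeological_group G"
    and X: "diffeological_space X"
    and bij: "\<And>B :: 'u dspace. diffeological_space B \<Longrightarrow>
               bij_betw (\<Phi> B) (htpy_classes B X) (Prin G B)"
    and natural: "\<And>(B :: 'u dspace) (B' :: 'u dspace) f h.
               diffeological_space B \<Longrightarrow> diffeological_space B' \<Longrightarrow>
               smooth B' B f \<Longrightarrow> smooth B X h \<Longrightarrow>
               \<Phi> B' (htpy_rel B' X `` {h \<circ> f}) = Prin_map G B' f (\<Phi> B (htpy_rel B X `` {h}))"
  shows "smoothly_homotopy_equivalent X (BG G)"
proof -
  interpret dgrp G by (rule dgrp.intro[OF G])
  obtain i :: "((nat \<Rightarrow> real) \<times> (nat \<Rightarrow> 'u)) set \<Rightarrow> 'u" where i: "inj_on i (pts (EG G))"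
    using EG_injects[OF universe] by blast
  obtain j :: "((nat \<Rightarrow> real) \<times> (nat \<Rightarrow> 'u)) set set \<Rightarrow> 'u" where j: "inj_on j (pts (BG G))"
    using BG_injects[OF i] by blast
  obtain f0 where f0: "charted G (BG G) EGB f0 (\<lambda>k x. el x k)" using charted_EGB by blast
  interpret E: charted G "BG G" EGB f0 "\<lambda>k x. el x k" by (rule f0)
  let ?Y = "image_dspace j (BG G)" and ?EU = "image_bundle i j EGB"
  note I = smooth_image_dspace[OF diffeological_space_EG i] and J = smooth_image_dspace[OF diffeological_space_BG j]
  interpret EU: charted G ?Y ?EU "\<lambda>k b. f0 k (the_inv_into (pts (BG G)) j b)"
    "\<lambda>k x. el (the_inv_into (pts (EG G)) i x) k"
    using E.charted_image[of i j] i j by simp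
  have ii: "the_inv_into (pts (EG G)) i (i x) = x" if "x \<in> pts (EG G)" for x using the_inv_into_f_f[OF i that] .
  have totEU: "tot ?EU = image_dspace i (EG G)" by (simp add: image_bundle_def)
  have actEU: "act ?EU (i x) a = i (EG_act G x a)" and prjEU: "prj ?EU (i x) = j (prj EGB x)" if "x \<in> pts (EG G)" for x a
    using that by (simp_all add: image_bundle_def ii)
  let ?cE = "bundle_rel G ?Y `` {?EU}"
  let ?id = "htpy_rel X X `` {\<lambda>x. x}"
  have EUc: "?EU \<in> ?cE" using EU.D_numerable bundle_isomorphic_refl by (auto simp: bundle_rel_def)
  have "?cE \<in> Prin G ?Y" unfolding Prin_def using EU.D_numerable by (intro quotientI) simp
  \<comment> \<open>Surjectivity of \<Phi> over the copy of \<open>BG\<close>: some \<open>f\<close>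
    corresponds to the universal bundle.\<close>
  then have "?cE \<in> \<Phi> ?Y ` htpy_classes ?Y X" using bij_betw_imp_surj_on[OF bij[OF J(1)]] by simp
  then obtain f where f: "smooth ?Y X f" "\<Phi> ?Y (htpy_rel ?Y X `` {f}) = ?cE"
    unfolding htpy_classes_def by (auto elim!: quotientE)
  have idc: "?id \<in> htpy_classes X X" unfolding htpy_classes_def by (intro quotientI) (simp add: smooth_id)
  then have cP: "\<Phi> X ?id \<in> Prin G X" using bij_betwE[OF bij[OF X]] by blast
  have "\<Phi> ?Y (htpy_rel ?Y X `` {(\<lambda>x. x) \<circ> f}) = Prin_map G ?Y f (\<Phi> X ?id)"
    by (rule natural[OF X J(1) f(1) smooth_id])
  then have "?EU \<in> Prin_map G ?Y f (\<Phi> X ?id)" using f(2) EUc by (simp add: comp_def)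
  \<comment> \<open>\<open>P\<close> represents the class that belongs to the identity of
    \<open>X\<close>, and its pullback along \<open>f\<close> is the universal bundle.\<close>
  then obtain P where P: "P \<in> \<Phi> X ?id" "bundle_isomorphic G ?EU (pullback_bundle f ?Y P)"
    by (auto simp: Prin_map_def)
  have numP: "D_numerable G X P" using cP P(1) by (auto simp: Prin_def bundle_rel_def elim!: quotientE)
  interpret PG: Gspace G X P
    using numP X by unfold_locales (auto simp: D_numerable_def principal_bundle_def diffeological_space_def)
  obtain fP \<gamma>P where "charted G X P fP \<gamma>P" using PG.charted_of_D_numerable[OF numP] by blast
  then interpret P: charted G X P fP \<gamma>P .
  obtain \<Psi> where \<Psi>: "smooth (tot P) (EG G) \<Psi>"
    "\<And>x a. x \<in> pts (tot P) \<Longrightarrow> a \<in> carrier G \<Longrightarrow> \<Psi> (act P x a) = EG_act G (\<Psi> x) a"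
    using P.classifying_map by metis
  have \<Psi>p: "\<Psi> x \<in> pts (EG G)" if "x \<in> pts (tot P)" for x using smooth_pts[OF \<Psi>(1) that] .
  \<comment> \<open>The map of bases induced by \<Psi>; this is the candidate for the homotopy
    inverse of \<open>f\<close>.\<close>
  obtain g where g: "smooth X (BG G) g" "\<And>x. x \<in> pts (tot P) \<Longrightarrow> g (prj P x) = prj EGB (\<Psi> x)"
  proof (rule subduction_descend[OF X PG.total diffeological_space_BG P.subd
        smooth_compose[OF \<Psi>(1) subduction_smooth[OF subduction_EGB]]])
    fix x y assume xy: "x \<in> pts (tot P)" "y \<in> pts (tot P)" "prj P x = prj P y"
    obtain a where "a \<in> carrier G" "y = act P x a" using P.transitive[OF xy] by blast
    then show "prj EGB (\<Psi> x) = prj EGB (\<Psi> y)" using xy \<Psi>(2) EGB_prj_act[OF \<Psi>p] by simp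
  qed blast
  let ?g = "\<lambda>x. j (g x)"
  have gs: "smooth X ?Y ?g" by (rule smooth_compose[OF g(1) J(2)])
  have "bundle_isomorphic G P (pullback_bundle ?g X ?EU)"
  proof (rule EU.pullback_isomorphic[OF P.Gtorsor_axioms gs, of "\<lambda>x. i (\<Psi> x)"])
    show "smooth (tot P) (tot ?EU) (\<lambda>x. i (\<Psi> x))" unfolding totEU by (rule smooth_compose[OF \<Psi>(1) I(2)])
  qed (use \<Psi> \<Psi>p g in \<open>simp_all add: actEU prjEU\<close>)
  \<comment> \<open>By naturality along \<open>?g\<close>, the bundle \<open>P\<close> therefore
    also belongs to the class of \<open>f \<circ> ?g\<close>.\<close>
  then have "P \<in> Prin_map G X ?g ?cE" using numP EUc by (auto simp: Prin_map_def)
  moreover have "\<Phi> X (htpy_rel X X `` {f \<circ> ?g}) = Prin_map G X ?g ?cE"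
    using natural[OF J(1) X gs f(1)] f(2) by simp
  ultimately have P2: "P \<in> \<Phi> X (htpy_rel X X `` {f \<circ> ?g})" by simp
  have fgs: "smooth X X (f \<circ> ?g)" using smooth_compose[OF gs f(1)] by (simp add: comp_def)
  then have fgc: "htpy_rel X X `` {f \<circ> ?g} \<in> htpy_classes X X"
    unfolding htpy_classes_def by (intro quotientI) simp
  then have "\<Phi> X (htpy_rel X X `` {f \<circ> ?g}) \<in> Prin G X" using bij_betwE[OF bij[OF X]] by blast
  \<comment> \<open>Both are isomorphism classes and share the member \<open>P\<close>, so they are
    equal, and injectivity of \<Phi> applies.\<close>
  then have "\<Phi> X (htpy_rel X X `` {f \<circ> ?g}) = \<Phi> X ?id"
    using quotient_disj[OF equiv_bundle_rel, of _ G X] cP P(1) P2 unfolding Prin_def by blast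
  then have "htpy_rel X X `` {f \<circ> ?g} = ?id"
    using bij_betw_imp_inj_on[OF bij[OF X]] fgc idc by (meson inj_onD)
  \<comment> \<open>Reflexivity puts the identity into the common class, which turns the equality of
    classes into an actual homotopy.\<close>
  moreover have "(\<lambda>x. x) \<in> ?id" using htpy_rel_refl[OF smooth_id] by blast
  ultimately have XX: "smoothly_homotopic X X (f \<circ> ?g) (\<lambda>x. x)" by (auto simp: htpy_rel_def)
  \<comment> \<open>For the composite on \<open>BG\<close>: the isomorphism of \<open>?EU\<close>
    with the pullback of \<open>P\<close>, followed by the projection to \<open>P\<close> and by
    \<Psi>, is an equivariant self-map of \<open>EG\<close> that covers \<open>g\<close> after
    \<open>f\<close> after \<open>j\<close>.\<close>
  obtain \<phi> where \<phi>: "smooth (tot ?EU) (tot (pullback_bundle f ?Y P)) \<phi>"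
    "\<And>x. x \<in> pts (tot ?EU) \<Longrightarrow> fst (\<phi> x) = prj ?EU x"
    "\<And>x a. x \<in> pts (tot ?EU) \<Longrightarrow> a \<in> carrier G \<Longrightarrow> \<phi> (act ?EU x a) = (fst (\<phi> x), act P (snd (\<phi> x)) a)"
    using P(2) unfolding bundle_isomorphic_def diffeomorphism_def
    by (auto simp: pullback_bundle_def case_prod_unfold)
  have \<phi>p: "snd (\<phi> (i x)) \<in> pts (tot P)" "f (fst (\<phi> (i x))) = prj P (snd (\<phi> (i x)))" if "x \<in> pts (EG G)" for x
    using smooth_pts[OF \<phi>(1), of "i x"] that by (auto simp: totEU pullback_bundle_def)
  have snds: "smooth (tot (pullback_bundle f ?Y P)) (tot P) snd"
    unfolding pullback_bundle_def gbundle.simps by (rule smooth_from_sub[OF smooth_snd])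
  have BB: "smoothly_homotopic (BG G) (BG G) (\<lambda>b. g (f (j b))) (\<lambda>b. b)"
  proof (rule equivariant_self_map_homotopic_id)
    show "smooth (EG G) (EG G) (\<lambda>x. \<Psi> (snd (\<phi> (i x))))"
      using smooth_compose[OF smooth_compose[OF smooth_compose[OF I(2)[folded totEU] \<phi>(1)] snds] \<Psi>(1)] .
    show "\<Psi> (snd (\<phi> (i (EG_act G x a)))) = EG_act G (\<Psi> (snd (\<phi> (i x)))) a" if "x \<in> pts (EG G)" "a \<in> carrier G" for x a
      using that \<phi>(3)[of "i x" a] \<phi>p[OF that(1)] by (simp add: totEU actEU \<Psi>(2))
    show "prj EGB (\<Psi> (snd (\<phi> (i x)))) = g (f (j (prj EGB x)))" if x: "x \<in> pts (EG G)" for x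
      using \<phi>p[OF x] g(2) \<phi>(2)[of "i x"] x by (simp add: totEU prjEU[symmetric])
  qed
  show ?thesis
    unfolding smoothly_homotopy_equivalent_def
  proof (intro exI conjI)
    show "smooth X (BG G) g" by (rule g(1))
    show "smooth (BG G) X (\<lambda>b. f (j b))" by (rule smooth_compose[OF J(2) f(1)])
    show "smoothly_homotopic X X ((\<lambda>b. f (j b)) \<circ> g) (\<lambda>x. x)" using XX by (simp add: comp_def)
    show "smoothly_homotopic (BG G) (BG G) (g \<circ> (\<lambda>b. f (j b))) (\<lambda>y. y)" using BB by (simp add: comp_def)
  qed
qed

end
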